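(* Let $S'=\{n\in S:\ \text{every prime } p\mid n \text{ satisfies } p\equiv 1 \pmod 4\}$, let $l\geq2$ be an integer and $\epsilon>0$, and define $c(l)=c(l,\epsilon)$ by $c(2)=\log2+\epsilon$, $c(3)=\frac32\log 2+\epsilon$ and $c(l)=\frac{l}{2}\log 2+c(\lfloor l/2\rfloor)+\epsilon$ for $l\ge4$. Then there exists a subset of $S'$ of relative density one in $S'$ such that for every $n$ in it, $$\mathcal{Q}\big(l,n,\,n^{1/2}/(\log n)^{c(l)}\big)=\emptyset.$$
   Context: $S=\{a^2+b^2:a,b\in\mathbb{Z}\}$. For $n\in S$, $K>0$ and an integer $l\ge1$, $$\mathcal{Q}(l,n,K)=\{(\xi_1,\dots,\xi_l)\in(\mathbb{Z}^2)^l: |\xi_i|^2=n\ \forall i,\ 0<|\xi_1+\dots+\xi_l|\le K\}.$$ A subset $A\subseteq S'$ has relative density one in $S'$ if $\#\{n\in A:n\le X\}/\#\{n\in S':n\le X\}\to1$ as $X\to\infty$. *)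

theory Defs
  imports "HOL-Analysis.Analysis" "HOL-Number_Theory.Number_Theory"
begin

definition sums_two_squares :: "nat set" where
  "sums_two_squares = {n. \<exists>a b :: int. int n = a\<^sup>2 + b\<^sup>2}"

(* 0 is not a member, since every prime divides 0. *)
definition sums_two_squares' :: "nat set" where
  "sums_two_squares' = {n \<in> sums_two_squares. \<forall>p. prime p \<and> p dvd n \<longrightarrow> [p = 1] (mod 4)}"

(* Euclidean length of a lattice point; the norm on real * real is the Euclidean one. *)
definition lattice_norm :: "int \<times> int \<Rightarrow> real" where
  "lattice_norm v = norm (real_of_int (fst v), real_of_int (snd v))"

(* An l-tuple of lattice points is a list of length l. *)
definition quasi_corr :: "nat \<Rightarrow> nat \<Rightarrow> real \<Rightarrow> (int \<times> int) list set" where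
  "quasi_corr l n K =
     {\<xi>. length \<xi> = l \<and> (\<forall>i<l. (lattice_norm (\<xi> ! i))\<^sup>2 = real n) \<and>
         0 < lattice_norm (\<Sum>i<l. \<xi> ! i) \<and> lattice_norm (\<Sum>i<l. \<xi> ! i) \<le> K}"

definition relative_density_one :: "nat set \<Rightarrow> nat set \<Rightarrow> bool" where
  "relative_density_one A B \<longleftrightarrow> A \<subseteq> B \<and>
     ((\<lambda>X :: real. real (card {n \<in> A. real n \<le> X}) / real (card {n \<in> B. real n \<le> X}))
        \<longlongrightarrow> 1) at_top"

(* Meaningful for l \<ge> 2 only; the value 0 for l < 2 is a dummy, never reached by
   the recursion started at some l \<ge> 2. *)
function c_exp :: "real \<Rightarrow> nat \<Rightarrow> real" where
  "c_exp \<epsilon> l =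
     (if l < 2 then 0
      else if l = 2 then ln 2 + \<epsilon>
      else if l = 3 then 3 / 2 * ln 2 + \<epsilon>
      else real l / 2 * ln 2 + c_exp \<epsilon> (l div 2) + \<epsilon>)"
  by pat_completeness auto
termination by (relation "Wellfounded.measure snd") auto

declare c_exp.simps [simp del]

end

(*
  A short sum z_1 + ... + z_l of Gaussian integers of norm n constrains the angle of a prime
  divisor of n. If p = |pi|^2 divides n, then each z_i is pi * w_i or cnj pi * w_i with
  |w_i|^2 = n/p, so the sum is pi * A + cnj pi * B. When both A and B are nonzero, say with
  |A| >= sqrt(n/p) / (log n)^c', smallness of the sum puts pi/cnj pi into an arc of length
  (log n)^(c' - c) determined by n/p, the w_i and the index set. One of A, B is a sum of at most
  l/2 terms, so by induction on l one may take c' = c(l div 2). A typical n has about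
  (1/2) log log n prime factors, hence at most (log n)^((l/2) log 2 + o(1)) such arcs, and an upper
  bound sieve shows that Gaussian primes have the expected density, up to (log n)^o(1), in each
  arc. Summing over p and n/p, the exponent c(l) - c(l div 2) = (l/2) log 2 + eps suffices.

  If the tuple splits trivially (all pi or all cnj pi) at every prime above a power of log n, those
  primes are a common factor and can be removed. The argument is repeated for the primes in
  (exp(sqrt(log log n)), (log n)^A]; there a typical n has very few prime factors, and the trivial
  bound for primes in an arc is enough. If these primes also split trivially, a nonzero Gaussian
  integer of norm less than 1 remains, which is absurd.
*)

theory Submission
  imports Defs "HOL-Real_Asymp.Real_Asymp"
begin

section \<open>Mertens estimates modulo 4\<close>

text \<open>All exceptional sets are compared with N / sqrt(log N), the order of the counting
  function of S', so a lower bound of that order is needed too; it is obtained elementarily. A loss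
  of (log N)^eta with small eta is harmless because eps leaves that much room, so Chebyshev and
  Mertens estimates together with Brun's pure sieve take the place of a prime number theorem for
  sectors. The threshold (log n)^A comes from the sieve: for primes near Y it needs arcs of length
  at least Y^(-1/4), which gives A = 4 (c(l) - c(l div 2)). Below it, the trivial bound retains one
  lattice point per row however short the arc is, a relative saving of only Y^(-1/2). The lower end
  exp(sqrt(log log n)) balances two demands. A typical n has at most (log log n)^(1/4) prime factors
  below (log n)^A, so the exp(O((log log n)^(1/4))) arcs lose against the saving exp(-sqrt(log log
  n) / 2). On the other hand, the part of n below both ends is at most exp((log log n)^(3/4)), which
  is (log n)^o(1).\<close>

abbreviation Lam :: "nat \<Rightarrow> real" where "Lam \<equiv> mangoldt"

text \<open>With n = d m, the pairs (n, d) with d dividing n correspond to the pairs (d, m) with d m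
  <= N. Each use below opens a Dirichlet convolution.\<close>

lemma sum_divisors_swap:
  fixes F :: "nat \<Rightarrow> nat \<Rightarrow> 'a :: comm_monoid_add"
  shows "(\<Sum>n=1..N. \<Sum>d | d dvd n. F d (n div d)) = (\<Sum>d=1..N. \<Sum>m=1..N div d. F d m)"
proof -
  have fin: "finite {d. d dvd n}" if "n \<in> {1..N}" for n :: nat
    using that by auto
  have "(\<Sum>n=1..N. \<Sum>d | d dvd n. F d (n div d)) =
        (\<Sum>(n,d)\<in>(SIGMA n:{1..N}. {d. d dvd n}). F d (n div d))"
    using fin by (subst sum.Sigma) auto
  also have "\<dots> = (\<Sum>(d,m)\<in>(SIGMA d:{1..N}. {1..N div d}). F d m)"
  proof (rule sum.reindex_bij_witness[where i = "\<lambda>(d,m). (d * m, d)" and j = "\<lambda>(n,d). (d, n div d)"], goal_cases)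
    case (1 a) then show ?case by auto
  next
    case (2 a)
    then obtain n d where a: "a = (n,d)" "1 \<le> n" "n \<le> N" "d dvd n" by auto
    have "d \<le> n" "d > 0" using a by (auto intro: dvd_imp_le dvd_pos_nat)
    then have "d \<le> N" "1 \<le> n div d" "n div d \<le> N div d" using a
      by (auto simp: div_le_mono Suc_le_eq div_greater_zero_iff)
    then show ?case using a \<open>d > 0\<close> by simp
  next
    case (3 b) then show ?case by auto
  next
    case (4 b)
    then obtain d m where b: "b = (d,m)" "1 \<le> d" "d \<le> N" "1 \<le> m" "m \<le> N div d" by auto
    then have "d * m \<le> N"
      using less_eq_div_iff_mult_less_eq[of d m N] by (simp add: mult.commute)
    then show ?case using b by auto
  next
    case (5 a) then show ?case by auto
  qed
  also have "\<dots> = (\<Sum>d=1..N. \<Sum>m=1..N div d. F d m)"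
    by (subst sum.Sigma) auto
  finally show ?thesis .
qed

section \<open>Chebyshev's bound and Mertens' first theorem\<close>

definition psi :: "nat \<Rightarrow> real" where "psi N = (\<Sum>d=1..N. Lam d)"

lemma sum_ln_eq: "(\<Sum>n=1..N. ln (real n)) = (\<Sum>d=1..N. Lam d * real (N div d))"
proof -
  have "(\<Sum>n=1..N. ln (real n)) = (\<Sum>n=1..N. \<Sum>d | d dvd n. Lam d)"
    by (intro sum.cong refl, subst mangoldt_sum) auto
  also have "\<dots> = (\<Sum>d=1..N. \<Sum>m=1..N div d. Lam d)"
    by (rule sum_divisors_swap)
  finally show ?thesis by (simp add: mult.commute)
qed

lemma sum_ln_fact: "(\<Sum>n=1..N. ln (real n)) = ln (fact N)"
proof (induction N)
  case (Suc N)
  have "ln (fact (Suc N) :: real) = ln (real (Suc N)) + ln (fact N)"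
    by (subst fact_Suc, subst ln_mult) auto
  then show ?case using Suc by simp
qed simp

text \<open>Chebyshev's argument: \<open>2 * n div d - 2 * (n div d)\<close> is never negative and
  equals 1 for n < d <= 2 n, so the von Mangoldt sum over that range is at most the logarithm of the
  central binomial coefficient, which is below 4^n.\<close>

lemma psi_double: "psi (2 * n) - psi n \<le> 2 * ln 2 * real n"
proof -
  \<comment> \<open>\<open>n div d\<close> is 0 for d > n, so the expansion of log n! may run up to
    2 n and be compared termwise with that of log (2 n)!.\<close>
  have ext: "(\<Sum>d=1..n. Lam d * real (n div d)) = (\<Sum>d=1..2*n. Lam d * real (n div d))"
    by (rule sum.mono_neutral_left) auto
  have "psi (2 * n) = psi n + (\<Sum>d=n+1..2*n. Lam d)"
    unfolding psi_def using sum.ub_add_nat[of 1 n Lam n] by (simp add: mult_2)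
  moreover have "(\<Sum>d=n+1..2*n. Lam d) \<le> (\<Sum>d=1..2*n. Lam d * (real (2 * n div d) - 2 * real (n div d)))"
  proof -
    have "(\<Sum>d=n+1..2*n. Lam d) = (\<Sum>d=n+1..2*n. Lam d * (real (2 * n div d) - 2 * real (n div d)))"
    proof (rule sum.cong[OF refl])
      fix d assume d: "d \<in> {n+1..2*n}"
      have "2 * n div d = 1" using d
        by (intro div_nat_eqI) auto
      moreover have "n div d = 0" using d by auto
      ultimately show "Lam d = Lam d * (real (2 * n div d) - 2 * real (n div d))" by simp
    qed
    also have "\<dots> \<le> (\<Sum>d=1..2*n. Lam d * (real (2 * n div d) - 2 * real (n div d)))"
    proof (rule sum_mono2)
      fix d assume "d \<in> {1..2*n} - {n+1..2*n}"
      have "2 * (n div d) \<le> 2 * n div d"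
      proof (cases "d = 0")
        case False
        have "2 * (n div d) * d \<le> 2 * n"
          using div_times_less_eq_dividend[of n d] by (simp add: mult.assoc)
        then show ?thesis using False by (simp add: less_eq_div_iff_mult_less_eq)
      qed simp
      then have "0 \<le> real (2 * n div d) - 2 * real (n div d)" by linarith
      then show "0 \<le> Lam d * (real (2 * n div d) - 2 * real (n div d))"
        by (intro mult_nonneg_nonneg mangoldt_nonneg)
    qed auto
    finally show ?thesis .
  qed
  moreover have "(\<Sum>d=1..2*n. Lam d * (real (2 * n div d) - 2 * real (n div d)))
     = ln (fact (2 * n)) - 2 * ln (fact n)"
    unfolding sum_ln_fact[symmetric] sum_ln_eq ext
    by (simp add: right_diff_distrib sum_subtractf sum_distrib_left mult_ac)
  moreover have "ln (fact (2 * n)) - 2 * ln (fact n) \<le> 2 * ln 2 * real n"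
  proof -
    have "fact (2 * n) = fact n * fact n * (2 * n choose n)"
      using binomial_fact_lemma[of n "2*n"] by (simp add: mult_2)
    then have "(fact (2 * n) :: real) = fact n * fact n * real (2 * n choose n)"
      by (metis of_nat_fact of_nat_mult)
    then have "ln (fact (2 * n)) = 2 * ln (fact n) + ln (real (2 * n choose n))"
      by (simp add: ln_mult)
    moreover have "ln (real (2 * n choose n)) \<le> ln (2 ^ (2 * n))"
      using binomial_le_pow2[of "2*n" n] by (subst ln_le_cancel_iff) (auto simp flip: of_nat_le_iff simp: zero_less_binomial)
    ultimately show ?thesis by (simp add: ln_realpow mult_ac)
  qed
  ultimately show ?thesis by linarith
qed

text \<open>Induction through m = n div 2. With ln 2 <= 0.7 doubling gives at most 4.4 m, well below
  6 m; the slack pays for the one extra term when n = 2 m + 1.\<close>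

lemma psi_le: "psi n \<le> 3 * real n"
proof (induction n rule: less_induct)
  case (less n)
  show ?case
  proof (cases "n \<le> 1")
    case True
    then have "n = 0 \<or> n = 1" by auto
    then show ?thesis by (auto simp: psi_def)
  next
    case False
    define m where "m = n div 2"
    have m: "m < n" "m \<ge> 1" using False by (auto simp: m_def)
    have l2: "ln 2 \<le> (0.7 :: real)" using ln2_le_25_over_36 by simp
    have a: "psi (2 * m) \<le> 3 * real m + 1.4 * real m"
      using less[OF m(1)] psi_double[of m] mult_right_mono[OF l2, of "real m"] by simp
    show ?thesis
    proof (cases "even n")
      case True
      then have "n = 2 * m" by (simp add: m_def)
      then show ?thesis using a m by simp
    next
      case False
      then have n: "n = 2 * m + 1" by (simp add: m_def)
      have "psi n = psi (2 * m) + Lam n" by (simp add: n psi_def)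
      moreover have "Lam n \<le> ln (real n)" using n by (intro mangoldt_le) auto
      moreover have "ln (real n) \<le> 0.7 + (real m + 1/2 - 1)"
      proof -
        have "real n = 2 * (real m + 1/2)" using n by simp
        then have "ln (real n) = ln 2 + ln (real m + 1/2)" by (simp only: ln_mult_pos)
        moreover have "ln (real m + 1/2) \<le> real m + 1/2 - 1" by (intro ln_le_minus_one) auto
        ultimately show ?thesis using l2 by linarith
      qed
      moreover have "real n = 2 * real m + 1" using n by simp
      ultimately show ?thesis using a m(2) by linarith
    qed
  qed
qed

lemma ln_fact_lower: "real n * ln (real n) - real n \<le> ln (fact n)"
proof (induction n)
  case (Suc n)
  show ?case
  proof (cases "n = 0")
    case False
    have "ln (real n + 1) - ln (real n) = ln (1 + 1 / real n)"
      using False ln_div[of "real n + 1" "real n"] by (simp add: add_divide_distrib add.commute)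
    also have "\<dots> \<le> 1 / real n" by (rule ln_add_one_self_le_self) auto
    finally have "real n * (ln (real n + 1) - ln (real n)) \<le> 1" using False by (simp add: field_simps)
    moreover have "ln (fact (Suc n) :: real) = ln (real n + 1) + ln (fact n)"
      by (subst fact_Suc) (simp add: ln_mult add_ac)
    ultimately show ?thesis using Suc by (simp add: algebra_simps)
  qed simp
qed simp

lemma real_div_le_Suc: "real n / real d \<le> real (n div d) + 1"
proof (cases "d = 0")
  case False
  have "n < (n div d + 1) * d"
    using False by (simp add: dividend_less_div_times)
  then have "real n < (real (n div d) + 1) * real d"
    by (metis of_nat_1 of_nat_add of_nat_less_iff of_nat_mult)
  then show ?thesis using False by (simp add: field_simps)
qed simp

text \<open>Dropping the floor in log N! = sum of \<open>Lam d * (N div d)\<close> changes it by at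
  most \<open>psi N\<close>, which is O(N); dividing by N and using Stirling-type bounds for log N!
  leaves a bounded error.\<close>

lemma mertens_Lam:
  assumes "N \<ge> 1"
  shows "\<bar>(\<Sum>d=1..N. Lam d / real d) - ln (real N)\<bar> \<le> 3"
proof -
  have N: "real N > 0" using assms by simp
  have up: "real N * (\<Sum>d=1..N. Lam d / real d) \<le> ln (fact N) + psi N"
  proof -
    have "real N * (\<Sum>d=1..N. Lam d / real d) \<le> (\<Sum>d=1..N. Lam d * real (N div d) + Lam d)"
      unfolding sum_distrib_left
    proof (rule sum_mono)
      fix d assume d: "d \<in> {1..N}"
      have "real N / real d \<le> real (N div d) + 1"
        using real_div_le_Suc[of N d] .
      then have "Lam d * (real N / real d) \<le> Lam d * (real (N div d) + 1)"
        by (rule mult_left_mono[OF _ mangoldt_nonneg])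
      then show "real N * (Lam d / real d) \<le> Lam d * real (N div d) + Lam d"
        by (simp add: algebra_simps)
    qed
    then show ?thesis unfolding sum.distrib sum_ln_eq[symmetric] sum_ln_fact psi_def .
  qed
  have lo: "ln (fact N) \<le> real N * (\<Sum>d=1..N. Lam d / real d)"
    unfolding sum_distrib_left sum_ln_fact[symmetric] sum_ln_eq
  proof (rule sum_mono)
    fix d assume d: "d \<in> {1..N}"
    have "real (N div d) \<le> real N / real d" by (rule of_nat_div_le_of_nat)
    then have "Lam d * real (N div d) \<le> Lam d * (real N / real d)"
      by (rule mult_left_mono[OF _ mangoldt_nonneg])
    then show "Lam d * real (N div d) \<le> real N * (Lam d / real d)" by (simp add: mult_ac)
  qed
  have "real N * ln (real N) - real N \<le> real N * (\<Sum>d=1..N. Lam d / real d)"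
    using lo ln_fact_lower[of N] by linarith
  then have 1: "ln (real N) - 1 \<le> (\<Sum>d=1..N. Lam d / real d)"
    using N mult_le_cancel_left_pos[OF N, of "ln (real N) - 1"] by (simp add: right_diff_distrib)
  have "ln (fact N :: real) \<le> real N * ln (real N)"
  proof -
    have "ln (fact N :: real) = (\<Sum>n=1..N. ln (real n))" by (rule sum_ln_fact[symmetric])
    also have "\<dots> \<le> (\<Sum>n=1..N. ln (real N))" by (rule sum_mono) auto
    finally show ?thesis by simp
  qed
  then have "real N * (\<Sum>d=1..N. Lam d / real d) \<le> real N * (ln (real N) + 3)"
    using up psi_le[of N] by (simp add: algebra_simps)
  then have 2: "(\<Sum>d=1..N. Lam d / real d) \<le> ln (real N) + 3" using N by simp
  show ?thesis using 1 2 by linarith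
qed

text \<open>Summation by parts; the increments of a nonincreasing weight telescope to
  \<open>b m - b n\<close>, and the remaining boundary term supplies the missing
  \<open>C * b n\<close>.\<close>

lemma abel_bound:
  fixes a b :: "nat \<Rightarrow> real"
  assumes part: "\<And>n. n \<ge> m \<Longrightarrow> \<bar>\<Sum>i=m..n. a i\<bar> \<le> C"
    and dec: "\<And>i. i \<ge> m \<Longrightarrow> b (Suc i) \<le> b i" and pos: "\<And>i. i \<ge> m \<Longrightarrow> b i \<ge> 0"
  shows "\<bar>\<Sum>i=m..n. a i * b i\<bar> \<le> C * b m"
proof (cases "n \<ge> m")
  case True
  have C: "C \<ge> 0" using part[of m] by linarith
  have "(\<Sum>i=m..n. a i * b i) = (\<Sum>i=m..n. a i) * b n + (\<Sum>k=m..<n. (\<Sum>i=m..k. a i) * (b k - b (Suc k)))"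
    using True
  proof (induction n rule: dec_induct)
    case (step n)
    then show ?case by (simp add: algebra_simps)
  qed simp
  also have "\<bar>\<dots>\<bar> \<le> \<bar>\<Sum>i=m..n. a i\<bar> * b n + (\<Sum>k=m..<n. \<bar>\<Sum>i=m..k. a i\<bar> * (b k - b (Suc k)))"
  proof -
    have "\<bar>\<Sum>k=m..<n. (\<Sum>i=m..k. a i) * (b k - b (Suc k))\<bar> \<le> (\<Sum>k=m..<n. \<bar>(\<Sum>i=m..k. a i) * (b k - b (Suc k))\<bar>)"
      by (rule sum_abs)
    also have "\<dots> = (\<Sum>k=m..<n. \<bar>\<Sum>i=m..k. a i\<bar> * (b k - b (Suc k)))"
      using dec by (intro sum.cong) (auto simp: abs_mult)
    finally have *: "\<bar>\<Sum>k=m..<n. (\<Sum>i=m..k. a i) * (b k - b (Suc k))\<bar> \<le> \<dots>" .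
    have "\<bar>(\<Sum>i=m..n. a i) * b n\<bar> = \<bar>\<Sum>i=m..n. a i\<bar> * b n"
      using pos[OF True] by (simp add: abs_mult)
    then show ?thesis using * by linarith
  qed
  also have "\<dots> \<le> C * b n + (\<Sum>k=m..<n. C * (b k - b (Suc k)))"
    using True part pos dec by (intro add_mono sum_mono mult_right_mono) auto
  also have "(\<Sum>k=m..<n. C * (b k - b (Suc k))) = C * (b m - b n)"
    unfolding sum_distrib_left[symmetric] using sum_Suc_diff'[OF True, of "\<lambda>i. - b i"] by simp
  finally show ?thesis by (simp add: algebra_simps)
next
  case False
  then show ?thesis using part[of m] pos[of m] by auto
qed

section \<open>From sums over prime powers to sums over primes\<close>

definition primes_upto :: "nat \<Rightarrow> nat set" where "primes_upto N = {q. prime q \<and> q \<le> N}"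

lemma finite_primes_upto [simp]: "finite (primes_upto N)"
  unfolding primes_upto_def by simp

lemma finite_pow_le: "prime (q::nat) \<Longrightarrow> finite {k. i \<le> k \<and> q ^ k \<le> N}"
proof (rule finite_subset[of _ "{..N}"])
  assume q: "prime q"
  show "{k. i \<le> k \<and> q ^ k \<le> N} \<subseteq> {..N}"
  proof
    fix k assume "k \<in> {k. i \<le> k \<and> q ^ k \<le> N}"
    then have "q ^ k \<le> N" by simp
    moreover have "k < (2::nat) ^ k" by (rule less_exp)
    moreover have "2 ^ k \<le> q ^ k" using prime_ge_2_nat[OF q] by (rule power_mono) simp
    ultimately have "k \<le> N" by linarith
    then show "k \<in> {..N}" by simp
  qed
qed simp

lemma sum_mangoldt:
  fixes h :: "nat \<Rightarrow> real"
  shows "(\<Sum>d=1..N. Lam d * h d) =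
    (\<Sum>q\<in>primes_upto N. ln (real q) * (\<Sum>k | 1 \<le> k \<and> q ^ k \<le> N. h (q ^ k)))"
proof -
  let ?A = "SIGMA q:primes_upto N. {k. 1 \<le> k \<and> q ^ k \<le> N}"
  have inj: "inj_on (\<lambda>(q,k). q ^ k) ?A"
  proof (rule inj_onI)
    fix a b assume "a \<in> ?A" "b \<in> ?A" "(\<lambda>(q,k). q ^ k) a = (\<lambda>(q,k). q ^ k) b"
    then show "a = b"
      using prime_power_inj'[of "fst a" "fst b" "snd a" "snd b"]
      by (cases a; cases b) (simp add: primes_upto_def)
  qed
  have im: "(\<lambda>(q,k). q ^ k) ` ?A = {d\<in>{1..N}. primepow d}"
  proof (intro equalityI subsetI)
    fix d assume "d \<in> {d\<in>{1..N}. primepow d}"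
    then obtain p k where d: "prime p" "k > 0" "d = p ^ k" "d \<le> N"
      by (auto simp: primepow_def)
    have "p \<le> d" using d self_le_power[of p k] prime_gt_0_nat[of p] by (simp add: Suc_le_eq)
    then show "d \<in> (\<lambda>(q,k). q ^ k) ` ?A" using d
      by (auto simp: primes_upto_def intro!: image_eqI[of _ _ "(p,k)"])
  next
    fix d assume "d \<in> (\<lambda>(q,k). q ^ k) ` ?A"
    then show "d \<in> {d\<in>{1..N}. primepow d}"
      by (auto simp: primes_upto_def Suc_le_eq prime_gt_0_nat)
  qed
  have "(\<Sum>d=1..N. Lam d * h d) = (\<Sum>d\<in>{d\<in>{1..N}. primepow d}. Lam d * h d)"
    by (rule sum.mono_neutral_right) (auto simp: mangoldt_def)
  also have "\<dots> = (\<Sum>(q,k)\<in>?A. Lam (q ^ k) * h (q ^ k))"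
    unfolding im[symmetric] by (subst sum.reindex[OF inj]) (simp add: case_prod_unfold comp_def)
  also have "\<dots> = (\<Sum>(q,k)\<in>?A. ln (real q) * h (q ^ k))"
    by (intro sum.cong refl) (auto simp: primes_upto_def mangoldt_primepow)
  also have "\<dots> = (\<Sum>q\<in>primes_upto N. \<Sum>k | 1 \<le> k \<and> q ^ k \<le> N. ln (real q) * h (q ^ k))"
    by (subst sum.Sigma) (auto simp: primes_upto_def intro!: finite_pow_le)
  finally show ?thesis by (simp add: sum_distrib_left)
qed

lemma geometric_tail_le:
  fixes x :: real
  assumes "0 \<le> x" "x \<le> 1/2" "finite A" "A \<subseteq> {2..}"
  shows "(\<Sum>k\<in>A. x ^ k) \<le> 2 * x\<^sup>2"
proof -
  obtain M where M: "A \<subseteq> {..<M}" using assms(3) by (meson finite_nat_iff_bounded)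
  have "(\<Sum>k\<in>A. x ^ k) \<le> (\<Sum>k\<in>{2..<M+2}. x ^ k)"
    using assms M by (intro sum_mono2) fastforce+
  also have "\<dots> = (\<Sum>k<M. x ^ (k + 2))"
    using sum.shift_bounds_nat_ivl[of "\<lambda>k. x ^ k" 0 2 M] unfolding atLeast0LessThan by (simp only: add_0)
  also have "\<dots> = x\<^sup>2 * (\<Sum>k<M. x ^ k)"
    by (simp add: sum_distrib_left power_add power2_eq_square mult_ac)
  also have "(\<Sum>k<M. x ^ k) \<le> 2"
  proof -
    have "(1 - x) * (\<Sum>k<M. x ^ k) = 1 - x ^ M" by (rule one_diff_power_eq[symmetric])
    moreover have "0 \<le> (\<Sum>k<M. x ^ k)" using assms by (intro sum_nonneg) auto
    then have "1/2 * (\<Sum>k<M. x ^ k) \<le> (1 - x) * (\<Sum>k<M. x ^ k)"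
      using assms by (intro mult_right_mono) auto
    moreover have "0 \<le> x ^ M" using assms by simp
    ultimately show ?thesis by linarith
  qed
  then have "x\<^sup>2 * (\<Sum>k<M. x ^ k) \<le> x\<^sup>2 * 2" by (intro mult_left_mono) auto
  finally show ?thesis by simp
qed

lemma ln_over_square_bounded: "\<exists>K\<ge>0. \<forall>A. finite A \<longrightarrow> 0 \<notin> A \<longrightarrow> (\<Sum>n\<in>A. ln (real n) / (real n)\<^sup>2) \<le> K"
proof -
  have s: "summable (\<lambda>n. ln (real n) / (real n)\<^sup>2)"
  proof (rule summable_comparison_test_bigo)
    show "summable (\<lambda>n. norm (real n powr (-(3/2))))"
      by (simp add: summable_real_powr_iff)
    show "(\<lambda>n. ln (real n) / (real n)\<^sup>2) \<in> O(\<lambda>n. real n powr (-(3/2)))"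
      by real_asymp
  qed
  have nn: "0 \<le> ln (real n) / (real n)\<^sup>2" for n
    by (cases "n = 0") auto
  show ?thesis
  proof (intro exI[of _ "suminf (\<lambda>n. ln (real n) / (real n)\<^sup>2)"] conjI allI impI)
    show "0 \<le> (\<Sum>n. ln (real n) / (real n)\<^sup>2)" using s nn by (intro suminf_nonneg)
    fix A :: "nat set" assume "finite A" "0 \<notin> A"
    then show "(\<Sum>n\<in>A. ln (real n) / (real n)\<^sup>2) \<le> (\<Sum>n. ln (real n) / (real n)\<^sup>2)"
      using s nn by (intro sum_le_suminf) auto
  qed
qed

text \<open>The inner sums are geometric from the square on, with ratio at most 1/2, hence at most 8
  / q^2. The bound \<open>g q \<le> real q / 2\<close> is what keeps the ratio under control at q =
  2 and q = 3. The constant must not depend on g, since g will vary with N.\<close>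

lemma prime_power_tail:
  "\<exists>K\<ge>0. \<forall>N g. (\<forall>q. prime q \<longrightarrow> 0 \<le> g q \<and> g q \<le> 2 \<and> g q \<le> real q / 2) \<longrightarrow>
     (\<Sum>q\<in>primes_upto N. ln (real q) * (\<Sum>k | 2 \<le> k \<and> q ^ k \<le> N. (g q / real q) ^ k)) \<le> K"
proof -
  obtain K where K: "K \<ge> 0" "\<And>A. finite A \<Longrightarrow> 0 \<notin> A \<Longrightarrow> (\<Sum>n\<in>A. ln (real n) / (real n)\<^sup>2) \<le> K"
    using ln_over_square_bounded by blast
  show ?thesis
  proof (intro exI[of _ "8 * K"] conjI allI impI)
    show "0 \<le> 8 * K" using K by simp
  next
    fix N and g :: "nat \<Rightarrow> real" assume g: "\<forall>q. prime q \<longrightarrow> 0 \<le> g q \<and> g q \<le> 2 \<and> g q \<le> real q / 2"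
    have "(\<Sum>q\<in>primes_upto N. ln (real q) * (\<Sum>k | 2 \<le> k \<and> q ^ k \<le> N. (g q / real q) ^ k))
       \<le> (\<Sum>q\<in>primes_upto N. 8 * (ln (real q) / (real q)\<^sup>2))"
    proof (rule sum_mono)
      fix q assume "q \<in> primes_upto N"
      then have q: "prime q" by (simp add: primes_upto_def)
      then have q0: "real q \<ge> 1" using prime_gt_0_nat[of q] by linarith
      have "(\<Sum>k | 2 \<le> k \<and> q ^ k \<le> N. (g q / real q) ^ k) \<le> 2 * (g q / real q)\<^sup>2"
        using g q q0 by (intro geometric_tail_le finite_pow_le) (auto simp: field_simps)
      also have "\<dots> \<le> 2 * (2 / real q)\<^sup>2"
        using g q q0 by (intro mult_left_mono power_mono divide_right_mono) auto
      also have "\<dots> = 8 / (real q)\<^sup>2" by (simp add: power_divide)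
      finally have "ln (real q) * (\<Sum>k | 2 \<le> k \<and> q ^ k \<le> N. (g q / real q) ^ k) \<le> ln (real q) * (8 / (real q)\<^sup>2)"
        using q0 by (intro mult_left_mono) auto
      then show "ln (real q) * (\<Sum>k | 2 \<le> k \<and> q ^ k \<le> N. (g q / real q) ^ k) \<le> 8 * (ln (real q) / (real q)\<^sup>2)"
        by (simp add: mult_ac)
    qed
    also have "\<dots> \<le> 8 * K"
      unfolding sum_distrib_left[symmetric] by (intro mult_left_mono K(2)) (auto simp: primes_upto_def)
    finally show "(\<Sum>q\<in>primes_upto N. ln (real q) * (\<Sum>k | 2 \<le> k \<and> q ^ k \<le> N. (g q / real q) ^ k)) \<le> 8 * K" .
  qed
qed

lemma sum_pow_split:
  fixes q :: nat and f :: "nat \<Rightarrow> real"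
  assumes "prime q" "q \<le> N"
  shows "(\<Sum>k | 1 \<le> k \<and> q ^ k \<le> N. f k) = f 1 + (\<Sum>k | 2 \<le> k \<and> q ^ k \<le> N. f k)"
proof -
  have "{k. 1 \<le> k \<and> q ^ k \<le> N} = insert 1 {k. 2 \<le> k \<and> q ^ k \<le> N}"
  proof (intro equalityI subsetI)
    fix k assume "k \<in> {k. 1 \<le> k \<and> q ^ k \<le> N}"
    then show "k \<in> insert 1 {k. 2 \<le> k \<and> q ^ k \<le> N}" by (cases "k = 1") auto
  qed (use assms in auto)
  then show ?thesis using finite_pow_le[OF assms(1)] by simp
qed

section \<open>The nonprincipal Dirichlet character modulo 4\<close>

definition chi4 :: "nat \<Rightarrow> real" where
  "chi4 n = (if n mod 4 = 1 then 1 else if n mod 4 = 3 then -1 else 0)"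

lemma mod4_cases: "(n::nat) mod 4 = 0 \<or> n mod 4 = 1 \<or> n mod 4 = 2 \<or> n mod 4 = 3"
  by linarith

lemma chi4_mult: "chi4 (m * n) = chi4 m * chi4 n"
proof -
  have "(m * n) mod 4 = ((m mod 4) * (n mod 4)) mod 4" by (simp add: mod_mult_eq)
  then show ?thesis using mod4_cases[of m] mod4_cases[of n]
    by (auto simp: chi4_def)
qed

lemma abs_chi4_le: "\<bar>chi4 n\<bar> \<le> 1" by (simp add: chi4_def)

lemma sum_chi4: "(\<Sum>i=1..n. chi4 i) = (if n mod 4 = 1 \<or> n mod 4 = 2 then 1 else 0)"
proof (induction n)
  case (Suc n)
  have "Suc n mod 4 = (if n mod 4 = 3 then 0 else Suc (n mod 4))" by (simp add: mod_Suc)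
  then show ?case using Suc mod4_cases[of n] by (auto simp: chi4_def)
qed simp

lemma abs_sum_chi4: "\<bar>\<Sum>i=m..n. chi4 i\<bar> \<le> 1"
proof (cases "m \<le> n \<and> m \<ge> 1")
  case True
  then have "(\<Sum>i=1..n. chi4 i) = (\<Sum>i=1..m-1. chi4 i) + (\<Sum>i=m..n. chi4 i)"
    using sum.ub_add_nat[of 1 "m-1" chi4 "n - (m-1)"] by simp
  then show ?thesis by (simp only: sum_chi4) (auto split: if_splits)
next
  case False
  then consider "m > n" | "m = 0" by linarith
  then show ?thesis
  proof cases
    case 2
    have "(\<Sum>i=0..n. chi4 i) = (\<Sum>i=1..n. chi4 i)"
      by (subst sum.atLeast_Suc_atMost) (auto simp: chi4_def)
    then show ?thesis using 2 by (simp only: sum_chi4) (auto split: if_splits)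
  qed simp
qed

lemma chi4_inverse_tail:
  assumes "m \<ge> 1"
  shows "\<bar>\<Sum>i=m..n. chi4 i / real i\<bar> \<le> 1 / real m"
  using abel_bound[of m chi4 1 "\<lambda>i. 1 / real i" n] abs_sum_chi4 assms
  by (auto simp: field_simps)

text \<open>\<open>ln x / x\<close> decreases only from e onwards, so partial summation starts at 3.
  The first two terms vanish because ln 1 = 0 and \<open>chi4 2 = 0\<close>.\<close>

lemma chi4_ln_bounded: "\<bar>\<Sum>n=1..N. chi4 n * (ln (real n) / real n)\<bar> \<le> 1"
proof (cases "N \<ge> 3")
  case True
  have "\<bar>\<Sum>n=3..N. chi4 n * (ln (real n) / real n)\<bar> \<le> 1 * (ln (real 3) / real 3)"
  proof (rule abel_bound)
    fix i :: nat assume "3 \<le> i"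
    then show "ln (real (Suc i)) / real (Suc i) \<le> ln (real i) / real i"
      using exp_le by (intro ln_x_over_x_mono) auto
  qed (use abs_sum_chi4 in auto)
  also have "\<dots> \<le> 1" using ln_le_minus_one[of "3::real"] by simp
  finally have 1: "\<bar>\<Sum>n=3..N. chi4 n * (ln (real n) / real n)\<bar> \<le> 1" .
  have "{1..N} = insert 1 (insert 2 {3..N})" using True by auto
  then have "(\<Sum>n=1..N. chi4 n * (ln (real n) / real n)) = (\<Sum>n=3..N. chi4 n * (ln (real n) / real n))"
    by (simp add: chi4_def)
  then show ?thesis using 1 by simp
next
  case False
  then have "{1..N} = {} \<or> {1..N} = {1} \<or> {1..N} = {1,2}" by auto
  then show ?thesis by (auto simp: chi4_def)
qed

text \<open>Truncations of the series for \<open>L(1, \<chi>)\<close> stay away from 0, so its value is never needed.\<close>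

lemma L_chi4_ge: "N \<ge> 1 \<Longrightarrow> 2/3 \<le> (\<Sum>m=1..N. chi4 m / real m)"
proof -
  assume N: "N \<ge> 1"
  have *: "(\<Sum>m=1..N. chi4 m / real m) = 1 + (\<Sum>m=3..N. chi4 m / real m)"
  proof (cases "N \<ge> 2")
    case True
    then have "{1..N} = insert 1 (insert 2 {3..N})" by auto
    then show ?thesis by (simp add: chi4_def)
  next
    case False
    then have "N = 1" using N by simp
    then show ?thesis by (simp add: chi4_def)
  qed
  show ?thesis using chi4_inverse_tail[of 3 N] unfolding * by simp
qed

text \<open>Writing ln n as a divisor sum of \<open>Lam\<close> turns the bounded sum of chi(n) ln n
  / n into a sum over d of \<open>Lam d * chi4 d / d\<close> times a truncation of L(1, chi) at N
  div d. Replacing every truncation by the one at N costs at most \<open>psi N / N\<close>, hence at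
  most 3. So L times the sum is at most 4 in absolute value, and L >= 2/3 gives 6.\<close>

lemma mertens_chi4:
  assumes N: "N \<ge> 1"
  shows "\<bar>\<Sum>d=1..N. Lam d * (chi4 d / real d)\<bar> \<le> 6"
proof -
  define L where "L = (\<Sum>m=1..N. chi4 m / real m)"
  let ?S = "\<Sum>d=1..N. Lam d * (chi4 d / real d)"
  let ?T = "\<lambda>d. \<Sum>m=1..N div d. chi4 m / real m"
  have "(\<Sum>n=1..N. chi4 n * (ln (real n) / real n)) =
        (\<Sum>n=1..N. \<Sum>d | d dvd n. Lam d * (chi4 d / real d) * (chi4 (n div d) / real (n div d)))"
  proof (rule sum.cong[OF refl])
    fix n assume n: "n \<in> {1..N}"
    have "(\<Sum>d | d dvd n. Lam d * (chi4 d / real d) * (chi4 (n div d) / real (n div d)))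
        = (\<Sum>d | d dvd n. Lam d * (chi4 n / real n))"
    proof (rule sum.cong[OF refl])
      fix d assume "d \<in> {d. d dvd n}"
      then have nd: "n = d * (n div d)" by simp
      have "chi4 n / real n = chi4 d / real d * (chi4 (n div d) / real (n div d))"
        by (subst (1 2) nd) (simp only: chi4_mult of_nat_mult times_divide_times_eq)
      then show "Lam d * (chi4 d / real d) * (chi4 (n div d) / real (n div d)) = Lam d * (chi4 n / real n)"
        by simp
    qed
    also have "\<dots> = ln (real n) * (chi4 n / real n)"
      using n unfolding sum_distrib_right[symmetric] by (subst mangoldt_sum) auto
    finally show "chi4 n * (ln (real n) / real n) = (\<Sum>d | d dvd n. Lam d * (chi4 d / real d) * (chi4 (n div d) / real (n div d)))"
      by simp
  qed
  also have "\<dots> = (\<Sum>d=1..N. \<Sum>m=1..N div d. Lam d * (chi4 d / real d) * (chi4 m / real m))"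
    by (rule sum_divisors_swap)
  also have "\<dots> = (\<Sum>d=1..N. Lam d * (chi4 d / real d) * ?T d)"
    by (simp add: sum_distrib_left)
  finally have A: "(\<Sum>n=1..N. chi4 n * (ln (real n) / real n)) = (\<Sum>d=1..N. Lam d * (chi4 d / real d) * ?T d)" .
  have "\<bar>L * ?S - (\<Sum>d=1..N. Lam d * (chi4 d / real d) * ?T d)\<bar> = \<bar>\<Sum>d=1..N. Lam d * (chi4 d / real d) * (L - ?T d)\<bar>"
    by (simp add: sum_distrib_left sum_subtractf right_diff_distrib mult_ac)
  also have "\<dots> \<le> (\<Sum>d=1..N. \<bar>Lam d * (chi4 d / real d) * (L - ?T d)\<bar>)" by (rule sum_abs)
  also have "\<dots> \<le> (\<Sum>d=1..N. Lam d * (1 / real N))"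
  proof (rule sum_mono)
    fix d assume d: "d \<in> {1..N}"
    have le: "N div d \<le> N" by simp
    have "L = ?T d + (\<Sum>m=N div d + 1..N. chi4 m / real m)"
      unfolding L_def using sum.ub_add_nat[of 1 "N div d" "\<lambda>m. chi4 m / real m" "N - N div d"] le by simp
    then have "\<bar>L - ?T d\<bar> \<le> 1 / real (N div d + 1)"
      using chi4_inverse_tail[of "N div d + 1" N] by simp
    \<comment> \<open>The tail starts at \<open>N div d + 1\<close>, which exceeds or equals N / d.
      The factor d cancels the 1 / d of the main term, so that the errors add up to Chebyshev's
      function.\<close>
    also have "\<dots> \<le> real d / real N"
      using real_div_le_Suc[of N d] d N by (auto simp: field_simps)
    finally have 1: "\<bar>L - ?T d\<bar> \<le> real d / real N" .
    have "\<bar>chi4 d / real d\<bar> * \<bar>L - ?T d\<bar> \<le> (1 / real d) * (real d / real N)"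
      using 1 abs_chi4_le[of d] by (intro mult_mono) (auto simp: divide_right_mono)
    also have "\<dots> = 1 / real N" using d by simp
    finally have "Lam d * (\<bar>chi4 d / real d\<bar> * \<bar>L - ?T d\<bar>) \<le> Lam d * (1 / real N)"
      by (rule mult_left_mono[OF _ mangoldt_nonneg])
    then show "\<bar>Lam d * (chi4 d / real d) * (L - ?T d)\<bar> \<le> Lam d * (1 / real N)"
      by (simp only: abs_mult abs_mangoldt mult.assoc)
  qed
  also have "\<dots> = psi N / real N" by (simp add: psi_def sum_divide_distrib)
  also have "\<dots> \<le> 3" using psi_le[of N] N by (simp add: field_simps)
  finally have "\<bar>L * ?S\<bar> \<le> 4" using chi4_ln_bounded[of N] unfolding A by linarith
  moreover have "2/3 * \<bar>?S\<bar> \<le> L * \<bar>?S\<bar>" using L_chi4_ge[OF N] unfolding L_def by (intro mult_right_mono) auto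
  moreover have "L * \<bar>?S\<bar> = \<bar>L * ?S\<bar>" using L_chi4_ge[OF N] unfolding L_def by (simp add: abs_mult)
  ultimately show ?thesis by linarith
qed

section \<open>Reciprocals of primes in a residue class modulo 4\<close>

abbreviation inv_primes :: "nat \<Rightarrow> nat \<Rightarrow> real" where
  "inv_primes a N \<equiv> \<Sum>q\<in>primes_upto N. if q mod 4 = a then 1 / real q else 0"

lemma prime_mod4: "prime q \<Longrightarrow> q = 2 \<or> q mod 4 = 1 \<or> q mod 4 = (3 :: nat)"
proof (cases "q = 2")
  case False
  assume "prime q"
  then have "odd q" using False primes_dvd_imp_eq two_is_prime_nat by blast
  then have "q mod 4 \<noteq> 0" "q mod 4 \<noteq> 2" by presburger+
  then show ?thesis using mod4_cases[of q] by auto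
qed simp

text \<open>Orthogonality of characters: for odd q, half of 1 plus or minus \<open>chi4 q\<close> is
  the indicator of the residue class. Prime powers from the square on contribute O(1) to both
  sums.\<close>

lemma mertens_mod4:
  "\<exists>C\<ge>0. \<forall>N\<ge>1. \<forall>a\<in>{1,3}.
     \<bar>(\<Sum>q\<in>primes_upto N. if q mod 4 = a then ln (real q) / real q else 0) - ln (real N) / 2\<bar> \<le> C"
proof -
  obtain K where K: "K \<ge> 0" "\<And>N g. (\<forall>q. prime q \<longrightarrow> 0 \<le> g q \<and> g q \<le> 2 \<and> g q \<le> real q / 2) \<Longrightarrow>
     (\<Sum>q\<in>primes_upto N. ln (real q) * (\<Sum>k | 2 \<le> k \<and> q ^ k \<le> N. (g q / real q) ^ k)) \<le> K"
    using prime_power_tail by blast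
  have half: "1 \<le> real q / 2" if "prime q" for q :: nat
    using prime_ge_2_nat[OF that] by simp
  have lnn: "0 \<le> ln (real q)" for q :: nat by (cases "q = 0") auto
  define E where "E N = (\<Sum>q\<in>primes_upto N. ln (real q) * (\<Sum>k | 2 \<le> k \<and> q ^ k \<le> N. (1 / real q) ^ k))" for N
  have E: "E N \<le> K" for N
    unfolding E_def using half by (intro K(2)) auto
  have decomp: "\<bar>(\<Sum>d=1..N. Lam d * (f d / real d)) - (\<Sum>q\<in>primes_upto N. ln (real q) * (f q / real q))\<bar> \<le> K"
    if f: "\<And>d. \<bar>f d\<bar> \<le> 1" for f :: "nat \<Rightarrow> real" and N
  proof -
    have "(\<Sum>d=1..N. Lam d * (f d / real d)) =
      (\<Sum>q\<in>primes_upto N. ln (real q) * (f q / real q) + ln (real q) * (\<Sum>k | 2 \<le> k \<and> q ^ k \<le> N. f (q ^ k) / real (q ^ k)))"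
      unfolding sum_mangoldt
      by (rule sum.cong[OF refl], subst sum_pow_split) (auto simp: primes_upto_def distrib_left)
    then have "\<bar>(\<Sum>d=1..N. Lam d * (f d / real d)) - (\<Sum>q\<in>primes_upto N. ln (real q) * (f q / real q))\<bar> =
      \<bar>\<Sum>q\<in>primes_upto N. ln (real q) * (\<Sum>k | 2 \<le> k \<and> q ^ k \<le> N. f (q ^ k) / real (q ^ k))\<bar>"
      by (simp add: sum.distrib)
    also have "\<dots> \<le> (\<Sum>q\<in>primes_upto N. \<bar>ln (real q) * (\<Sum>k | 2 \<le> k \<and> q ^ k \<le> N. f (q ^ k) / real (q ^ k))\<bar>)"
      by (rule sum_abs)
    also have "\<dots> \<le> E N"
      unfolding E_def
    proof (rule sum_mono)
      fix q assume "q \<in> primes_upto N"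
      have "\<bar>\<Sum>k | 2 \<le> k \<and> q ^ k \<le> N. f (q ^ k) / real (q ^ k)\<bar> \<le> (\<Sum>k | 2 \<le> k \<and> q ^ k \<le> N. \<bar>f (q ^ k) / real (q ^ k)\<bar>)"
        by (rule sum_abs)
      also have "\<dots> \<le> (\<Sum>k | 2 \<le> k \<and> q ^ k \<le> N. (1 / real q) ^ k)"
        using f by (intro sum_mono) (auto simp: power_divide divide_right_mono)
      finally show "\<bar>ln (real q) * (\<Sum>k | 2 \<le> k \<and> q ^ k \<le> N. f (q ^ k) / real (q ^ k))\<bar>
          \<le> ln (real q) * (\<Sum>k | 2 \<le> k \<and> q ^ k \<le> N. (1 / real q) ^ k)"
        using lnn[of q] by (simp add: abs_mult mult_left_mono)
    qed
    finally show ?thesis using E[of N] by linarith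
  qed
  show ?thesis
  proof (intro exI[of _ "10 + 2 * K"] conjI allI impI ballI)
    show "0 \<le> 10 + 2 * K" using K by simp
  next
    fix N a :: nat assume N: "1 \<le> N" and a: "a \<in> {1,3}"
    define P where "P = (\<Sum>q\<in>primes_upto N. ln (real q) * (1 / real q))"
    define X where "X = (\<Sum>q\<in>primes_upto N. ln (real q) * (chi4 q / real q))"
    define T where "T = (\<Sum>q\<in>primes_upto N. if q = 2 then ln (real q) / real q else 0)"
    have 1: "\<bar>P - ln (real N)\<bar> \<le> 3 + K"
      using decomp[of "\<lambda>_. 1" N] mertens_Lam[OF N] unfolding P_def by simp
    have 2: "\<bar>X\<bar> \<le> 6 + K"
      using decomp[of chi4 N] abs_chi4_le mertens_chi4[OF N] unfolding X_def by simp
    have 3: "0 \<le> T" "T \<le> 1"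
    proof -
      have "T = (if 2 \<in> primes_upto N then ln 2 / 2 else 0)"
        unfolding T_def using sum.delta[of "primes_upto N" 2 "\<lambda>q. ln (real q) / real q"] by simp
      then show "0 \<le> T" "T \<le> 1" using ln2_le_25_over_36 by (auto split: if_splits)
    qed
    \<comment> \<open>The value of the character on the class a. The sum T corrects for q = 2, where
      the character vanishes and the indicator formula would give 1/2.\<close>
    define s :: real where "s = (if a = 1 then 1 else -1)"
    have "(\<Sum>q\<in>primes_upto N. if q mod 4 = a then ln (real q) / real q else 0) =
      (\<Sum>q\<in>primes_upto N. (ln (real q) * (1 / real q)) / 2 + s * (ln (real q) * (chi4 q / real q)) / 2
         - (if q = 2 then ln (real q) / real q else 0) / 2)"
    proof (rule sum.cong[OF refl])
      fix q assume "q \<in> primes_upto N"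
      then have q: "prime q" by (simp add: primes_upto_def)
      have "q = 2 \<or> q mod 4 = 1 \<or> q mod 4 = 3" using prime_mod4[OF q] .
      then show "(if q mod 4 = a then ln (real q) / real q else 0) =
         (ln (real q) * (1 / real q)) / 2 + s * (ln (real q) * (chi4 q / real q)) / 2
         - (if q = 2 then ln (real q) / real q else 0) / 2"
        using a unfolding s_def chi4_def by auto
    qed
    also have "\<dots> = P / 2 + s * X / 2 - T / 2"
      unfolding P_def X_def T_def
      by (simp only: sum.distrib sum_subtractf sum_divide_distrib sum_distrib_left)
    finally have 4: "(\<Sum>q\<in>primes_upto N. if q mod 4 = a then ln (real q) / real q else 0) = P / 2 + s * X / 2 - T / 2" .
    have "\<bar>s * X\<bar> \<le> 6 + K" using 2 by (simp add: s_def)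
    then show "\<bar>(\<Sum>q\<in>primes_upto N. if q mod 4 = a then ln (real q) / real q else 0) - ln (real N) / 2\<bar> \<le> 10 + 2 * K"
      using 1 3 K(1) unfolding 4 by linarith
  qed
qed

text \<open>A Riemann sum for the integral of d(ln t) / ln t, whose value is ln ln. The 1 is the
  term i = 2. One step from n to n + 1 has error at most 4 / n^2, which is bounded by 4 (1 / (n - 1)
  - 1 / n); the last summand on the left is the telescoped total.\<close>

lemma sum_dlog_over_log:
  assumes "N \<ge> 2"
  shows "ln (ln (real N)) - ln (ln 2) + 1 - 4 * (1 - 1 / (real N - 1)) \<le> (\<Sum>i=2..N. (ln (real i) - ln (real (i - 1))) / ln (real i)) \<and>
    (\<Sum>i=2..N. (ln (real i) - ln (real (i - 1))) / ln (real i)) \<le> ln (ln (real N)) - ln (ln 2) + 1"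
  using assms
proof (induction N rule: dec_induct)
  case (step n)
  define u v where "u = ln (real (Suc n))" and "v = ln (real n)"
  have n: "real n \<ge> 2" using step by simp
  have v: "v \<ge> 1/2" using n ln2_ge_two_thirds ln_mono[of 2 "real n"] unfolding v_def by linarith
  have uv: "u \<ge> v" unfolding u_def v_def using n by simp
  have uv1: "u - v \<le> 1 / real n"
  proof -
    have "u - v = ln (1 + 1 / real n)"
      unfolding u_def v_def using n ln_div[of "real n + 1" "real n"] by (simp add: add_divide_distrib add.commute)
    also have "\<dots> \<le> 1 / real n" by (rule ln_add_one_self_le_self) auto
    finally show ?thesis .
  qed
  have lnd: "ln u - ln v = ln (u / v)" using v uv by (simp add: ln_div)
  have up: "(u - v) / u \<le> ln u - ln v"
  proof -
    have "ln (v / u) \<le> v / u - 1" using v uv by (intro ln_le_minus_one) auto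
    moreover have "ln (v / u) = ln v - ln u" using v uv by (simp add: ln_div)
    ultimately show ?thesis using v uv by (simp add: diff_divide_distrib)
  qed
  have lo: "ln u - ln v \<le> (u - v) / u + 4 * (1 / (real n - 1) - 1 / real n)"
  proof -
    have "ln u - ln v \<le> u / v - 1" unfolding lnd using v uv by (intro ln_le_minus_one) auto
    also have "\<dots> = (u - v) / u + (u - v)\<^sup>2 / (u * v)" using v uv
      by (simp add: field_simps power2_eq_square)
    also have "(u - v)\<^sup>2 / (u * v) \<le> (1 / real n)\<^sup>2 / (1/2 * (1/2))"
      using v uv uv1 n by (intro frac_le power_mono mult_mono) auto
    also have "\<dots> \<le> 4 * (1 / (real n - 1) - 1 / real n)"
      using n by (simp add: field_simps power2_eq_square)
    finally show ?thesis by simp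
  qed
  have "(\<Sum>i=2..Suc n. (ln (real i) - ln (real (i - 1))) / ln (real i)) =
     (\<Sum>i=2..n. (ln (real i) - ln (real (i - 1))) / ln (real i)) + (u - v) / u"
    using step by (simp add: u_def v_def)
  then show ?case using step.IH up lo unfolding u_def[symmetric] v_def[symmetric]
    by simp
qed simp

text \<open>Half the increment of ln is subtracted from the prime term in c, so that the partial
  sums of c are bounded by \<open>mertens_mod4\<close>. Summation by parts with the weight 1 / ln i
  then removes the logarithm, and the subtracted part produces ln ln N / 2.\<close>

lemma sum_inverse_primes_mod4:
  "\<exists>C\<ge>0. \<forall>N\<ge>2. \<forall>a\<in>{1,3}.
     \<bar>(inv_primes a N) - ln (ln (real N)) / 2\<bar> \<le> C"
proof -
  obtain C where C: "C \<ge> 0" "\<And>N a. N \<ge> 1 \<Longrightarrow> a \<in> {1,3} \<Longrightarrow>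
     \<bar>(\<Sum>q\<in>primes_upto N. if q mod 4 = a then ln (real q) / real q else 0) - ln (real N) / 2\<bar> \<le> C"
    using mertens_mod4 by blast
  show ?thesis
  proof (intro exI[of _ "2 * C + 5 + \<bar>ln (ln 2)\<bar>"] conjI allI impI ballI)
    show "0 \<le> 2 * C + 5 + \<bar>ln (ln 2)\<bar>" using C(1) by simp
  next
    fix N a :: nat assume N: "2 \<le> N" and a: "a \<in> {1,3}"
    define c where "c i = (if prime i \<and> i mod 4 = a then ln (real i) / real i else 0) - (ln (real i) - ln (real (i - 1))) / 2" for i
    have conv: "(\<Sum>q\<in>primes_upto n. if q mod 4 = a then f q else 0) = (\<Sum>i=2..n. if prime i \<and> i mod 4 = a then f i else 0)"
      for n and f :: "nat \<Rightarrow> real"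
      by (rule sum.mono_neutral_cong_left) (auto simp: primes_upto_def prime_ge_2_nat)
    have tel: "(\<Sum>i=2..n. ln (real i) - ln (real (i - 1))) = ln (real n)" if "n \<ge> 1" for n
      using that by (induction n rule: dec_induct) auto
    have "\<bar>\<Sum>i=2..N. c i * (1 / ln (real i))\<bar> \<le> C * (1 / ln (real 2))"
    proof (rule abel_bound)
      fix n :: nat assume n: "2 \<le> n"
      have "(\<Sum>i=2..n. c i) = (\<Sum>q\<in>primes_upto n. if q mod 4 = a then ln (real q) / real q else 0) - ln (real n) / 2"
        unfolding c_def conv sum_subtractf using tel[of n] n by (simp add: sum_divide_distrib[symmetric])
      then show "\<bar>\<Sum>i=2..n. c i\<bar> \<le> C" using C(2)[of n a] n a by simp
    next
      fix i :: nat assume i: "2 \<le> i"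
      then have "0 < ln (real i)" "ln (real i) \<le> ln (real (Suc i))" by auto
      then show "1 / ln (real (Suc i)) \<le> 1 / ln (real i)" by (intro frac_le) auto
      show "0 \<le> 1 / ln (real i)" using i by simp
    qed
    also have "\<dots> \<le> C * 2"
      using ln2_ge_two_thirds C(1) by (intro mult_left_mono) (auto simp: field_simps)
    finally have 1: "\<bar>\<Sum>i=2..N. c i * (1 / ln (real i))\<bar> \<le> 2 * C" by simp
    have "(\<Sum>i=2..N. c i * (1 / ln (real i))) = (\<Sum>i=2..N. (if prime i \<and> i mod 4 = a then 1 / real i else 0) -
       (ln (real i) - ln (real (i - 1))) / ln (real i) / 2)"
    proof (rule sum.cong[OF refl])
      fix i assume "i \<in> {2..N}"
      then have "ln (real i) > 0" by simp
      then show "c i * (1 / ln (real i)) = (if prime i \<and> i mod 4 = a then 1 / real i else 0) -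
       (ln (real i) - ln (real (i - 1))) / ln (real i) / 2"
        unfolding c_def by (cases "prime i \<and> i mod 4 = a") (auto simp: diff_divide_distrib mult.commute)
    qed
    also have "\<dots> = (inv_primes a N) -
       (\<Sum>i=2..N. (ln (real i) - ln (real (i - 1))) / ln (real i)) / 2"
      unfolding conv by (simp only: sum_subtractf sum_divide_distrib)
    finally have 2: "(\<Sum>i=2..N. c i * (1 / ln (real i))) = \<dots>" .
    have 3: "1 / (real N - 1) \<ge> 0" using N by simp
    show "\<bar>(inv_primes a N) - ln (ln (real N)) / 2\<bar> \<le> 2 * C + 5 + \<bar>ln (ln 2)\<bar>"
      using 1 sum_dlog_over_log[OF N, THEN conjunct1] sum_dlog_over_log[OF N, THEN conjunct2] 3
      unfolding 2 right_diff_distrib abs_le_iff by linarith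
  qed
qed

section \<open>Mean values of multiplicative functions\<close>

text \<open>The completely multiplicative function with value \<open>g q\<close> at each prime q. As
  a product over the multiset of prime factors it covers both indicators of multiplicative sets and
  weights such as y^Omega(n).\<close>

definition cmult :: "(nat \<Rightarrow> real) \<Rightarrow> nat \<Rightarrow> real" where
  "cmult g n = (\<Prod>q\<in>#prime_factorization n. g q)"

lemma cmult_1 [simp]: "cmult g (Suc 0) = 1" by (simp add: cmult_def)

lemma cmult_mult: "m > 0 \<Longrightarrow> n > 0 \<Longrightarrow> cmult g (m * n) = cmult g m * cmult g n"
  by (simp add: cmult_def prime_factorization_mult)

lemma cmult_prime: "prime q \<Longrightarrow> cmult g q = g q"
  by (simp add: cmult_def prime_factorization_prime)

lemma cmult_prime_power: "prime q \<Longrightarrow> cmult g (q ^ k) = g q ^ k"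
  by (induction k) (auto simp: cmult_mult cmult_prime prime_gt_0_nat)

lemma cmult_nonneg: "(\<And>q. prime q \<Longrightarrow> g q \<ge> 0) \<Longrightarrow> cmult g n \<ge> 0"
proof -
  assume g: "\<And>q. prime q \<Longrightarrow> g q \<ge> 0"
  have "0 \<le> (\<Prod>q\<in>#M. g q)" if "\<forall>q\<in>#M. prime q" for M
    using that by (induction M) (auto intro!: mult_nonneg_nonneg g)
  then show ?thesis unfolding cmult_def by auto
qed

definition composed_of :: "nat set \<Rightarrow> nat \<Rightarrow> nat set" where
  "composed_of P N = {m\<in>{1..N}. \<forall>q. prime q \<longrightarrow> q dvd m \<longrightarrow> q \<in> P}"

lemma finite_composed_of [simp]: "finite (composed_of P N)" by (simp add: composed_of_def)

text \<open>Rankin's form of the Euler product, one prime at a time: dividing a multiple of q once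
  by q leads back into the same set, so the multiples contribute at most \<open>g q / q\<close>
  times the whole sum, and what is left avoids q. Truncation at N only loses nonnegative
  terms.\<close>

lemma cmult_sum_le_prod:
  assumes "finite P" "\<And>q. q \<in> P \<Longrightarrow> prime q" and g0: "\<And>q. prime q \<Longrightarrow> 0 \<le> g q"
    and "\<And>q. q \<in> P \<Longrightarrow> g q < real q"
  shows "(\<Sum>m\<in>composed_of P N. cmult g m / real m) \<le> (\<Prod>q\<in>P. 1 / (1 - g q / real q))"
  using assms(1,2,4)
proof (induction P rule: finite_induct)
  case empty
  have "composed_of {} N \<subseteq> {1}"
  proof
    fix m assume "m \<in> composed_of {} N"
    then have "\<not> (\<exists>q. prime q \<and> q dvd m)" by (auto simp: composed_of_def)
    then show "m \<in> {1}" using prime_factor_nat[of m] by auto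
  qed
  then have "(\<Sum>m\<in>composed_of {} N. cmult g m / real m) \<le> (\<Sum>m\<in>{1}. cmult g m / real m)"
    by (intro sum_mono2) auto
  then show ?case by simp
next
  case (insert q P)
  let ?H = "\<lambda>m. cmult g m / real m" and ?M = "composed_of (insert q P) N"
  have q: "prime q" "g q < real q" using insert by auto
  have H0: "?H m \<ge> 0" for m using cmult_nonneg[of g, OF g0] by simp
  have "(\<Sum>m\<in>?M. ?H m) = (\<Sum>m\<in>{m\<in>?M. q dvd m}. ?H m) + (\<Sum>m\<in>{m\<in>?M. \<not> q dvd m}. ?H m)"
    by (subst sum.union_disjoint[symmetric]) (auto intro!: sum.cong)
  also have "{m\<in>?M. \<not> q dvd m} = composed_of P N"
  proof (intro equalityI subsetI)
    fix m assume "m \<in> {m\<in>?M. \<not> q dvd m}"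
    then show "m \<in> composed_of P N" by (auto simp: composed_of_def)
  next
    fix m assume "m \<in> composed_of P N"
    moreover from this have "\<not> q dvd m" using insert.hyps q by (auto simp: composed_of_def)
    ultimately show "m \<in> {m\<in>?M. \<not> q dvd m}" by (auto simp: composed_of_def)
  qed
  also have "(\<Sum>m\<in>{m\<in>?M. q dvd m}. ?H m) \<le> (\<Sum>m\<in>(\<lambda>m. q * m) ` ?M. ?H m)"
  proof (rule sum_mono2)
    show "{m\<in>?M. q dvd m} \<subseteq> (\<lambda>m. q * m) ` ?M"
    proof
      fix m assume m: "m \<in> {m\<in>?M. q dvd m}"
      then obtain k where k: "m = q * k" by (auto elim: dvdE)
      have km: "k \<le> m" using k q prime_gt_0_nat[of q] by simp
      have mN: "m \<le> N" "m > 0" using m by (auto simp: composed_of_def)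
      have "k \<le> N" using km mN(1) by (rule order.trans)
      have "k > 0" using mN(2) k by (auto intro: Nat.gr0I)
      then have "k \<in> ?M" using m k \<open>k \<le> N\<close> by (auto simp: composed_of_def)
      then show "m \<in> (\<lambda>m. q * m) ` ?M" using k by auto
    qed
  qed (use H0 in auto)
  also have "\<dots> = (\<Sum>m\<in>?M. ?H (q * m))"
    using q by (subst sum.reindex) (auto simp: inj_on_def prime_gt_0_nat)
  also have "\<dots> = (\<Sum>m\<in>?M. g q / real q * ?H m)"
    using q by (intro sum.cong refl, subst cmult_mult) (auto simp: composed_of_def prime_gt_0_nat cmult_prime)
  finally have "(1 - g q / real q) * (\<Sum>m\<in>?M. ?H m) \<le> (\<Sum>m\<in>composed_of P N. ?H m)"
    unfolding sum_distrib_left[symmetric] left_diff_distrib by simp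
  also have "\<dots> \<le> (\<Prod>q\<in>P. 1 / (1 - g q / real q))" using insert by auto
  finally have *: "(1 - g q / real q) * (\<Sum>m\<in>?M. ?H m) \<le> (\<Prod>q\<in>P. 1 / (1 - g q / real q))" .
  have pos: "1 - g q / real q > 0" using q prime_gt_0_nat[of q] by (simp add: field_simps)
  have "(\<Sum>m\<in>?M. ?H m) \<le> 1 / (1 - g q / real q) * (\<Prod>q\<in>P. 1 / (1 - g q / real q))"
    using * pos by (simp add: pos_le_divide_eq mult.commute)
  then show ?case using insert.hyps by simp
qed

lemma composed_of_primes_upto: "composed_of (primes_upto N) N = {1..N}"
proof -
  have "q \<le> N" if "1 \<le> m" "m \<le> N" "q dvd m" for m q :: nat
    using dvd_imp_le[OF that(3)] that by simp
  then show ?thesis by (auto simp: composed_of_def primes_upto_def)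
qed

lemma inverse_one_minus_le_exp:
  fixes x :: real
  assumes "0 \<le> x" "x \<le> 1/2"
  shows "1 / (1 - x) \<le> exp (x + 2 * x\<^sup>2)"
proof -
  have "- x - 2 * x\<^sup>2 \<le> ln (1 - x)" using assms by (rule ln_one_minus_pos_lower_bound)
  then have "exp (- (x + 2 * x\<^sup>2)) \<le> 1 - x"
    using assms by (subst ln_ge_iff[symmetric]) auto
  then have "exp (- (x + 2 * x\<^sup>2)) * exp (x + 2 * x\<^sup>2) \<le> (1 - x) * exp (x + 2 * x\<^sup>2)"
    by (rule mult_right_mono) simp
  then have "1 \<le> exp (x + 2 * x\<^sup>2) * (1 - x)"
    by (simp only: exp_minus_inverse mult.commute)
  then show ?thesis using assms by (subst pos_divide_le_eq) auto
qed

text \<open>The bound 2 covers every weight used later; the bound q / 2 keeps the Euler factors 1 /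
  (1 - g q / q) bounded at the smallest primes.\<close>

definition admissible :: "(nat \<Rightarrow> real) \<Rightarrow> bool" where
  "admissible g \<longleftrightarrow> (\<forall>q. prime q \<longrightarrow> 0 \<le> g q \<and> g q \<le> 2 \<and> g q \<le> real q / 2)"

lemma prod_inverse_le_exp:
  "\<exists>K\<ge>0. \<forall>P g. finite P \<longrightarrow> (\<forall>q\<in>P. prime q) \<longrightarrow> admissible g \<longrightarrow>
     (\<Prod>q\<in>P. 1 / (1 - g q / real q)) \<le> exp ((\<Sum>q\<in>P. g q / real q) + K)"
proof -
  obtain K where K: "K \<ge> 0" "\<And>A. finite A \<Longrightarrow> 0 \<notin> A \<Longrightarrow> (\<Sum>n\<in>A. ln (real n) / (real n)\<^sup>2) \<le> K"
    using ln_over_square_bounded by blast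
  show ?thesis
  proof (intro exI[of _ "16 * K"] conjI allI impI)
    show "0 \<le> 16 * K" using K by simp
  next
    fix P :: "nat set" and g
    assume P: "finite P" "\<forall>q\<in>P. prime q" and g: "admissible g"
    have "(\<Prod>q\<in>P. 1 / (1 - g q / real q)) \<le> (\<Prod>q\<in>P. exp (g q / real q + 16 * (ln (real q) / (real q)\<^sup>2)))"
    proof (rule prod_mono, safe)
      fix q assume "q \<in> P"
      then have q: "prime q" using P by auto
      then have q2: "real q \<ge> 2" using prime_ge_2_nat[of q] by simp
      define x where "x = g q / real q"
      have x: "0 \<le> x" "x \<le> 1/2" "x \<le> 2 / real q"
        using g q q2 by (auto simp: admissible_def x_def field_simps)
      show "0 \<le> 1 / (1 - g q / real q)" using x unfolding x_def[symmetric] by simp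
      have "ln (real q) \<ge> ln 2" using q2 by simp
      then have l: "ln (real q) \<ge> 1/2" using ln2_ge_two_thirds by linarith
      have "1 / (1 - x) \<le> exp (x + 2 * x\<^sup>2)" using x by (intro inverse_one_minus_le_exp)
      also have "2 * x\<^sup>2 \<le> 2 * (2 / real q)\<^sup>2" using x by (intro mult_left_mono power_mono) auto
      also have "\<dots> = 8 / (real q)\<^sup>2" by (simp add: power_divide)
      \<comment> \<open>Since ln q >= 1/2, inserting a logarithm doubles the constant and makes the
        convergent series of \<open>ln_over_square_bounded\<close> applicable.\<close>
      also have "\<dots> \<le> 16 * ln (real q) / (real q)\<^sup>2" using l by (intro divide_right_mono) auto
      finally show "1 / (1 - g q / real q) \<le> exp (g q / real q + 16 * (ln (real q) / (real q)\<^sup>2))"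
        by (simp add: x_def)
    qed
    also have "\<dots> = exp ((\<Sum>q\<in>P. g q / real q) + 16 * (\<Sum>q\<in>P. ln (real q) / (real q)\<^sup>2))"
      using P by (simp add: exp_sum[symmetric] sum.distrib sum_distrib_left)
    also have "\<dots> \<le> exp ((\<Sum>q\<in>P. g q / real q) + 16 * K)"
    proof -
      have "0 \<notin> P" using P(2) not_prime_0 by blast
      then show ?thesis using K(2)[of P] P(1) by simp
    qed
    finally show "(\<Prod>q\<in>P. 1 / (1 - g q / real q)) \<le> exp ((\<Sum>q\<in>P. g q / real q) + 16 * K)" .
  qed
qed

lemma cmult_harmonic:
  "\<exists>K\<ge>0. \<forall>N g. admissible g \<longrightarrow>
     (\<Sum>m=1..N. cmult g m / real m) \<le> exp ((\<Sum>q\<in>primes_upto N. g q / real q) + K)"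
proof -
  obtain K where K: "K \<ge> 0" "\<And>P g. finite P \<Longrightarrow> \<forall>q\<in>P. prime q \<Longrightarrow> admissible g \<Longrightarrow>
     (\<Prod>q\<in>P. 1 / (1 - g q / real q)) \<le> exp ((\<Sum>q\<in>P. g q / real q) + K)"
    using prod_inverse_le_exp by blast
  have "(\<Sum>m=1..N. cmult g m / real m) \<le> exp ((\<Sum>q\<in>primes_upto N. g q / real q) + K)" if g: "admissible g" for N g
  proof -
    have "g q < real q" if "q \<in> primes_upto N" for q
    proof -
      have "prime q" using that by (simp add: primes_upto_def)
      then have "g q \<le> real q / 2" "q > 0" using g by (auto simp: admissible_def prime_gt_0_nat)
      then show ?thesis by simp
    qed
    then have "(\<Sum>m=1..N. cmult g m / real m) \<le> (\<Prod>q\<in>primes_upto N. 1 / (1 - g q / real q))"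
      unfolding composed_of_primes_upto[of N, symmetric]
      using g by (intro cmult_sum_le_prod) (auto simp: primes_upto_def admissible_def)
    also have "\<dots> \<le> exp ((\<Sum>q\<in>primes_upto N. g q / real q) + K)"
      using g by (intro K) (auto simp: primes_upto_def)
    finally show ?thesis .
  qed
  then show ?thesis using K(1) by blast
qed

lemma sum_ln_primes_le: "(\<Sum>q\<in>primes_upto N. ln (real q)) \<le> 3 * real N"
proof -
  have "(\<Sum>q\<in>primes_upto N. ln (real q)) = (\<Sum>q\<in>primes_upto N. Lam q)"
    by (intro sum.cong) (auto simp: primes_upto_def)
  also have "\<dots> \<le> psi N"
    unfolding psi_def
  proof (rule sum_mono2)
    show "primes_upto N \<subseteq> {1..N}" using prime_ge_1_nat by (auto simp: primes_upto_def)
  qed (simp_all add: mangoldt_nonneg)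
  finally show ?thesis using psi_le[of N] by linarith
qed

text \<open>Inserting a weight \<open>ln n = (\<Sum>d dvd n. \<Lambda>(d))\<close> reduces the mean value to the logarithmic mean,
  with a loss of a constant factor only.\<close>

lemma cmult_mean:
  "\<exists>C\<ge>0. \<forall>N\<ge>2. \<forall>g. admissible g \<longrightarrow>
     (\<Sum>n=1..N. cmult g n) \<le> C * (real N / ln (real N)) * exp (\<Sum>q\<in>primes_upto N. g q / real q)"
proof -
  obtain K where K: "K \<ge> 0" "\<And>N g. admissible g \<Longrightarrow>
     (\<Sum>q\<in>primes_upto N. ln (real q) * (\<Sum>k | 2 \<le> k \<and> q ^ k \<le> N. (g q / real q) ^ k)) \<le> K"
    using prime_power_tail unfolding admissible_def by blast
  obtain K' where K': "K' \<ge> 0" "\<And>N g. admissible g \<Longrightarrow>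
     (\<Sum>m=1..N. cmult g m / real m) \<le> exp ((\<Sum>q\<in>primes_upto N. g q / real q) + K')"
    using cmult_harmonic by blast
  show ?thesis
  proof (intro exI[of _ "(7 + K) * exp K'"] conjI allI impI)
    show "0 \<le> (7 + K) * exp K'" using K by simp
  next
    fix N :: nat and g assume N: "2 \<le> N" and g: "admissible g"
    have g': "0 \<le> g q" "g q \<le> 2" if "prime q" for q using g that by (auto simp: admissible_def)
    define f where "f = cmult g"
    have f0: "f n \<ge> 0" for n unfolding f_def using g' by (intro cmult_nonneg) auto
    \<comment> \<open>Chebyshev's bound with weight f. The primes contribute at most 2 * 3 x because
      g <= 2; for higher powers q^k <= x allows g^k to be replaced by x (g / q)^k, which sums to at
      most K x.\<close>
    have D: "(\<Sum>d=1..x. Lam d * f d) \<le> (6 + K) * real x" for x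
    proof -
      have "(\<Sum>d=1..x. Lam d * f d) = (\<Sum>q\<in>primes_upto x. ln (real q) * g q + ln (real q) * (\<Sum>k | 2 \<le> k \<and> q ^ k \<le> x. g q ^ k))"
        unfolding sum_mangoldt f_def
        by (rule sum.cong[OF refl], subst sum_pow_split) (auto simp: primes_upto_def distrib_left cmult_prime_power cmult_prime)
      also have "\<dots> \<le> (\<Sum>q\<in>primes_upto x. ln (real q) * 2 + ln (real q) * (real x * (\<Sum>k | 2 \<le> k \<and> q ^ k \<le> x. (g q / real q) ^ k)))"
      proof (rule sum_mono)
        fix q assume "q \<in> primes_upto x"
        then have q: "prime q" by (simp add: primes_upto_def)
        have q1: "real q \<ge> 1" using prime_gt_0_nat[OF q] by linarith
        have "(\<Sum>k | 2 \<le> k \<and> q ^ k \<le> x. g q ^ k) \<le> real x * (\<Sum>k | 2 \<le> k \<and> q ^ k \<le> x. (g q / real q) ^ k)"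
          unfolding sum_distrib_left
        proof (rule sum_mono)
          fix k assume "k \<in> {k. 2 \<le> k \<and> q ^ k \<le> x}"
          then have "real (q ^ k) \<le> real x" unfolding of_nat_le_iff by simp
          then have "real q ^ k * (g q / real q) ^ k \<le> real x * (g q / real q) ^ k"
            using g'[OF q] by (intro mult_right_mono) auto
          moreover have "real q ^ k * (g q / real q) ^ k = g q ^ k"
            using q1 by (simp add: power_divide)
          ultimately show "g q ^ k \<le> real x * (g q / real q) ^ k" by simp
        qed
        then show "ln (real q) * g q + ln (real q) * (\<Sum>k | 2 \<le> k \<and> q ^ k \<le> x. g q ^ k) \<le>
          ln (real q) * 2 + ln (real q) * (real x * (\<Sum>k | 2 \<le> k \<and> q ^ k \<le> x. (g q / real q) ^ k))"
          using g'[OF q] q1 by (intro add_mono mult_left_mono) auto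
      qed
      also have "\<dots> = 2 * (\<Sum>q\<in>primes_upto x. ln (real q)) +
         real x * (\<Sum>q\<in>primes_upto x. ln (real q) * (\<Sum>k | 2 \<le> k \<and> q ^ k \<le> x. (g q / real q) ^ k))"
        by (simp add: sum.distrib sum_distrib_left mult_ac)
      also have "\<dots> \<le> 2 * (3 * real x) + real x * K"
        using K(2)[OF g, of x] by (intro add_mono mult_left_mono sum_ln_primes_le) auto
      finally show ?thesis by (simp add: algebra_simps)
    qed
    define F where "F = (\<Sum>m=1..N. f m / real m)"
    have "(\<Sum>n=1..N. f n * ln (real n)) = (\<Sum>n=1..N. \<Sum>d | d dvd n. f d * (Lam (n div d) * f (n div d)))"
    proof (rule sum.cong[OF refl])
      fix n assume n: "n \<in> {1..N}"
      have "f n * ln (real n) = (\<Sum>d | d dvd n. f n * Lam d)"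
        unfolding sum_distrib_left[symmetric] using n by (subst mangoldt_sum) auto
      also have "\<dots> = (\<Sum>d | d dvd n. f n * Lam (n div d))"
      proof (rule sum.reindex_bij_witness[of _ "\<lambda>d. n div d" "\<lambda>d. n div d"])
        fix d assume "d \<in> {d. d dvd n}"
        then obtain k where k: "n = d * k" by (auto elim: dvdE)
        then have "d > 0" "k > 0" using n by (auto intro: Nat.gr0I)
        then show "n div (n div d) = d" "n div d \<in> {d. d dvd n}" "f n * Lam (n div (n div d)) = f n * Lam d"
          "n div (n div d) = d" "n div d \<in> {d. d dvd n}"
          unfolding k by simp_all
      qed
      also have "\<dots> = (\<Sum>d | d dvd n. f d * (Lam (n div d) * f (n div d)))"
      proof (rule sum.cong[OF refl])
        fix d assume d: "d \<in> {d. d dvd n}"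
        then have "n = d * (n div d)" "d > 0" "n div d > 0" using n by (auto elim!: dvdE)
        then have "f n = f d * f (n div d)" unfolding f_def by (metis cmult_mult)
        then show "f n * Lam (n div d) = f d * (Lam (n div d) * f (n div d))" by simp
      qed
      finally show "f n * ln (real n) = (\<Sum>d | d dvd n. f d * (Lam (n div d) * f (n div d)))" .
    qed
    also have "\<dots> = (\<Sum>d=1..N. \<Sum>m=1..N div d. f d * (Lam m * f m))"
      by (rule sum_divisors_swap)
    also have "\<dots> = (\<Sum>d=1..N. f d * (\<Sum>m=1..N div d. Lam m * f m))"
      by (simp add: sum_distrib_left)
    also have "\<dots> \<le> (\<Sum>d=1..N. f d * ((6 + K) * (real N / real d)))"
    proof (intro sum_mono mult_left_mono f0)
      fix d assume "d \<in> {1..N}"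
      have "(\<Sum>m=1..N div d. Lam m * f m) \<le> (6 + K) * real (N div d)" by (rule D)
      also have "\<dots> \<le> (6 + K) * (real N / real d)" using K(1) by (intro mult_left_mono of_nat_div_le_of_nat) auto
      finally show "(\<Sum>m=1..N div d. Lam m * f m) \<le> (6 + K) * (real N / real d)" .
    qed
    also have "\<dots> = (6 + K) * real N * F" by (simp add: F_def sum_distrib_left mult_ac)
    finally have 1: "(\<Sum>n=1..N. f n * ln (real n)) \<le> (6 + K) * real N * F" .
    \<comment> \<open>Passing from ln n to the constant ln N costs ln(N / n) <= N / n, which is only
      one more copy of N F.\<close>
    have "(\<Sum>n=1..N. f n * ln (real N)) \<le> (\<Sum>n=1..N. f n * ln (real n) + f n * (real N / real n))"
    proof (rule sum_mono)
      fix n assume n: "n \<in> {1..N}"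
      then have "ln (real N) = ln (real n) + ln (real N / real n)" by (simp add: ln_div)
      moreover have "ln (real N / real n) \<le> real N / real n - 1" using n by (intro ln_le_minus_one) auto
      ultimately have "ln (real N) \<le> ln (real n) + real N / real n" by simp
      then have "f n * ln (real N) \<le> f n * (ln (real n) + real N / real n)"
        by (rule mult_left_mono[OF _ f0])
      then show "f n * ln (real N) \<le> f n * ln (real n) + f n * (real N / real n)" by (simp add: distrib_left)
    qed
    also have "\<dots> = (\<Sum>n=1..N. f n * ln (real n)) + real N * F"
      by (simp add: sum.distrib F_def sum_distrib_left mult_ac)
    also have "\<dots> \<le> (7 + K) * real N * F" using 1 by (simp add: algebra_simps)
    finally have "(\<Sum>n=1..N. f n) * ln (real N) \<le> (7 + K) * real N * F"
      by (simp add: sum_distrib_right)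
    also have "\<dots> \<le> (7 + K) * real N * exp ((\<Sum>q\<in>primes_upto N. g q / real q) + K')"
      unfolding F_def f_def using K(1) by (intro mult_left_mono K'(2)[OF g]) auto
    finally have "(\<Sum>n=1..N. f n) \<le> (7 + K) * real N * exp ((\<Sum>q\<in>primes_upto N. g q / real q) + K') / ln (real N)"
      using N by (simp add: pos_le_divide_eq)
    then show "(\<Sum>n=1..N. cmult g n) \<le> (7 + K) * exp K' * (real N / ln (real N)) * exp (\<Sum>q\<in>primes_upto N. g q / real q)"
      unfolding f_def by (simp add: exp_add mult_ac)
  qed
qed

section \<open>Integers composed of primes congruent to 1 modulo 4\<close>

text \<open>This is \<open>sums_two_squares'\<close> without the representation as a sum of two
  squares, which follows from the condition on the primes; see
  \<open>sums_two_squares'_eq_S1\<close>. In this form membership is visibly multiplicative.\<close>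

definition S1 :: "nat set" where
  "S1 = {n. n > 0 \<and> (\<forall>p. prime p \<longrightarrow> p dvd n \<longrightarrow> p mod 4 = 1)}"

lemma S1_pos: "n \<in> S1 \<Longrightarrow> n > 0" by (simp add: S1_def)

lemma S1_mult_iff: "m * n \<in> S1 \<longleftrightarrow> m \<in> S1 \<and> n \<in> S1"
  by (auto simp: S1_def prime_dvd_mult_iff)

lemma S1_prime: "prime p \<Longrightarrow> p mod 4 = 1 \<Longrightarrow> p \<in> S1"
  using prime_gt_0_nat[of p] primes_dvd_imp_eq[of _ p] unfolding S1_def by blast

lemma prime_mod4_ge_5:
  assumes "prime (q::nat)" "q mod 4 = 1"
  shows "q \<ge> 5"
proof (rule ccontr)
  assume "\<not> q \<ge> 5"
  then have "q \<in> {0,1,2,3,4}" by auto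
  then show False using assms by auto
qed

text \<open>Setting g to 0 outside the class 1 modulo 4 makes \<open>cmult\<close> vanish off
  \<open>S1\<close>, so sums over \<open>S1\<close> become sums over all integers. The remaining
  primes are at least 5, hence any g between 0 and 2 becomes admissible.\<close>

definition restr :: "(nat \<Rightarrow> real) \<Rightarrow> nat \<Rightarrow> real" where
  "restr g q = (if q mod 4 = 1 then g q else 0)"

lemma admissible_restr:
  assumes "\<And>q. 0 \<le> g q \<and> g q \<le> 2"
  shows "admissible (restr g)"
  unfolding admissible_def
proof (intro allI impI)
  fix q :: nat assume q: "prime q"
  show "0 \<le> restr g q \<and> restr g q \<le> 2 \<and> restr g q \<le> real q / 2"
  proof (cases "q mod 4 = 1")
    case True
    then have "real q \<ge> 5" using prime_mod4_ge_5[OF q] by simp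
    then show ?thesis using assms[of q] True by (simp add: restr_def)
  qed (simp add: restr_def)
qed

lemma cmult_restr:
  assumes "n > 0"
  shows "cmult (restr g) n = (if n \<in> S1 then cmult g n else 0)"
proof (cases "n \<in> S1")
  case True
  then have "restr g q = g q" if "q \<in># prime_factorization n" for q
    using that by (auto simp: S1_def restr_def in_prime_factors_iff)
  then show ?thesis using True unfolding cmult_def by (simp cong: image_mset_cong)
next
  case False
  then obtain p where "prime p" "p dvd n" "p mod 4 \<noteq> 1" using assms by (auto simp: S1_def)
  then have "p \<in># prime_factorization n" "restr g p = 0"
    using assms by (auto simp: in_prime_factors_iff restr_def)
  then show ?thesis using False unfolding cmult_def by (auto simp: prod_mset_zero_iff)
qed

lemma sum_cmult_restr:
  "(\<Sum>n=1..N. cmult (restr g) n * h n) = (\<Sum>n\<in>S1 \<inter> {1..N}. cmult g n * h n)"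
proof -
  have "(\<Sum>n=1..N. cmult (restr g) n * h n) = (\<Sum>n=1..N. if n \<in> S1 then cmult g n * h n else 0)"
    by (intro sum.cong refl) (auto simp: cmult_restr)
  also have "\<dots> = (\<Sum>n\<in>{1..N} \<inter> S1. cmult g n * h n)"
    by (simp add: sum.inter_restrict)
  finally show ?thesis by (simp add: Int_commute)
qed

lemma sum_restr: "(\<Sum>q\<in>P. restr g q / real q) = (\<Sum>q\<in>P. if q mod 4 = 1 then g q / real q else 0)"
  by (intro sum.cong) (auto simp: restr_def)

lemma S1_mean:
  "\<exists>C\<ge>0. \<forall>N\<ge>2. \<forall>g. (\<forall>q. 0 \<le> g q \<and> g q \<le> 2) \<longrightarrow>
     (\<Sum>n\<in>S1 \<inter> {1..N}. cmult g n) \<le>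
       C * (real N / ln (real N)) * exp (\<Sum>q\<in>primes_upto N. if q mod 4 = 1 then g q / real q else 0)"
proof -
  obtain C where C: "C \<ge> 0" "\<And>N g. N \<ge> 2 \<Longrightarrow> admissible g \<Longrightarrow>
     (\<Sum>n=1..N. cmult g n) \<le> C * (real N / ln (real N)) * exp (\<Sum>q\<in>primes_upto N. g q / real q)"
    using cmult_mean by blast
  show ?thesis
  proof (intro exI[of _ C] conjI allI impI)
    fix N :: nat and g :: "nat \<Rightarrow> real" assume N: "2 \<le> N" and g: "\<forall>q. 0 \<le> g q \<and> g q \<le> 2"
    show "(\<Sum>n\<in>S1 \<inter> {1..N}. cmult g n) \<le>
       C * (real N / ln (real N)) * exp (\<Sum>q\<in>primes_upto N. if q mod 4 = 1 then g q / real q else 0)"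
      using C(2)[OF N admissible_restr[of g]] g sum_cmult_restr[of g "\<lambda>_. 1" N] by (simp add: sum_restr)
  qed (rule C(1))
qed

lemma cmult_const_1 [simp]: "cmult (\<lambda>_. 1) n = 1" by (simp add: cmult_def)

lemma exp_half_lnln: "N \<ge> 2 \<Longrightarrow> exp (ln (ln (real N)) / 2) = sqrt (ln (real N))"
proof -
  assume "N \<ge> 2"
  then have "ln (real N) > 0" by simp
  then have "exp (ln (ln (real N)) / 2) = ln (real N) powr (1/2)" by (simp add: powr_def)
  then show ?thesis using \<open>ln (real N) > 0\<close> by (simp add: powr_half_sqrt)
qed

text \<open>The case g = 1: half of the primes contribute ln ln N / 2 to the exponent, and N / ln N
  times sqrt(ln N) is N / sqrt(ln N).\<close>

lemma S1_count_upper: "\<exists>C>0. \<forall>N\<ge>2. real (card (S1 \<inter> {1..N})) \<le> C * real N / sqrt (ln (real N))"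
proof -
  obtain C where C: "C \<ge> 0" "\<And>N g. N \<ge> 2 \<Longrightarrow> (\<forall>q. 0 \<le> g q \<and> g q \<le> 2) \<Longrightarrow>
     (\<Sum>n\<in>S1 \<inter> {1..N}. cmult g n) \<le>
       C * (real N / ln (real N)) * exp (\<Sum>q\<in>primes_upto N. if q mod 4 = 1 then g q / real q else 0)"
    using S1_mean by blast
  obtain D where D: "D \<ge> 0" "\<And>N a. N \<ge> 2 \<Longrightarrow> a \<in> {1,3} \<Longrightarrow>
     \<bar>(inv_primes a N) - ln (ln (real N)) / 2\<bar> \<le> D"
    using sum_inverse_primes_mod4 by blast
  show ?thesis
  proof (intro exI[of _ "(C + 1) * exp D"] conjI allI impI)
    show "0 < (C + 1) * exp D" using C(1) by (simp add: add_nonneg_pos)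
    fix N :: nat assume N: "2 \<le> N"
    have l: "ln (real N) > 0" using N by simp
    have "real (card (S1 \<inter> {1..N})) = (\<Sum>n\<in>S1 \<inter> {1..N}. cmult (\<lambda>_. 1) n)" by simp
    also have "\<dots> \<le> C * (real N / ln (real N)) * exp (inv_primes 1 N)"
      by (rule C(2)[OF N]) simp
    also have "\<dots> \<le> (C + 1) * (real N / ln (real N)) * exp (D + ln (ln (real N)) / 2)"
      using D(2)[OF N, of 1] C(1) l by (intro mult_mono) auto
    also have "\<dots> = (C + 1) * exp D * real N * (sqrt (ln (real N)) / ln (real N))"
      using exp_half_lnln[OF N] by (simp add: exp_add)
    also have "sqrt (ln (real N)) / ln (real N) = 1 / sqrt (ln (real N))"
    proof -
      have "sqrt (ln (real N)) * sqrt (ln (real N)) = ln (real N)" using l by simp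
      then show ?thesis using l by (simp add: field_simps)
    qed
    finally show "real (card (S1 \<inter> {1..N})) \<le> (C + 1) * exp D * real N / sqrt (ln (real N))" by simp
  qed
qed

lemma S1_harmonic_upper: "\<exists>C>0. \<forall>N\<ge>2. (\<Sum>n\<in>S1 \<inter> {1..N}. 1 / real n) \<le> C * sqrt (ln (real N))"
proof -
  obtain K where K: "K \<ge> 0" "\<And>N g. admissible g \<Longrightarrow>
     (\<Sum>m=1..N. cmult g m / real m) \<le> exp ((\<Sum>q\<in>primes_upto N. g q / real q) + K)"
    using cmult_harmonic by blast
  obtain D where D: "D \<ge> 0" "\<And>N a. N \<ge> 2 \<Longrightarrow> a \<in> {1,3} \<Longrightarrow>
     \<bar>(inv_primes a N) - ln (ln (real N)) / 2\<bar> \<le> D"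
    using sum_inverse_primes_mod4 by blast
  show ?thesis
  proof (intro exI[of _ "exp (D + K)"] conjI allI impI)
    fix N :: nat assume N: "2 \<le> N"
    have "(\<Sum>n\<in>S1 \<inter> {1..N}. 1 / real n) = (\<Sum>n=1..N. cmult (restr (\<lambda>_. 1)) n / real n)"
      using sum_cmult_restr[of "\<lambda>_. 1" "\<lambda>n. 1 / real n" N] by simp
    also have "\<dots> \<le> exp ((\<Sum>q\<in>primes_upto N. restr (\<lambda>_. 1) q / real q) + K)"
      by (rule K(2)) (auto intro: admissible_restr)
    also have "\<dots> \<le> exp ((D + ln (ln (real N)) / 2) + K)"
      using D(2)[OF N, of 1] by (simp add: sum_restr)
    also have "\<dots> = exp (D + K) * sqrt (ln (real N))"
      using exp_half_lnln[OF N] by (simp add: exp_add)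
    finally show "(\<Sum>n\<in>S1 \<inter> {1..N}. 1 / real n) \<le> exp (D + K) * sqrt (ln (real N))" .
  qed simp
qed

section \<open>Lower bounds for the density of \<open>S1\<close>\<close>

definition part :: "(nat \<Rightarrow> bool) \<Rightarrow> nat \<Rightarrow> nat" where
  "part P n = prod_mset (filter_mset P (prime_factorization n))"

lemma part_mult_compl: "n > 0 \<Longrightarrow> part P n * part (\<lambda>q. \<not> P q) n = n"
proof -
  assume "n > 0"
  then have "prod_mset (prime_factorization n) = n" by (simp add: prod_mset_prime_factorization_nat)
  then show ?thesis
    unfolding part_def prod_mset_Un[symmetric] by (simp flip: multiset_partition)
qed

lemma prime_factorization_part: "prime_factorization (part P n) = filter_mset P (prime_factorization n)"
  unfolding part_def by (rule prime_factorization_prod_mset_primes) (auto dest: in_prime_factors_imp_prime)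

lemma part_pos: "part P n > 0"
  unfolding part_def by (auto simp: prod_mset_zero_iff intro!: Nat.gr0I)

lemma prime_dvd_part: "prime p \<Longrightarrow> p dvd part P n \<Longrightarrow> P p \<and> p dvd n"
proof -
  assume p: "prime p" "p dvd part P n"
  then have "p \<in># prime_factorization (part P n)"
    using part_pos[of P n] by (auto simp: in_prime_factors_iff)
  then show ?thesis unfolding prime_factorization_part by auto
qed

lemma part_le: "n > 0 \<Longrightarrow> part P n \<le> n"
  using part_mult_compl[of n P] part_pos[of "\<lambda>q. \<not> P q" n]
  by (metis One_nat_def Suc_leI mult.right_neutral mult_le_mono2)

text \<open>A lower bound extracted from an upper bound. Every n <= N is a product a b with a in
  \<open>S1\<close> and b free of primes congruent to 1 modulo 4, so the harmonic sum ln N is at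
  most the product of the two partial harmonic sums. The second is O(sqrt(ln N)) by the Euler
  product, which forces the first to be at least of this order.\<close>

lemma S1_harmonic_lower: "\<exists>c>0. \<forall>N\<ge>2. c * sqrt (ln (real N)) \<le> (\<Sum>n\<in>S1 \<inter> {1..N}. 1 / real n)"
proof -
  obtain K where K: "K \<ge> 0" "\<And>N g. admissible g \<Longrightarrow>
     (\<Sum>m=1..N. cmult g m / real m) \<le> exp ((\<Sum>q\<in>primes_upto N. g q / real q) + K)"
    using cmult_harmonic by blast
  obtain D where D: "D \<ge> 0" "\<And>N a. N \<ge> 2 \<Longrightarrow> a \<in> {1,3} \<Longrightarrow>
     \<bar>(inv_primes a N) - ln (ln (real N)) / 2\<bar> \<le> D"
    using sum_inverse_primes_mod4 by blast
  define g :: "nat \<Rightarrow> real" where "g q = (if q mod 4 = 1 then 0 else 1)" for q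
  define E where "E = exp (D + K + 1)"
  have adm: "admissible g"
    unfolding admissible_def g_def using prime_ge_2_nat by auto
  have g01: "cmult g n \<ge> 0" for n by (rule cmult_nonneg) (simp add: g_def)
  show ?thesis
  proof (intro exI[of _ "1 / E"] conjI allI impI)
    show "0 < 1 / E" by (simp add: E_def)
    fix N :: nat assume N: "2 \<le> N"
    have l: "ln (real N) > 0" using N by simp
    have "(\<Sum>q\<in>primes_upto N. g q / real q) \<le> (\<Sum>q\<in>primes_upto N. (if q mod 4 = 3 then 1 / real q else 0) + (if q = 2 then 1 / real q else 0))"
    proof (rule sum_mono)
      fix q assume "q \<in> primes_upto N"
      then have q: "prime q" by (simp add: primes_upto_def)
      have "q = 2 \<or> q mod 4 = 1 \<or> q mod 4 = 3" using prime_mod4[OF q] .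
      then show "g q / real q \<le> (if q mod 4 = 3 then 1 / real q else 0) + (if q = 2 then 1 / real q else 0)"
        by (auto simp: g_def)
    qed
    also have "\<dots> \<le> (D + ln (ln (real N)) / 2) + 1"
      unfolding sum.distrib
    proof (rule add_mono)
      show "(inv_primes 3 N) \<le> D + ln (ln (real N)) / 2"
        using D(2)[OF N, of 3] by simp
      show "(\<Sum>q\<in>primes_upto N. if q = 2 then 1 / real q else 0) \<le> 1"
        using sum.delta[of "primes_upto N" 2 "\<lambda>q. 1 / real q"] by simp
    qed
    finally have "(\<Sum>q\<in>primes_upto N. g q / real q) + K \<le> (D + K + 1) + ln (ln (real N)) / 2" by simp
    then have "exp ((\<Sum>q\<in>primes_upto N. g q / real q) + K) \<le> exp ((D + K + 1) + ln (ln (real N)) / 2)" by simp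
    also have "\<dots> = E * sqrt (ln (real N))"
      unfolding exp_add[of "D + K + 1"] exp_half_lnln[OF N] E_def ..
    finally have B: "(\<Sum>m=1..N. cmult g m / real m) \<le> E * sqrt (ln (real N))"
      using K(2)[OF adm, of N] by linarith
    let ?a = "part (\<lambda>q. q mod 4 = 1)" and ?b = "part (\<lambda>q. \<not> (q mod 4 = 1))"
    have "ln (real N) \<le> harm N" using harm_ge_ln[of N] N by (smt (verit) ln_le_cancel_iff of_nat_0_less_iff zero_less_numeral order_less_le_trans)
    also have "harm N = (\<Sum>n=1..N. 1 / real n)" by (simp add: harm_def inverse_eq_divide)
    also have "\<dots> = (\<Sum>n=1..N. (\<lambda>(a,b). 1 / real a * (cmult g b / real b)) (?a n, ?b n))"
    proof (rule sum.cong[OF refl])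
      fix n assume n: "n \<in> {1..N}"
      have "real n = real (?a n) * real (?b n)"
        using part_mult_compl[of n "\<lambda>q. q mod 4 = 1"] n unfolding of_nat_mult[symmetric] by simp
      moreover have "cmult g (?b n) = 1"
        unfolding cmult_def prime_factorization_part by (rule prod_mset.neutral) (auto simp: g_def)
      ultimately show "1 / real n = (\<lambda>(a,b). 1 / real a * (cmult g b / real b)) (?a n, ?b n)" by simp
    qed
    also have "\<dots> = (\<Sum>z\<in>(\<lambda>n. (?a n, ?b n)) ` {1..N}. (\<lambda>(a,b). 1 / real a * (cmult g b / real b)) z)"
    proof (subst sum.reindex)
      show "inj_on (\<lambda>n. (?a n, ?b n)) {1..N}"
      proof (rule inj_onI)
        fix x y assume xy: "x \<in> {1..N}" "y \<in> {1..N}" "(?a x, ?b x) = (?a y, ?b y)"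
        then show "x = y" using part_mult_compl[of x "\<lambda>q. q mod 4 = 1"] part_mult_compl[of y "\<lambda>q. q mod 4 = 1"]
          by simp
      qed
    qed simp
    also have "\<dots> \<le> (\<Sum>z\<in>(S1 \<inter> {1..N}) \<times> {1..N}. (\<lambda>(a,b). 1 / real a * (cmult g b / real b)) z)"
    proof (rule sum_mono2)
      show "(\<lambda>n. (?a n, ?b n)) ` {1..N} \<subseteq> (S1 \<inter> {1..N}) \<times> {1..N}"
      proof (safe, goal_cases)
        case (1 a b n)
        then show ?case using part_pos prime_dvd_part[where P = "\<lambda>q. q mod 4 = 1"] unfolding S1_def by blast
      next
        case (2 a b n)
        then show ?case using part_pos[of "\<lambda>q. q mod 4 = 1" n] part_le[of n "\<lambda>q. q mod 4 = 1"] by auto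
      next
        case (3 a b n)
        then show ?case using part_pos[of "\<lambda>q. \<not> (q mod 4 = 1)" n] part_le[of n "\<lambda>q. \<not> (q mod 4 = 1)"] by auto
      qed
      show "0 \<le> (\<lambda>(a,b). 1 / real a * (cmult g b / real b)) z" for z
        using g01 by (auto simp: case_prod_unfold)
    qed simp
    also have "\<dots> = (\<Sum>n\<in>S1 \<inter> {1..N}. 1 / real n) * (\<Sum>m=1..N. cmult g m / real m)"
      by (simp add: sum_product sum.cartesian_product)
    also have "\<dots> \<le> (\<Sum>n\<in>S1 \<inter> {1..N}. 1 / real n) * (E * sqrt (ln (real N)))"
      by (intro mult_left_mono B sum_nonneg) auto
    finally have "sqrt (ln (real N)) * sqrt (ln (real N)) \<le> ((\<Sum>n\<in>S1 \<inter> {1..N}. 1 / real n) * E) * sqrt (ln (real N))"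
      using l by (simp add: mult_ac)
    then have "sqrt (ln (real N)) \<le> (\<Sum>n\<in>S1 \<inter> {1..N}. 1 / real n) * E"
      using l by (simp only: mult_le_cancel_right_pos real_sqrt_gt_0_iff)
    then show "1 / E * sqrt (ln (real N)) \<le> (\<Sum>n\<in>S1 \<inter> {1..N}. 1 / real n)"
      by (simp add: E_def field_simps)
  qed
qed

text \<open>The Mertens sum over the primes in (x / K, x] is at least ln K / 2 - 2 C, hence at least
  1 once K is large, while each of its terms is at most K ln x / x.\<close>

lemma primes_mod4_interval:
  "\<exists>K\<ge>1. \<forall>x\<ge>K. real x / (real K * ln (real x)) \<le> real (card {p. prime p \<and> p mod 4 = 1 \<and> x div K < p \<and> p \<le> x})"
proof -
  obtain C where C: "C \<ge> 0" "\<And>N a. N \<ge> 1 \<Longrightarrow> a \<in> {1,3} \<Longrightarrow>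
     \<bar>(\<Sum>q\<in>primes_upto N. if q mod 4 = a then ln (real q) / real q else 0) - ln (real N) / 2\<bar> \<le> C"
    using mertens_mod4 by blast
  \<comment> \<open>Half of ln K has to exceed the two errors C at x and at x div K by 1.\<close>
  define K where "K = nat \<lceil>exp (4 * C + 2)\<rceil>"
  have K1: "real K \<ge> exp (4 * C + 2)" unfolding K_def by (simp add: le_nat_iff real_nat_ceiling_ge)
  then have lnK: "ln (real K) \<ge> 4 * C + 2"
    by (smt (verit) exp_gt_zero ln_exp ln_le_cancel_iff)
  have "real K \<ge> 2" using K1 exp_ge_add_one_self[of "4 * C + 2"] C(1) by linarith
  then have K2: "K \<ge> 2" by simp
  show ?thesis
  proof (intro exI[of _ K] conjI allI impI)
    show "K \<ge> 1" using K2 by simp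
    fix x assume x: "K \<le> x"
    define y where "y = x div K"
    have y: "1 \<le> y" "y \<le> x" unfolding y_def using x K2
      by (auto simp: Suc_le_eq div_greater_zero_iff)
    have lx: "ln (real x) > 0" using x K2 by simp
    let ?A = "{p. prime p \<and> p mod 4 = 1 \<and> y < p \<and> p \<le> x}"
    let ?f = "\<lambda>q. if q mod 4 = 1 then ln (real q) / real q else 0 :: real"
    have "(\<Sum>q\<in>primes_upto x. ?f q) = (\<Sum>q\<in>primes_upto y. ?f q) + (\<Sum>q\<in>primes_upto x - primes_upto y. ?f q)"
      using y by (intro sum.subset_diff[THEN trans[OF _ add.commute]]) (auto simp: primes_upto_def)
    also have "(\<Sum>q\<in>primes_upto x - primes_upto y. ?f q) = (\<Sum>q\<in>?A. ln (real q) / real q)"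
      by (rule sum.mono_neutral_cong_right) (auto simp: primes_upto_def)
    finally have "(\<Sum>q\<in>?A. ln (real q) / real q) = (\<Sum>q\<in>primes_upto x. ?f q) - (\<Sum>q\<in>primes_upto y. ?f q)" by simp
    moreover have "real y * real K \<le> real x"
      using of_nat_div_le_of_nat[of x K] K2 by (simp add: y_def field_simps)
    then have "ln (real y) + ln (real K) \<le> ln (real x)"
      using y K2 x by (subst ln_mult_pos[symmetric]) auto
    ultimately have "1 \<le> (\<Sum>q\<in>?A. ln (real q) / real q)"
      using C(2)[of x 1] C(2)[of y 1] y lnK by simp
    also have "\<dots> \<le> (\<Sum>q\<in>?A. ln (real x) * (real K / real x))"
    proof (rule sum_mono)
      fix q assume q: "q \<in> ?A"
      have "real x / real K \<le> real q"
        using real_div_le_Suc[of x K] q by (simp add: y_def)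
      then have "1 / real q \<le> real K / real x" using q K2 x prime_gt_0_nat[of q] by (auto simp: field_simps)
      then have "ln (real q) * (1 / real q) \<le> ln (real x) * (real K / real x)"
        using q prime_gt_0_nat[of q] by (intro mult_mono) auto
      then show "ln (real q) / real q \<le> ln (real x) * (real K / real x)" by simp
    qed
    also have "\<dots> = real (card ?A) * (ln (real x) * (real K / real x))" by simp
    finally show "real x / (real K * ln (real x)) \<le> real (card {p. prime p \<and> p mod 4 = 1 \<and> x div K < p \<and> p \<le> x})"
      using lx K2 x unfolding y_def by (simp add: field_simps)
  qed
qed

lemma ln_nat_ge_1: "n \<ge> 3 \<Longrightarrow> ln (real n) \<ge> 1"
proof -
  assume "n \<ge> 3"
  then have "exp 1 \<le> real n" using exp_le by linarith
  then show ?thesis using \<open>n \<ge> 3\<close> by (subst ln_ge_iff) auto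
qed

text \<open>The normalisation is the order of magnitude of the counting function of \<open>S1\<close>.\<close>

definition small :: "(nat \<Rightarrow> real) \<Rightarrow> bool" where
  "small f \<longleftrightarrow> ((\<lambda>N. f N * sqrt (ln (real N)) / real N) \<longlonglongrightarrow> 0)"

text \<open>Counts products k p with k in \<open>S1\<close>, k <= m about N^(1/3), and p a prime
  congruent to 1 modulo 4 just below N / k. Since K <= m and m^3 <= N, such p exceeds m and cannot
  divide any admissible k, so the product determines p and k. The sum of 1 / k over
  \<open>S1\<close> turns the prime density 1 / ln N into 1 / sqrt(ln N).\<close>

lemma S1_count_lower:
  "\<exists>c>0. \<exists>N0\<ge>2. \<forall>N\<ge>N0. c * real N / sqrt (ln (real N)) \<le> real (card (S1 \<inter> {1..N}))"
proof -
  obtain K :: nat where K: "K \<ge> 1" "\<And>x. x \<ge> K \<Longrightarrow> real x / (real K * ln (real x)) \<le> real (card {p. prime p \<and> p mod 4 = 1 \<and> x div K < p \<and> p \<le> x})"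
    using primes_mod4_interval by blast
  obtain c where c: "c > 0" "\<And>N. N \<ge> 2 \<Longrightarrow> c * sqrt (ln (real N)) \<le> (\<Sum>n\<in>S1 \<inter> {1..N}. 1 / real n)"
    using S1_harmonic_lower by blast
  define M where "M N = nat \<lfloor>real N powr (1/3)\<rfloor>" for N
  have "filterlim M at_top sequentially" unfolding M_def by real_asymp
  then have "eventually (\<lambda>N. M N \<ge> max K 2) sequentially" unfolding filterlim_at_top by (rule spec)
  then obtain N0 where N0: "\<And>N. N \<ge> N0 \<Longrightarrow> M N \<ge> max K 2" by (auto simp: eventually_sequentially)
  show ?thesis
  proof (intro exI[of _ "c / (6 * real K)"] exI[of _ "max N0 2"] conjI allI impI)
    show "0 < c / (6 * real K)" using c(1) K(1) by simp
    fix N :: nat assume N: "max N0 2 \<le> N"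
    define m where "m = M N"
    have m: "m \<ge> K" "m \<ge> 2" using N0[of N] N by (auto simp: m_def)
    have "real m \<le> real N powr (1/3)" unfolding m_def M_def by simp
    then have "real m ^ 3 \<le> (real N powr (1/3)) ^ 3" by (intro power_mono) auto
    also have "\<dots> = real N" using N by (simp add: powr_powr flip: powr_realpow)
    finally have m3: "m ^ 3 \<le> N" unfolding of_nat_power[symmetric] of_nat_le_iff .
    \<comment> \<open>From N^(1/3) <= m + 1 <= m^2.\<close>
    have lm: "ln (real N) \<le> 6 * ln (real m)"
    proof -
      have "real N powr (1/3) \<le> real m + 1" unfolding m_def M_def by linarith
      then have "ln (real N powr (1/3)) \<le> ln (real m + 1)" using N by (subst ln_le_cancel_iff) auto
      also have "\<dots> \<le> ln (real m ^ 2)"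
      proof (subst ln_le_cancel_iff)
        have "2 * real m \<le> real m * real m" using m by (intro mult_right_mono) auto
        moreover have "real m + 1 \<le> 2 * real m" using m by simp
        ultimately show "real m + 1 \<le> real m ^ 2" unfolding power2_eq_square by linarith
      qed (use m in auto)
      also have "\<dots> = 2 * ln (real m)" using m by (simp add: ln_realpow)
      finally show ?thesis using N by (simp add: ln_powr)
    qed
    have lN: "ln (real N) > 0" using N by simp
    define Q where "Q k = {p. prime p \<and> p mod 4 = 1 \<and> (N div k) div K < p \<and> p \<le> N div k}" for k
    have Qbig: "p > m" if "p \<in> Q k" "k \<in> {1..m}" for p k
    proof -
      have "m * (k * K) \<le> m * (m * m)" using m that by (intro mult_mono) auto
      also have "\<dots> \<le> N" using m3 by (simp add: power3_eq_cube mult.assoc)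
      finally have "m \<le> N div (k * K)" using that K(1)
        by (simp add: less_eq_div_iff_mult_less_eq)
      then show ?thesis using that by (simp add: Q_def div_mult2_eq)
    qed
    have Qcard: "real N / (2 * real k * real K * ln (real N)) \<le> real (card (Q k))" if k: "k \<in> {1..m}" for k
    proof -
      have mm: "m \<le> m * m" by (rule le_square)
      then have "k \<le> m * m" using k by (meson atLeastAtMost_iff le_trans)
      then have "K * k \<le> m * (m * m)" using m by (intro mult_le_mono) auto
      then have "K * k \<le> N" using m3 by (simp add: power3_eq_cube mult.assoc)
      then have x: "N div k \<ge> K" using k by (simp add: less_eq_div_iff_mult_less_eq)
      have k2: "k < N" using k m3 m self_le_power[of m 3] power_strict_increasing[of 1 3 m] by simp
      have x2: "real (N div k) \<ge> real N / (2 * real k)"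
      proof -
        have "N div k \<ge> 1" using x K(1) by simp
        then have "real (N div k) \<ge> 1" by linarith
        then show ?thesis using real_div_le_Suc[of N k] by simp
      qed
      show ?thesis
      proof (cases "ln (real (N div k)) > 0")
        case True
        have "N div k \<le> N" by simp
        then have "ln (real (N div k)) \<le> ln (real N)" using x K(1) N by simp
        then have "real N / (2 * real k) / (real K * ln (real N)) \<le> real (N div k) / (real K * ln (real (N div k)))"
          using x2 K(1) True by (intro frac_le mult_left_mono mult_pos_pos) auto
        also have "\<dots> \<le> real (card (Q k))" using K(2)[OF x] by (simp add: Q_def)
        finally show ?thesis by (simp add: mult_ac)
      next
        case False
        have "N div k \<le> 1"
        proof (rule ccontr)
          assume "\<not> N div k \<le> 1"
          then have "1 < real (N div k)" by linarith
          then show False using False ln_gt_zero by blast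
        qed
        then have "N div k = 1" using x K(1) by simp
        moreover have "k * 2 \<le> N"
        proof -
          have "2 \<le> m * m" using mm m(2) by linarith
          then have "k * 2 \<le> m * (m * m)" using k by (intro mult_le_mono) auto
          then show ?thesis using m3 by (simp add: power3_eq_cube mult.assoc)
        qed
        ultimately show ?thesis using k less_eq_div_iff_mult_less_eq[of k 2 N] by (simp add: mult.commute)
      qed
    qed
    have fQ: "finite (Q k)" for k unfolding Q_def by simp
    let ?A = "SIGMA k:S1 \<inter> {1..m}. Q k"
    have "c * sqrt (ln (real m)) * (real N / (2 * real K * ln (real N))) \<le> (\<Sum>k\<in>S1 \<inter> {1..m}. 1 / real k) * (real N / (2 * real K * ln (real N)))"
      using lN by (intro mult_right_mono c(2) m) auto
    also have "\<dots> = (\<Sum>k\<in>S1 \<inter> {1..m}. real N / (2 * real k * real K * ln (real N)))"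
      unfolding sum_distrib_right by (intro sum.cong) (auto simp: mult_ac)
    also have "\<dots> \<le> (\<Sum>k\<in>S1 \<inter> {1..m}. real (card (Q k)))"
      by (intro sum_mono Qcard) auto
    also have "\<dots> = real (card ?A)" by (subst card_SigmaI) (auto simp: fQ)
    also have "card ?A \<le> card (S1 \<inter> {1..N})"
    proof (rule card_inj_on_le[of "\<lambda>(k,p). k * p"])
      show "inj_on (\<lambda>(k,p). k * p) ?A"
      proof (rule inj_onI, clarify)
        fix k p k' p' assume 1: "p \<in> Q k" "k \<in> {1..m}" "p' \<in> Q k'" "k' \<in> {1..m}" "k * p = k' * p'"
        have pr: "prime p" "prime p'" using 1 by (auto simp: Q_def)
        have "p dvd k' * p'" using 1(5) by (metis dvd_triv_right)
        then have "p dvd k' \<or> p dvd p'" using pr prime_dvd_mult_iff by blast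
        moreover have "\<not> p dvd k'" using Qbig[OF 1(1,2)] 1(4) dvd_imp_le[of p k'] by auto
        ultimately have "p = p'" using pr primes_dvd_imp_eq by blast
        then show "k = k' \<and> p = p'" using 1(5) pr prime_gt_0_nat[of p] by simp
      qed
      show "(\<lambda>(k,p). k * p) ` ?A \<subseteq> S1 \<inter> {1..N}"
      proof (clarify, intro IntI)
        fix k p assume 1: "k \<in> S1" "k \<in> {1..m}" "p \<in> Q k"
        show "k * p \<in> S1" using 1 by (auto simp: S1_mult_iff Q_def intro: S1_prime)
        have "k * p \<le> k * (N div k)" using 1 by (intro mult_left_mono) (auto simp: Q_def)
        also have "\<dots> \<le> N" by simp
        finally show "k * p \<in> {1..N}" using 1 prime_gt_0_nat[of p] by (auto simp: Q_def Suc_le_eq)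
      qed
    qed simp
    finally have main: "c * sqrt (ln (real m)) * (real N / (2 * real K * ln (real N))) \<le> real (card (S1 \<inter> {1..N}))" by simp
    have "0 \<le> ln (real m)" using m by simp
    then have "sqrt (ln (real N)) \<le> sqrt (9 * ln (real m))" using lm by (intro real_sqrt_le_mono) linarith
    also have "\<dots> = 3 * sqrt (ln (real m))" by (simp add: real_sqrt_mult)
    finally have "c * (sqrt (ln (real N)) / 3) * (real N / (2 * real K * ln (real N))) \<le> c * sqrt (ln (real m)) * (real N / (2 * real K * ln (real N)))"
      using c(1) lN by (intro mult_right_mono mult_left_mono) auto
    moreover have "c * (sqrt (ln (real N)) / 3) * (real N / (2 * real K * ln (real N))) = c / (6 * real K) * real N / sqrt (ln (real N))"
    proof -
      have "sqrt (ln (real N)) * sqrt (ln (real N)) = ln (real N)" using lN by simp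
      then show ?thesis using lN K(1) by (simp add: field_simps)
    qed
    ultimately show "c / (6 * real K) * real N / sqrt (ln (real N)) \<le> real (card (S1 \<inter> {1..N}))"
      using main by linarith
  qed simp
qed

section \<open>Tail bounds for the number of prime factors\<close>

abbreviation Om :: "nat \<Rightarrow> nat" where "Om n \<equiv> size (prime_factorization n)"

lemma cmult_const: "cmult (\<lambda>_. y) n = y ^ Om n"
  by (simp add: cmult_def)

lemma cmult_two_on:
  "cmult (\<lambda>q. if P q then 2 else 1) n = 2 ^ size (filter_mset P (prime_factorization n))"
proof -
  have "(\<Prod>q\<in>#M. if P q then 2 else 1 :: real) = 2 ^ size (filter_mset P M)" for M
    by (induction M) auto
  then show ?thesis by (simp add: cmult_def)
qed

lemma smallI:
  assumes "eventually (\<lambda>N. 0 \<le> f N \<and> f N \<le> C * (real N / sqrt (ln (real N))) * h N) sequentially" "h \<longlonglongrightarrow> 0"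
  shows "small f"
  unfolding small_def
proof (rule tendsto_sandwich[OF _ _ tendsto_const])
  show "(\<lambda>N. C * h N) \<longlonglongrightarrow> 0" using tendsto_mult_right_zero[OF assms(2), of C] by simp
  show "eventually (\<lambda>N. 0 \<le> f N * sqrt (ln (real N)) / real N) sequentially"
    using assms(1) eventually_gt_at_top[of 1] by eventually_elim simp
  show "eventually (\<lambda>N. f N * sqrt (ln (real N)) / real N \<le> C * h N) sequentially"
    using assms(1) eventually_gt_at_top[of 1]
  proof eventually_elim
    case (elim N)
    then have l: "sqrt (ln (real N)) > 0" "real N > 0" by auto
    then have "f N * (sqrt (ln (real N)) / real N) \<le> C * (real N / sqrt (ln (real N))) * h N * (sqrt (ln (real N)) / real N)"
      using elim by (intro mult_right_mono) auto
    also have "\<dots> = C * h N" using l by simp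
    finally show ?case by simp
  qed
qed

abbreviation many_primes :: "real \<Rightarrow> nat \<Rightarrow> nat set" where
  "many_primes \<eta> N \<equiv> {n \<in> S1 \<inter> {1..N}. real (Om n) > (1/2 + \<eta>) * ln (ln (real N))}"

text \<open>Rankin's trick with the weight y^Omega(n), y = exp eta. With L = ln N, the mean of the
  weight is at most of order N L^(y/2 - 1) and y <= 1 + eta + eta^2; dividing by the weight L^(eta
  (1/2 + eta)) at the threshold leaves N L^(-1/2 - eta^2/2), a power of L below the size of
  \<open>S1\<close>.\<close>

lemma typical_Omega:
  assumes "0 < \<eta>" "\<eta> \<le> 1/2"
  shows "small (\<lambda>N. real (card (many_primes \<eta> N)))"
proof -
  obtain C where C: "C \<ge> 0" "\<And>N g. N \<ge> 2 \<Longrightarrow> (\<forall>q. 0 \<le> g q \<and> g q \<le> 2) \<Longrightarrow>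
     (\<Sum>n\<in>S1 \<inter> {1..N}. cmult g n) \<le>
       C * (real N / ln (real N)) * exp (\<Sum>q\<in>primes_upto N. if q mod 4 = 1 then g q / real q else 0)"
    using S1_mean by blast
  obtain D where D: "D \<ge> 0" "\<And>N a. N \<ge> 2 \<Longrightarrow> a \<in> {1,3} \<Longrightarrow>
     \<bar>(inv_primes a N) - ln (ln (real N)) / 2\<bar> \<le> D"
    using sum_inverse_primes_mod4 by blast
  define y where "y = exp \<eta>"
  have "exp \<eta> \<le> 1 + \<eta> + \<eta>\<^sup>2" using assms by (intro exp_bound) auto
  moreover have "\<eta>\<^sup>2 \<le> (1/2)\<^sup>2" using assms by (intro power_mono) auto
  ultimately have y: "y \<le> 1 + \<eta> + \<eta>\<^sup>2" "y \<le> 2" "y \<ge> 0" using assms by (auto simp: y_def power2_eq_square)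
  show ?thesis
  proof (rule smallI[where h = "\<lambda>N. ln (real N) powr (-(\<eta>\<^sup>2/2))" and C = "C * exp (2 * D)"])
    show "(\<lambda>N. ln (real N) powr (-(\<eta>\<^sup>2/2))) \<longlonglongrightarrow> 0" using assms by real_asymp
    show "eventually (\<lambda>N. 0 \<le> real (card (many_primes \<eta> N)) \<and>
       real (card (many_primes \<eta> N)) \<le>
        C * exp (2 * D) * (real N / sqrt (ln (real N))) * ln (real N) powr (-(\<eta>\<^sup>2/2))) sequentially"
      using eventually_ge_at_top[of 3]
    proof (eventually_elim, intro conjI)
      case (elim N)
      define L where "L = ln (real N)"
      have L: "L \<ge> 1" unfolding L_def by (rule ln_nat_ge_1) (use elim in auto)
      let ?T = "{n \<in> S1 \<inter> {1..N}. real (Om n) > (1/2 + \<eta>) * ln L}"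
      have "real (card ?T) * exp (\<eta> * ((1/2 + \<eta>) * ln L)) = (\<Sum>n\<in>?T. exp (\<eta> * ((1/2 + \<eta>) * ln L)))" by simp
      also have "\<dots> \<le> (\<Sum>n\<in>?T. y ^ Om n)"
      proof (rule sum_mono)
        fix n assume "n \<in> ?T"
        then have "\<eta> * ((1/2 + \<eta>) * ln L) \<le> \<eta> * real (Om n)" using assms by (intro mult_left_mono) auto
        then show "exp (\<eta> * ((1/2 + \<eta>) * ln L)) \<le> y ^ Om n"
          by (simp add: y_def exp_of_nat_mult[symmetric] mult.commute)
      qed
      also have "\<dots> \<le> (\<Sum>n\<in>S1 \<inter> {1..N}. cmult (\<lambda>_. y) n)"
        unfolding cmult_const using y by (intro sum_mono2) auto
      also have "\<dots> \<le> C * (real N / L) * exp (\<Sum>q\<in>primes_upto N. if q mod 4 = 1 then y / real q else 0)"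
        unfolding L_def using elim y by (intro C(2)) auto
      also have "(\<Sum>q\<in>primes_upto N. if q mod 4 = 1 then y / real q else 0) = y * (inv_primes 1 N)"
        unfolding sum_distrib_left by (intro sum.cong) auto
      also have "C * (real N / L) * exp \<dots> \<le> C * (real N / L) * exp (2 * D + (1 + \<eta> + \<eta>\<^sup>2) * (ln L / 2))"
      proof (intro mult_left_mono)
        have "y * (inv_primes 1 N) \<le> y * (D + ln L / 2)"
          using D(2)[of N 1] elim y unfolding L_def by (intro mult_left_mono) auto
        also have "\<dots> \<le> 2 * D + (1 + \<eta> + \<eta>\<^sup>2) * (ln L / 2)"
          unfolding distrib_left using y D(1) L by (intro add_mono mult_right_mono) auto
        finally show "exp (y * (inv_primes 1 N)) \<le> exp (2 * D + (1 + \<eta> + \<eta>\<^sup>2) * (ln L / 2))"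
          by simp
      qed (use C(1) L in auto)
      finally have "real (card ?T) \<le> C * (real N / L) * exp (2 * D + (1 + \<eta> + \<eta>\<^sup>2) * (ln L / 2)) / exp (\<eta> * ((1/2 + \<eta>) * ln L))"
        by (subst pos_le_divide_eq) auto
      also have "\<dots> = C * (real N / L) * exp ((2 * D + (1 + \<eta> + \<eta>\<^sup>2) * (ln L / 2)) - \<eta> * ((1/2 + \<eta>) * ln L))"
        by (simp only: exp_diff times_divide_eq_right)
      also have "\<dots> = C * (real N / L) * exp (2 * D + (1/2) * ln L + (-(\<eta>\<^sup>2/2)) * ln L)"
        by (rule arg_cong[where f = "\<lambda>t. C * (real N / L) * exp t"]) (simp add: field_simps power2_eq_square)
      also have "\<dots> = C * exp (2 * D) * (real N / L * L powr (1/2)) * L powr (-(\<eta>\<^sup>2/2))"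
      proof -
        have e: "L powr a = exp (a * ln L)" for a using L by (simp add: powr_def)
        show ?thesis unfolding e exp_add by (simp add: mult_ac)
      qed
      also have "real N / L * L powr (1/2) = real N / sqrt L"
        using L by (simp add: powr_half_sqrt real_div_sqrt field_simps)
      finally show "real (card (many_primes \<eta> N)) \<le>
        C * exp (2 * D) * (real N / sqrt (ln (real N))) * ln (real N) powr (-(\<eta>\<^sup>2/2))"
        by (simp add: L_def)
    qed simp
  qed
qed

abbreviation many_small_primes :: "real \<Rightarrow> nat \<Rightarrow> nat set" where
  "many_small_primes A N \<equiv> {n \<in> S1 \<inter> {1..N}.
     real (size (filter_mset (\<lambda>q. real q \<le> ln (real N) powr A) (prime_factorization n))) > ln (ln (real N)) powr (1/4)}"

text \<open>Rankin's trick with weight 2 on each prime up to (ln N)^A. The sum of their reciprocals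
  adds only ln(A ln ln N) / 2 to the exponent, so the weight has mean of order sqrt(A ln ln N),
  against 2^((ln ln N)^(1/4)) at the threshold. Any positive power in place of 1/4 would do here; it
  has to stay below 1/2 for the arcs and for the remaining part of n.\<close>

lemma typical_smooth_Omega:
  assumes "A > 0"
  shows "small (\<lambda>N. real (card (many_small_primes A N)))"
proof -
  obtain C where C: "C \<ge> 0" "\<And>N g. N \<ge> 2 \<Longrightarrow> (\<forall>q. 0 \<le> g q \<and> g q \<le> 2) \<Longrightarrow>
     (\<Sum>n\<in>S1 \<inter> {1..N}. cmult g n) \<le>
       C * (real N / ln (real N)) * exp (\<Sum>q\<in>primes_upto N. if q mod 4 = 1 then g q / real q else 0)"
    using S1_mean by blast
  obtain D where D: "D \<ge> 0" "\<And>N a. N \<ge> 2 \<Longrightarrow> a \<in> {1,3} \<Longrightarrow>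
     \<bar>(inv_primes a N) - ln (ln (real N)) / 2\<bar> \<le> D"
    using sum_inverse_primes_mod4 by blast
  let ?h = "\<lambda>N. exp (ln (A * ln (ln (real N))) / 2) * exp (- ln 2 * ln (ln (real N)) powr (1/4))"
  let ?T = "\<lambda>N. (many_small_primes A N)"
  show ?thesis
  proof (rule smallI[where h = ?h and C = "C * exp (2 * D)"])
    show "?h \<longlonglongrightarrow> 0" using assms by real_asymp
    have "eventually (\<lambda>N. ln (real N) powr A \<ge> 2) sequentially" using assms by real_asymp
    then show "eventually (\<lambda>N. 0 \<le> real (card (?T N)) \<and>
       real (card (?T N)) \<le> C * exp (2 * D) * (real N / sqrt (ln (real N))) * ?h N) sequentially"
      using eventually_ge_at_top[of 3]
    proof (eventually_elim, intro conjI)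
      case (elim N)
      define L where "L = ln (real N)"
      have L: "L \<ge> 1" unfolding L_def by (rule ln_nat_ge_1) (use elim in auto)
      define Y where "Y = L powr A"
      have Y: "Y \<ge> 2" using elim by (simp add: Y_def L_def)
      define g :: "nat \<Rightarrow> real" where "g q = (if real q \<le> Y then 2 else 1)" for q
      have "real (card (?T N)) * exp (ln 2 * ln L powr (1/4)) = (\<Sum>n\<in>?T N. exp (ln 2 * ln L powr (1/4)))" by simp
      also have "\<dots> \<le> (\<Sum>n\<in>?T N. cmult g n)"
      proof (rule sum_mono)
        fix n assume "n \<in> ?T N"
        then have "ln 2 * ln L powr (1/4) \<le> ln 2 * real (size (filter_mset (\<lambda>q. real q \<le> Y) (prime_factorization n)))"
          unfolding L_def Y_def by (intro mult_left_mono) auto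
        then have "exp (ln 2 * ln L powr (1/4)) \<le> exp (ln 2 * real (size (filter_mset (\<lambda>q. real q \<le> Y) (prime_factorization n))))"
          by simp
        also have "\<dots> = cmult g n"
          unfolding g_def cmult_two_on by (simp add: exp_of_nat2_mult)
        finally show "exp (ln 2 * ln L powr (1/4)) \<le> cmult g n" .
      qed
      also have "\<dots> \<le> (\<Sum>n\<in>S1 \<inter> {1..N}. cmult g n)"
        by (intro sum_mono2) (auto intro!: cmult_nonneg simp: g_def)
      also have "\<dots> \<le> C * (real N / L) * exp (\<Sum>q\<in>primes_upto N. if q mod 4 = 1 then g q / real q else 0)"
        unfolding L_def using elim by (intro C(2)) (auto simp: g_def)
      also have "\<dots> \<le> C * (real N / L) * exp ((D + ln L / 2) + (D + ln (A * ln L) / 2))"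
      proof (intro mult_left_mono)
        define y where "y = nat \<lfloor>Y\<rfloor>"
        have y: "y \<ge> 2" "real y \<le> Y" using Y by (auto simp: y_def le_nat_iff le_floor_iff)
        have "(\<Sum>q\<in>primes_upto N. if q mod 4 = 1 then g q / real q else 0) =
          (inv_primes 1 N) + (\<Sum>q\<in>primes_upto N. if q mod 4 = 1 \<and> real q \<le> Y then 1 / real q else 0)"
          unfolding sum.distrib[symmetric] by (intro sum.cong) (auto simp: g_def)
        also have "(\<Sum>q\<in>primes_upto N. if q mod 4 = 1 \<and> real q \<le> Y then 1 / real q else 0) = (\<Sum>q\<in>{q\<in>primes_upto N. real q \<le> Y}. if q mod 4 = 1 then 1 / real q else 0)"
          by (rule sum.mono_neutral_cong_right) auto
        also have "\<dots> \<le> (inv_primes 1 y)"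
          by (rule sum_mono2) (auto simp: primes_upto_def y_def le_nat_iff le_floor_iff)
        also have "\<dots> \<le> D + ln (ln (real y)) / 2" using D(2)[of y 1] y by simp
        also have "ln (ln (real y)) \<le> ln (ln Y)" using y Y by simp
        also have "ln Y = A * ln L" using L by (simp add: Y_def ln_powr)
        finally have "(\<Sum>q\<in>primes_upto N. if q mod 4 = 1 then g q / real q else 0) \<le> (inv_primes 1 N) + (D + ln (A * ln L) / 2)"
          by simp
        moreover have "(inv_primes 1 N) \<le> D + ln L / 2"
          using D(2)[of N 1] elim by (simp add: L_def)
        ultimately show "exp (\<Sum>q\<in>primes_upto N. if q mod 4 = 1 then g q / real q else 0) \<le> exp ((D + ln L / 2) + (D + ln (A * ln L) / 2))"
          by simp
      qed (use C(1) L in auto)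
      finally have "real (card (?T N)) \<le> C * (real N / L) * exp ((D + ln L / 2) + (D + ln (A * ln L) / 2)) / exp (ln 2 * ln L powr (1/4))"
        by (subst pos_le_divide_eq) auto
      also have "\<dots> = C * exp (2 * D) * (real N / L * exp (ln L / 2)) * (exp (ln (A * ln L) / 2) * exp (- ln 2 * ln L powr (1/4)))"
        by (simp add: exp_add exp_minus field_simps mult_exp_exp)
      also have "real N / L * exp (ln L / 2) = real N / sqrt L"
      proof -
        have "exp (ln L / 2) = sqrt L" using exp_half_lnln[of N] elim by (simp add: L_def)
        then show ?thesis using L by (simp add: real_div_sqrt field_simps)
      qed
      finally show "real (card (?T N)) \<le> C * exp (2 * D) * (real N / sqrt (ln (real N))) * ?h N"
        by (simp add: L_def)
    qed simp
  qed
qed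

section \<open>The Brun sieve\<close>

text \<open>The elementary symmetric polynomial of degree j. The sets D stand for squarefree sieve
  moduli with j prime factors.\<close>

definition esym :: "nat \<Rightarrow> ('a \<Rightarrow> real) \<Rightarrow> 'a set \<Rightarrow> real" where
  "esym j x P = (\<Sum>D | D \<subseteq> P \<and> card D = j. \<Prod>q\<in>D. x q)"

lemma esym_0 [simp]: "finite P \<Longrightarrow> esym 0 x P = 1"
proof -
  assume P: "finite P"
  have "{D. D \<subseteq> P \<and> card D = 0} = {{}}" using P finite_subset by fastforce
  then show ?thesis by (simp add: esym_def)
qed

lemma esym_Suc_empty [simp]: "esym (Suc j) x {} = 0"
proof -
  have "{D. D \<subseteq> {} \<and> card D = Suc j} = ({} :: 'a set set)" by auto
  then show ?thesis unfolding esym_def by (metis sum.empty)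
qed

lemma esym_insert:
  assumes "finite P" "q \<notin> P"
  shows "esym (Suc j) x (insert q P) = esym (Suc j) x P + x q * esym j x P"
proof -
  have split: "{D. D \<subseteq> insert q P \<and> card D = Suc j} = {D. D \<subseteq> P \<and> card D = Suc j} \<union> insert q ` {D. D \<subseteq> P \<and> card D = j}"
  proof (intro equalityI subsetI)
    fix D assume D: "D \<in> {D. D \<subseteq> insert q P \<and> card D = Suc j}"
    then have fin: "finite D" using assms(1) by (auto intro: finite_subset)
    show "D \<in> {D. D \<subseteq> P \<and> card D = Suc j} \<union> insert q ` {D. D \<subseteq> P \<and> card D = j}"
    proof (cases "q \<in> D")
      case True
      then have "D = insert q (D - {q})" "card (D - {q}) = j" "D - {q} \<subseteq> P" using D fin by auto
      then show ?thesis by blast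
    qed (use D in auto)
  next
    fix D assume "D \<in> {D. D \<subseteq> P \<and> card D = Suc j} \<union> insert q ` {D. D \<subseteq> P \<and> card D = j}"
    then show "D \<in> {D. D \<subseteq> insert q P \<and> card D = Suc j}"
      using assms by (auto simp: card_insert_if finite_subset dest: finite_subset)
  qed
  have inj: "inj_on (insert q) {D. D \<subseteq> P \<and> card D = j}"
    using assms(2) by (auto simp: inj_on_def)
  have fin: "finite {D. D \<subseteq> P \<and> card D = i}" for i
    by (rule finite_subset[of _ "Pow P"]) (use assms in auto)
  have "esym (Suc j) x (insert q P) = esym (Suc j) x P + (\<Sum>D\<in>insert q ` {D. D \<subseteq> P \<and> card D = j}. \<Prod>q\<in>D. x q)"
    unfolding esym_def split using fin assms(2) by (intro sum.union_disjoint) auto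
  also have "(\<Sum>D\<in>insert q ` {D. D \<subseteq> P \<and> card D = j}. \<Prod>q\<in>D. x q) = (\<Sum>D | D \<subseteq> P \<and> card D = j. \<Prod>q\<in>insert q D. x q)"
    by (subst sum.reindex[OF inj]) simp
  also have "\<dots> = (\<Sum>D | D \<subseteq> P \<and> card D = j. x q * (\<Prod>q\<in>D. x q))"
    using assms by (intro sum.cong refl prod.insert) (auto intro: finite_subset)
  finally show ?thesis by (simp add: esym_def sum_distrib_left)
qed

text \<open>The left side is one degree of the expansion of the product on the right, all of whose
  terms are nonnegative. The free parameter c is tuned to the degree: large c to show that a high
  degree is negligible, small c when the x q are not small.\<close>

lemma esym_le:
  assumes "finite P" "\<And>q. q \<in> P \<Longrightarrow> 0 \<le> x q" "0 \<le> c"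
  shows "c ^ j * esym j x P \<le> (\<Prod>q\<in>P. 1 + c * x q)"
  using assms(1,2)
proof (induction P arbitrary: j rule: finite_induct)
  case empty
  then show ?case by (cases j) auto
next
  case (insert q P)
  have pos: "1 \<le> (\<Prod>q\<in>insert q P. 1 + c * x q)"
    using insert.prems assms(3) by (intro prod_ge_1) auto
  show ?case
  proof (cases j)
    case 0
    then show ?thesis using pos insert.hyps by simp
  next
    case (Suc i)
    have "c ^ j * esym j x (insert q P) = c ^ Suc i * esym (Suc i) x P + c * x q * (c ^ i * esym i x P)"
      unfolding Suc esym_insert[OF insert.hyps] by (simp add: algebra_simps)
    also have "\<dots> \<le> (\<Prod>q\<in>P. 1 + c * x q) + c * x q * (\<Prod>q\<in>P. 1 + c * x q)"
      using insert.IH[of "Suc i"] insert.IH[of i] insert.prems assms(3) by (intro add_mono mult_left_mono) simp_all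
    also have "\<dots> = (\<Prod>q\<in>insert q P. 1 + c * x q)" using insert.hyps by (simp add: algebra_simps)
    finally show ?thesis .
  qed
qed

text \<open>The sum runs over \<open>i < j\<close>, so that the truncation at level \<open>k\<close> is \<open>bonf (Suc k)\<close>;
  the empty truncation \<open>j = 0\<close> makes the induction in \<open>bonferroni\<close> uniform.\<close>

definition bonf :: "nat \<Rightarrow> ('a \<Rightarrow> real) \<Rightarrow> 'a set \<Rightarrow> real" where
  "bonf j x P = (\<Sum>i<j. (-1) ^ i * esym i x P)"

lemma bonf_insert:
  assumes "finite P" "q \<notin> P"
  shows "bonf (Suc j) x (insert q P) = bonf (Suc j) x P - x q * bonf j x P"
proof -
  have "bonf (Suc j) x (insert q P) = 1 + (\<Sum>i<j. (-1) ^ Suc i * (esym (Suc i) x P + x q * esym i x P))"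
    unfolding bonf_def sum.lessThan_Suc_shift using assms by (simp add: esym_insert)
  also have "\<dots> = (1 + (\<Sum>i<j. (-1) ^ Suc i * esym (Suc i) x P)) - x q * bonf j x P"
  proof -
    have "(-1) ^ Suc i * (esym (Suc i) x P + x q * esym i x P) = (-1) ^ Suc i * esym (Suc i) x P - x q * ((-1) ^ i * esym i x P)" for i
      by (simp add: algebra_simps)
    then show ?thesis by (simp only: bonf_def sum_distrib_left sum_subtractf add_diff_eq)
  qed
  also have "1 + (\<Sum>i<j. (-1) ^ Suc i * esym (Suc i) x P) = bonf (Suc j) x P"
    unfolding bonf_def sum.lessThan_Suc_shift[of _ j] using assms by simp
  finally show ?thesis .
qed

text \<open>Inclusion-exclusion truncated, with the sign and the size of the error. Adding q gives
  the error at level j as the old error at level j plus x q times the old error at level j - 1, with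
  matching signs. Real weights in [0, 1] are allowed so that one statement serves twice in
  \<open>brun_sieve\<close>: for indicators and for the densities 2 / q.\<close>

lemma bonferroni:
  assumes "finite P" "\<And>q. q \<in> P \<Longrightarrow> 0 \<le> x q \<and> x q \<le> 1"
  shows "0 \<le> (-1) ^ Suc j * (bonf j x P - (\<Prod>q\<in>P. 1 - x q)) \<and>
     (-1) ^ Suc j * (bonf j x P - (\<Prod>q\<in>P. 1 - x q)) \<le> esym j x P"
  using assms
proof (induction P arbitrary: j rule: finite_induct)
  case empty
  show ?case
  proof (cases j)
    case (Suc i)
    have "bonf (Suc i) x ({} :: 'a set) = 1"
      unfolding bonf_def sum.lessThan_Suc_shift by simp
    then show ?thesis using Suc by simp
  qed (simp add: bonf_def)
next
  case (insert q P)
  show ?case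
  proof (cases j)
    case 0
    have "0 \<le> (\<Prod>q\<in>insert q P. 1 - x q)" "(\<Prod>q\<in>insert q P. 1 - x q) \<le> 1"
      using insert.prems by (auto intro!: prod_nonneg prod_le_1 simp del: prod.insert)
    then show ?thesis using 0 insert.hyps by (simp add: bonf_def)
  next
    case (Suc i)
    let ?p = "\<Prod>q\<in>P. 1 - x q"
    have "(-1) ^ Suc j * (bonf j x (insert q P) - (\<Prod>q\<in>insert q P. 1 - x q)) =
      (-1) ^ Suc (Suc i) * (bonf (Suc i) x P - ?p) + x q * ((-1) ^ Suc i * (bonf i x P - ?p))"
      unfolding Suc bonf_insert[OF insert.hyps] using insert.hyps by (simp add: algebra_simps)
    moreover have "0 \<le> (-1) ^ Suc (Suc i) * (bonf (Suc i) x P - ?p)"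
      "(-1) ^ Suc (Suc i) * (bonf (Suc i) x P - ?p) \<le> esym (Suc i) x P"
      "0 \<le> (-1) ^ Suc i * (bonf i x P - ?p)" "(-1) ^ Suc i * (bonf i x P - ?p) \<le> esym i x P"
      using insert.IH[of "Suc i"] insert.IH[of i] insert.prems by auto
    moreover have "0 \<le> x q" using insert.prems by simp
    moreover have "0 \<le> a + y * b \<and> a + y * b \<le> e + y * f" if "0 \<le> a" "a \<le> e" "0 \<le> b" "b \<le> f" "0 \<le> y" for a b e f y :: real
      using that by (auto intro: add_mono mult_left_mono)
    ultimately show ?thesis unfolding Suc esym_insert[OF insert.hyps] by metis
  qed
qed

section \<open>Sieving an interval by two residue classes per prime\<close>

lemma card_residue_interval:
  fixes s r m :: int
  assumes m: "m > 0"
  shows "\<bar>real (card {b\<in>{s..<s + int N}. [b = r] (mod m)}) - real N / real_of_int m\<bar> \<le> 1"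
proof -
  define u v where "u = \<lceil>real_of_int (s - r) / real_of_int m\<rceil>" and "v = \<lceil>real_of_int (s + int N - r) / real_of_int m\<rceil>"
  have "bij_betw (\<lambda>t. r + m * t) {u..<v} {b\<in>{s..<s + int N}. [b = r] (mod m)}"
  proof (rule bij_betwI')
    fix x y assume "x \<in> {u..<v}" "y \<in> {u..<v}"
    show "(r + m * x = r + m * y) = (x = y)" using m by simp
  next
    fix t assume t: "t \<in> {u..<v}"
    have "real_of_int (s - r) / real_of_int m \<le> real_of_int t"
      using t by (simp add: u_def ceiling_le_iff)
    then have "real_of_int (s - r) \<le> real_of_int (m * t)" using m by (simp add: field_simps)
    then have 1: "s - r \<le> m * t" by linarith
    have "real_of_int t < real_of_int (s + int N - r) / real_of_int m"
      using t by (simp add: v_def less_ceiling_iff)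
    then have "real_of_int (m * t) < real_of_int (s + int N - r)" using m by (simp add: field_simps)
    then have 2: "m * t < s + int N - r" by linarith
    show "r + m * t \<in> {b\<in>{s..<s + int N}. [b = r] (mod m)}" using 1 2 by (auto simp: cong_iff_dvd_diff)
  next
    fix b assume b: "b \<in> {b\<in>{s..<s + int N}. [b = r] (mod m)}"
    then obtain t where t: "b = r + m * t" by (auto simp: cong_iff_dvd_diff elim!: dvdE) (metis add.commute diff_add_cancel)
    have "real_of_int (s - r) \<le> real_of_int (m * t)" unfolding of_int_le_iff using b t by simp
    then have "real_of_int (s - r) / real_of_int m \<le> real_of_int t" using m by (simp add: field_simps)
    then have 1: "u \<le> t" by (simp add: u_def ceiling_le_iff)
    have "real_of_int (m * t) < real_of_int (s + int N - r)" unfolding of_int_less_iff using b t by simp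
    then have "real_of_int t < real_of_int (s + int N - r) / real_of_int m" using m by (simp add: field_simps)
    then have 2: "t < v" by (simp add: v_def less_ceiling_iff)
    show "\<exists>x\<in>{u..<v}. b = r + m * x" using 1 2 t by auto
  qed
  then have "card {b\<in>{s..<s + int N}. [b = r] (mod m)} = nat (v - u)"
    using bij_betw_same_card by fastforce
  moreover have "real_of_int (s + int N - r) / real_of_int m = real_of_int (s - r) / real_of_int m + real N / real_of_int m"
    by (simp add: add_divide_distrib[symmetric])
  moreover have "real N / real_of_int m \<ge> 0" using m by simp
  ultimately show ?thesis unfolding u_def v_def by linarith
qed

text \<open>Models the condition that q divides a^2 + b^2, as a condition on b for fixed a. There
  are two classes per prime but only half of the primes are used, so the sieve has dimension one and
  saves one logarithm.\<close>

definition two_roots :: "int \<Rightarrow> (int \<Rightarrow> bool) \<Rightarrow> bool" where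
  "two_roots q H \<longleftrightarrow> (\<exists>r1 r2. \<not> [r1 = r2] (mod q) \<and> (\<forall>b. H b \<longleftrightarrow> [b = r1] (mod q) \<or> [b = r2] (mod q)))"

text \<open>By the Chinese remainder theorem each q in D splits one residue class into two, to a
  modulus larger by the factor q. Each of the final 2^(card D) classes is counted with error at most
  1. The class r modulo m accumulates the primes already treated in the induction.\<close>

lemma card_hits:
  fixes D :: "nat set" and H :: "nat \<Rightarrow> int \<Rightarrow> bool"
  assumes "finite D" "\<And>q. q \<in> D \<Longrightarrow> prime q" "\<And>q. q \<in> D \<Longrightarrow> two_roots (int q) (H q)"
    "m > 0" "\<And>q. q \<in> D \<Longrightarrow> coprime m (int q)"
  shows "\<bar>real (card {b\<in>{s..<s + int N}. [b = r] (mod m) \<and> (\<forall>q\<in>D. H q b)}) - real N / real_of_int m * (\<Prod>q\<in>D. 2 / real q)\<bar> \<le> 2 ^ card D"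
  using assms
proof (induction D arbitrary: m r rule: finite_induct)
  case empty
  then show ?case using card_residue_interval[of m s N r] by simp
next
  case (insert q D)
  have q: "prime q" using insert.prems by simp
  obtain r1 r2 where r12: "\<not> [r1 = r2] (mod int q)" "\<And>b. H q b \<longleftrightarrow> [b = r1] (mod int q) \<or> [b = r2] (mod int q)"
    using insert.prems(2)[of q] unfolding two_roots_def by auto
  have cop: "coprime m (int q)" using insert.prems by simp
  obtain x1 where x1: "[x1 = r] (mod m)" "[x1 = r1] (mod int q)" using binary_chinese_remainder_int[OF cop] by blast
  obtain x2 where x2: "[x2 = r] (mod m)" "[x2 = r2] (mod int q)" using binary_chinese_remainder_int[OF cop] by blast
  have eqv: "[b = r] (mod m) \<and> [b = ri] (mod int q) \<longleftrightarrow> [b = xi] (mod m * int q)"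
    if "[xi = r] (mod m)" "[xi = ri] (mod int q)" for b xi ri
  proof
    assume "[b = r] (mod m) \<and> [b = ri] (mod int q)"
    then have "[b = xi] (mod m)" "[b = xi] (mod int q)" using that by (meson cong_sym cong_trans)+
    then show "[b = xi] (mod m * int q)" using cop by (rule coprime_cong_mult)
  next
    assume b: "[b = xi] (mod m * int q)"
    then have "[b = xi] (mod m)" "[b = xi] (mod int q)"
      using cong_modulus_mult[of b xi m "int q"] cong_modulus_mult[of b xi "int q" m] by (auto simp: mult.commute)
    then show "[b = r] (mod m) \<and> [b = ri] (mod int q)" using that by (meson cong_trans)
  qed
  let ?S = "\<lambda>x. {b\<in>{s..<s + int N}. [b = x] (mod m * int q) \<and> (\<forall>q\<in>D. H q b)}"
  have un: "{b\<in>{s..<s + int N}. [b = r] (mod m) \<and> (\<forall>q\<in>insert q D. H q b)} = ?S x1 \<union> ?S x2"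
    unfolding eqv[OF x1, symmetric] eqv[OF x2, symmetric] using r12(2) by auto
  have dis: "?S x1 \<inter> ?S x2 = {}"
    unfolding eqv[OF x1, symmetric] eqv[OF x2, symmetric] using r12(1) by (auto dest: cong_sym intro: cong_trans)
  have fin: "finite (?S x)" for x by (rule finite_subset[of _ "{s..<s + int N}"]) auto
  have card: "card {b\<in>{s..<s + int N}. [b = r] (mod m) \<and> (\<forall>q\<in>insert q D. H q b)} = card (?S x1) + card (?S x2)"
    unfolding un using fin dis by (intro card_Un_disjoint) auto
  have "\<bar>real (card (?S x)) - real N / real_of_int (m * int q) * (\<Prod>q\<in>D. 2 / real q)\<bar> \<le> 2 ^ card D" for x
  proof (rule insert.IH)
    show "m * int q > 0" using insert.prems(3) prime_gt_0_nat[OF q] by simp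
    fix q' assume q': "q' \<in> D"
    have "coprime q q'" using q' insert.hyps(2) q insert.prems(1)[of q'] by (auto intro: primes_coprime)
    then show "coprime (m * int q) (int q')" using insert.prems(4)[of q'] q' by (simp add: coprime_mult_left_iff)
  qed (use insert.prems in auto)
  note IH = this
  have "\<bar>A + B - 2 * X\<bar> \<le> 2 * P" if "\<bar>A - X\<bar> \<le> P" "\<bar>B - X\<bar> \<le> P" for A B X P :: real
    using that by linarith
  from this[OF IH[of x1] IH[of x2]]
  have "\<bar>real (card (?S x1)) + real (card (?S x2)) - 2 * (real N / real_of_int (m * int q) * (\<Prod>q\<in>D. 2 / real q))\<bar> \<le> 2 * 2 ^ card D" .
  moreover have "2 * (real N / real_of_int (m * int q) * (\<Prod>q\<in>D. 2 / real q)) = real N / real_of_int m * (\<Prod>q\<in>insert q D. 2 / real q)"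
    using insert.hyps by simp
  ultimately show ?case
    by (simp only: card of_nat_add card_insert_disjoint[OF insert.hyps] power_Suc)
qed

text \<open>Brun's pure sieve: an even truncation level bounds the indicator of the unsieved b from
  above. The three terms are the main term, the cost of completing the truncated main term to the
  full product, and the rounding errors of all moduli with at most k prime factors.\<close>

lemma brun_sieve:
  fixes Q :: "nat set" and H :: "nat \<Rightarrow> int \<Rightarrow> bool"
  assumes Q: "finite Q" "\<And>q. q \<in> Q \<Longrightarrow> prime q" "\<And>q. q \<in> Q \<Longrightarrow> two_roots (int q) (H q)"
    and "even k"
  shows "real (card {b\<in>{s..<s + int N}. \<forall>q\<in>Q. \<not> H q b}) \<le>
     real N * (\<Prod>q\<in>Q. 1 - 2 / real q) + real N * esym (Suc k) (\<lambda>q. 2 / real q) Q + (\<Sum>j<Suc k. esym j (\<lambda>_. 2) Q)"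
proof -
  define I where "I = {s..<s + int N}"
  define h :: "int \<Rightarrow> nat \<Rightarrow> real" where "h b q = (if H q b then 1 else 0)" for b q
  have fI: "finite I" by (simp add: I_def)
  have fD: "finite {D. D \<subseteq> Q \<and> card D = j}" for j
    by (rule finite_subset[of _ "Pow Q"]) (use Q in auto)
  have "real (card {b\<in>I. \<forall>q\<in>Q. \<not> H q b}) = (\<Sum>b\<in>{b\<in>I. \<forall>q\<in>Q. \<not> H q b}. 1)" by simp
  also have "\<dots> = (\<Sum>b\<in>I. \<Prod>q\<in>Q. 1 - h b q)"
  proof (rule sum.mono_neutral_cong_left[OF fI], goal_cases)
    case 2
    show ?case
    proof
      fix b assume "b \<in> I - {b\<in>I. \<forall>q\<in>Q. \<not> H q b}"
      then obtain q where "q \<in> Q" "H q b" by auto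
      then show "(\<Prod>q\<in>Q. 1 - h b q) = 0" using Q(1) by (auto simp: h_def)
    qed
  qed (auto simp: h_def)
  also have "\<dots> \<le> (\<Sum>b\<in>I. bonf (Suc k) (h b) Q)"
  proof (rule sum_mono)
    fix b
    have "0 \<le> (-1) ^ Suc (Suc k) * (bonf (Suc k) (h b) Q - (\<Prod>q\<in>Q. 1 - h b q))"
      using bonferroni[OF Q(1), of "h b" "Suc k"] by (auto simp: h_def)
    then show "(\<Prod>q\<in>Q. 1 - h b q) \<le> bonf (Suc k) (h b) Q" using \<open>even k\<close> by simp
  qed
  also have "\<dots> = (\<Sum>j<Suc k. (-1) ^ j * (\<Sum>b\<in>I. esym j (h b) Q))"
    unfolding bonf_def by (subst sum.swap) (simp add: sum_distrib_left)
  \<comment> \<open>\<open>card_hits\<close> with modulus 1 replaces each count by its expected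
    value. The rounding error 2^j for each set of j primes is what \<open>esym j\<close> of the
    constant 2 collects; its sign is given away.\<close>
  also have "\<dots> \<le> (\<Sum>j<Suc k. (-1) ^ j * (real N * esym j (\<lambda>q. 2 / real q) Q) + esym j (\<lambda>_. 2) Q)"
  proof (rule sum_mono)
    fix j
    have "(\<Sum>b\<in>I. esym j (h b) Q) = (\<Sum>D | D \<subseteq> Q \<and> card D = j. \<Sum>b\<in>I. \<Prod>q\<in>D. h b q)"
      unfolding esym_def by (rule sum.swap)
    also have "\<dots> = (\<Sum>D | D \<subseteq> Q \<and> card D = j. real (card {b\<in>I. \<forall>q\<in>D. H q b}))"
    proof (rule sum.cong[OF refl])
      fix D assume D: "D \<in> {D. D \<subseteq> Q \<and> card D = j}"
      then have fin: "finite D" using Q(1) finite_subset by auto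
      have "(\<Sum>b\<in>I. \<Prod>q\<in>D. h b q) = (\<Sum>b\<in>I. if \<forall>q\<in>D. H q b then 1 else 0)"
        using fin by (intro sum.cong refl) (auto simp: h_def)
      also have "\<dots> = real (card {b\<in>I. \<forall>q\<in>D. H q b})"
        using fI by (simp add: sum.If_cases Int_def)
      finally show "(\<Sum>b\<in>I. \<Prod>q\<in>D. h b q) = real (card {b\<in>I. \<forall>q\<in>D. H q b})" .
    qed
    finally have 1: "(\<Sum>b\<in>I. esym j (h b) Q) = (\<Sum>D | D \<subseteq> Q \<and> card D = j. real (card {b\<in>I. \<forall>q\<in>D. H q b}))" .
    have "\<bar>(\<Sum>b\<in>I. esym j (h b) Q) - real N * esym j (\<lambda>q. 2 / real q) Q\<bar> =
       \<bar>\<Sum>D | D \<subseteq> Q \<and> card D = j. real (card {b\<in>I. \<forall>q\<in>D. H q b}) - real N * (\<Prod>q\<in>D. 2 / real q)\<bar>"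
      unfolding 1 unfolding esym_def by (simp add: sum_distrib_left sum_subtractf)
    also have "\<dots> \<le> (\<Sum>D | D \<subseteq> Q \<and> card D = j. \<bar>real (card {b\<in>I. \<forall>q\<in>D. H q b}) - real N * (\<Prod>q\<in>D. 2 / real q)\<bar>)"
      by (rule sum_abs)
    also have "\<dots> \<le> (\<Sum>D | D \<subseteq> Q \<and> card D = j. \<Prod>q\<in>D. 2)"
    proof (rule sum_mono)
      fix D assume D: "D \<in> {D. D \<subseteq> Q \<and> card D = j}"
      then have fin: "finite D" using Q(1) finite_subset by auto
      show "\<bar>real (card {b\<in>I. \<forall>q\<in>D. H q b}) - real N * (\<Prod>q\<in>D. 2 / real q)\<bar> \<le> (\<Prod>q\<in>D. 2)"
        using card_hits[OF fin, of H 1 s N 0] D Q unfolding I_def by (auto simp: subset_iff)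
    qed
    also have "\<dots> = esym j (\<lambda>_. 2) Q" by (simp add: esym_def)
    finally have "\<bar>(\<Sum>b\<in>I. esym j (h b) Q) - real N * esym j (\<lambda>q. 2 / real q) Q\<bar> \<le> esym j (\<lambda>_. 2) Q" .
    then show "(-1) ^ j * (\<Sum>b\<in>I. esym j (h b) Q) \<le> (-1) ^ j * (real N * esym j (\<lambda>q. 2 / real q) Q) + esym j (\<lambda>_. 2) Q"
      by (cases "even j") auto
  qed
  also have "\<dots> = real N * bonf (Suc k) (\<lambda>q. 2 / real q) Q + (\<Sum>j<Suc k. esym j (\<lambda>_. 2) Q)"
    by (simp only: sum.distrib bonf_def sum_distrib_left mult.left_commute)
  \<comment> \<open>Bonferroni a second time, now with the densities as weights and using the other
    inequality, to return from the truncated sum to the full product.\<close>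
  also have "\<dots> \<le> real N * ((\<Prod>q\<in>Q. 1 - 2 / real q) + esym (Suc k) (\<lambda>q. 2 / real q) Q) + (\<Sum>j<Suc k. esym j (\<lambda>_. 2) Q)"
  proof -
    have "0 \<le> 2 / real q \<and> 2 / real q \<le> 1" if "q \<in> Q" for q
      using prime_ge_2_nat[OF Q(2)[OF that]] by simp
    then have "0 \<le> (-1) ^ Suc (Suc k) * (bonf (Suc k) (\<lambda>q. 2 / real q) Q - (\<Prod>q\<in>Q. 1 - 2 / real q)) \<and>
      (-1) ^ Suc (Suc k) * (bonf (Suc k) (\<lambda>q. 2 / real q) Q - (\<Prod>q\<in>Q. 1 - 2 / real q)) \<le> esym (Suc k) (\<lambda>q. 2 / real q) Q"
      by (intro bonferroni Q(1))
    then     have "(-1) ^ Suc (Suc k) * (bonf (Suc k) (\<lambda>q. 2 / real q) Q - (\<Prod>q\<in>Q. 1 - 2 / real q)) \<le> esym (Suc k) (\<lambda>q. 2 / real q) Q"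
      by blast
    then show ?thesis using \<open>even k\<close> by (intro add_mono mult_left_mono) auto
  qed
  finally show ?thesis by (simp add: I_def distrib_left)
qed

lemma minus_one_quadratic_residue:
  assumes "prime (p::nat)" "p mod 4 = 1"
  shows "\<exists>i::int. int p dvd i\<^sup>2 + 1"
proof -
  have p: "2 < p" using prime_mod4_ge_5[OF assms] by simp
  have ev: "even ((p - 1) div 2)" using assms(2) by presburger
  have "[Legendre (-1) (int p) = (-1) ^ ((p - 1) div 2)] (mod int p)"
    using euler_criterion[of p "-1"] assms(1) p by simp
  then have "[Legendre (-1) (int p) = 1] (mod int p)" using ev by simp
  moreover have "\<not> int p dvd 2" "\<not> int p dvd 1"
    using p zdvd_imp_le[of "int p" 2] zdvd_imp_le[of "int p" 1] by auto
  ultimately have "Legendre (-1) (int p) \<noteq> -1" "Legendre (-1) (int p) \<noteq> 0"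
    by (auto simp: cong_iff_dvd_diff)
  then have "QuadRes (int p) (-1)" unfolding Legendre_def by (auto split: if_splits)
  then show ?thesis by (auto simp: QuadRes_def cong_iff_dvd_diff)
qed

text \<open>With i^2 = -1 modulo q the roots are plus and minus i a. They are distinct because q
  divides none of 2, i and a.\<close>

lemma two_roots_sum_squares:
  assumes q: "prime q" "q mod 4 = 1" and a: "\<not> int q dvd a"
  shows "two_roots (int q) (\<lambda>b. int q dvd a\<^sup>2 + b\<^sup>2)"
proof -
  obtain i where i: "int q dvd i\<^sup>2 + 1" using minus_one_quadratic_residue[OF q] by blast
  have pq: "prime (int q)" using q by simp
  have q5: "q \<ge> 5" using prime_mod4_ge_5[OF q] .
  show ?thesis unfolding two_roots_def
  proof (intro exI conjI allI)
    show "\<not> [i * a = - (i * a)] (mod int q)"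
    proof
      assume "[i * a = - (i * a)] (mod int q)"
      then have "int q dvd i * a - - (i * a)" unfolding cong_iff_dvd_diff .
      moreover have "i * a - - (i * a) = 2 * (i * a)" by simp
      ultimately have "int q dvd 2 * (i * a)" by (rule back_subst)
      then have "int q dvd 2 \<or> int q dvd i" using pq a by (auto simp: prime_dvd_mult_iff)
      moreover have "\<not> int q dvd 2" using q5 zdvd_imp_le[of "int q" 2] by auto
      moreover have "\<not> int q dvd i"
      proof
        assume "int q dvd i"
        then have "int q dvd i\<^sup>2" by (simp add: power2_eq_square)
        then have "int q dvd 1" using i dvd_add_right_iff by blast
        then show False using q5 zdvd_imp_le[of "int q" 1] by auto
      qed
      ultimately show False by blast
    qed
    fix b
    have "a\<^sup>2 + b\<^sup>2 = (b - i * a) * (b + i * a) + a\<^sup>2 * (i\<^sup>2 + 1)"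
      by (simp add: algebra_simps power2_eq_square)
    then have "int q dvd a\<^sup>2 + b\<^sup>2 \<longleftrightarrow> int q dvd (b - i * a) * (b + i * a)"
      using i by (metis dvd_add_left_iff dvd_mult)
    also have "\<dots> \<longleftrightarrow> int q dvd b - i * a \<or> int q dvd b + i * a"
      using pq by (rule prime_dvd_mult_iff)
    finally show "int q dvd a\<^sup>2 + b\<^sup>2 \<longleftrightarrow> [b = i * a] (mod int q) \<or> [b = - (i * a)] (mod int q)"
      by (simp add: cong_iff_dvd_diff)
  qed
qed

section \<open>Gaussian primes in narrow sectors\<close>

text \<open>Thue's pigeonhole argument: there are more than p pairs (u, v) with coordinates up to
  the integer part of sqrt p, so two of them agree in u - i v modulo p. The square sum of their
  differences is a positive multiple of p below 2 p, because p itself is not a square.\<close>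

lemma fermat_two_squares:
  assumes "prime (p::nat)" "p mod 4 = 1"
  shows "\<exists>a b::int. a\<^sup>2 + b\<^sup>2 = int p"
proof -
  obtain i where i: "int p dvd i\<^sup>2 + 1" using minus_one_quadratic_residue[OF assms] by blast
  define r where "r = \<lfloor>sqrt (real p)\<rfloor>"
  have p0: "p > 0" using assms(1) by (rule prime_gt_0_nat)
  have r0: "r \<ge> 0" by (simp add: r_def)
  have "(real_of_int r)\<^sup>2 \<le> (sqrt (real p))\<^sup>2" using r0 by (intro power_mono) (auto simp: r_def)
  then have "real_of_int (r\<^sup>2) \<le> real_of_int (int p)" by simp
  then have r1: "r\<^sup>2 \<le> int p" by linarith
  have "(sqrt (real p))\<^sup>2 < (real_of_int r + 1)\<^sup>2" unfolding r_def by (intro power_strict_mono) auto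
  then have "real_of_int (int p) < real_of_int ((r + 1)\<^sup>2)" by simp
  then have r2: "int p < (r + 1)\<^sup>2" by linarith
  let ?f = "\<lambda>(u,v). (u - i * v) mod int p"
  have "card ({0..r} \<times> {0..r}) > card {0..<int p}"
  proof -
    have "int (card ({0..r} \<times> {0..r})) = (r + 1)\<^sup>2"
      using r0 by (simp add: card_cartesian_product power2_eq_square)
    moreover have "card {0..<int p} = p" by simp
    ultimately show ?thesis using r2 by linarith
  qed
  moreover have "?f ` ({0..r} \<times> {0..r}) \<subseteq> {0..<int p}" using p0 by auto
  ultimately have "\<not> inj_on ?f ({0..r} \<times> {0..r})"
    by (metis card_inj_on_le finite_atLeastLessThan_int not_le)
  then obtain u v u' v' where uv: "u \<in> {0..r}" "v \<in> {0..r}" "u' \<in> {0..r}" "v' \<in> {0..r}"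
    "(u, v) \<noteq> (u', v')" "(u - i * v) mod int p = (u' - i * v') mod int p"
    unfolding inj_on_def by auto
  define a b where "a = u - u'" and "b = v - v'"
  have "int p dvd (u - i * v) - (u' - i * v')" using uv(6) by (simp add: mod_eq_dvd_iff)
  then have "int p dvd a - i * b" by (simp add: a_def b_def algebra_simps)
  then have "int p dvd (a - i * b) * (a + i * b) + b\<^sup>2 * (i\<^sup>2 + 1)" using i by simp
  moreover have "(a - i * b) * (a + i * b) + b\<^sup>2 * (i\<^sup>2 + 1) = a\<^sup>2 + b\<^sup>2"
    by (simp add: algebra_simps power2_eq_square)
  ultimately have dvd: "int p dvd a\<^sup>2 + b\<^sup>2" by simp
  then obtain k where k: "a\<^sup>2 + b\<^sup>2 = int p * k" by (auto elim: dvdE)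
  have pos: "a\<^sup>2 + b\<^sup>2 > 0" using uv(5) by (auto simp: a_def b_def sum_power2_gt_zero_iff)
  have "\<bar>a\<bar> \<le> r" "\<bar>b\<bar> \<le> r" using uv by (auto simp: a_def b_def)
  then have "a\<^sup>2 \<le> r\<^sup>2" "b\<^sup>2 \<le> r\<^sup>2" using r0 by (auto simp: abs_le_square_iff[symmetric])
  moreover have "r\<^sup>2 \<noteq> int p"
  proof
    assume "r\<^sup>2 = int p"
    then have "int p = int (nat r ^ 2)" using r0 by simp
    then have "p = nat r ^ 2" by (simp only: of_nat_eq_iff)
    then show False using assms(1) by (metis prime_power_iff numeral_eq_one_iff num.distinct(1))
  qed
  ultimately have "a\<^sup>2 + b\<^sup>2 < 2 * int p" using r1 by linarith
  then have 3: "int p * k < int p * 2" "int p * k > 0" using k pos by linarith+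
  have "k < 2" using 3(1) mult_less_cancel_left_pos[of "int p" k 2] p0 by linarith
  moreover have "k > 0" using 3(2) p0 by (simp add: zero_less_mult_iff)
  ultimately have "k < 2" "k > 0" by blast+
  then have "k = 1" by simp
  then show ?thesis using k by auto
qed

text \<open>An arbitrary choice among the representations of p. Later arguments treat
  \<open>gp p\<close> and its conjugate side by side, so nothing depends on it.\<close>

definition gauss_rep :: "nat \<Rightarrow> int \<times> int" where
  "gauss_rep p = (SOME (a, b). a\<^sup>2 + b\<^sup>2 = int p)"

definition gp :: "nat \<Rightarrow> complex" where
  "gp p = Complex (of_int (fst (gauss_rep p))) (of_int (snd (gauss_rep p)))"

lemma gauss_rep:
  assumes "prime p" "p mod 4 = 1"
  shows "(fst (gauss_rep p))\<^sup>2 + (snd (gauss_rep p))\<^sup>2 = int p"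
proof -
  have "\<exists>x. (\<lambda>(a, b). a\<^sup>2 + b\<^sup>2 = int p) x" using fermat_two_squares[OF assms] by auto
  from someI_ex[OF this] show ?thesis unfolding gauss_rep_def by (simp add: case_prod_unfold)
qed

lemma cmod_gp: "prime p \<Longrightarrow> p mod 4 = 1 \<Longrightarrow> cmod (gp p) = sqrt (real p)"
proof -
  assume p: "prime p" "p mod 4 = 1"
  have "real_of_int ((fst (gauss_rep p))\<^sup>2 + (snd (gauss_rep p))\<^sup>2) = real p"
    unfolding gauss_rep[OF p] by simp
  then show ?thesis by (simp add: gp_def cmod_def)
qed

text \<open>The condition says that \<open>gp p / cnj (gp p)\<close>, the unit number at twice the
  angle of \<open>gp p\<close>, lies within \<delta> of u. The centre u is any complex number, since
  it will arise as a quotient of two sums and not as a point of the unit circle.\<close>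

definition sector :: "complex \<Rightarrow> real \<Rightarrow> nat set" where
  "sector u \<delta> = {p. prime p \<and> p mod 4 = 1 \<and> cmod (gp p - u * cnj (gp p)) \<le> \<delta> * sqrt (real p)}"

abbreviation sector_upto :: "complex \<Rightarrow> real \<Rightarrow> real \<Rightarrow> nat set" where
  "sector_upto u \<delta> Y \<equiv> {p\<in>sector u \<delta>. real p \<le> Y}"

lemma sector_det:
  assumes "p \<in> sector u \<delta>" "p' \<in> sector u \<delta>"
  shows "\<bar>Im (gp p * cnj (gp p'))\<bar> \<le> \<delta> * sqrt (real p) * sqrt (real p')"
proof -
  define e e' where "e = gp p - u * cnj (gp p)" and "e' = gp p' - u * cnj (gp p')"
  have m: "cmod (gp p) = sqrt (real p)" "cmod (gp p') = sqrt (real p')"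
    using assms by (auto simp: sector_def cmod_gp)
  have ee: "cmod e \<le> \<delta> * sqrt (real p)" "cmod e' \<le> \<delta> * sqrt (real p')"
    using assms by (auto simp: sector_def e_def e'_def)
  have "gp p * cnj (gp p') - cnj (gp p * cnj (gp p')) = e * cnj (gp p') - e' * cnj (gp p)"
    by (simp add: e_def e'_def algebra_simps)
  moreover have "cmod (gp p * cnj (gp p') - cnj (gp p * cnj (gp p'))) = 2 * \<bar>Im (gp p * cnj (gp p'))\<bar>"
  proof -
    have "cmod (w - cnj w) = 2 * \<bar>Im w\<bar>" for w
    proof -
      have "w - cnj w = Complex 0 (2 * Im w)" by (simp add: complex_eq_iff)
      then show ?thesis by (simp add: cmod_def abs_mult real_sqrt_mult)
    qed
    then show ?thesis by blast
  qed
  moreover have "cmod (e * cnj (gp p') - e' * cnj (gp p)) \<le> cmod e * cmod (gp p') + cmod e' * cmod (gp p)"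
    by (metis complex_mod_cnj norm_mult norm_triangle_ineq4)
  moreover have "cmod e * cmod (gp p') \<le> (\<delta> * sqrt (real p)) * sqrt (real p')"
    unfolding m using ee by (intro mult_right_mono) auto
  moreover have "cmod e' * cmod (gp p) \<le> (\<delta> * sqrt (real p')) * sqrt (real p)"
    unfolding m using ee by (intro mult_right_mono) auto
  ultimately show ?thesis by (simp add: mult_ac)
qed

text \<open>A neighbourhood of a line through the origin instead of a sector. For each a the
  admissible b form an interval, on which a one-dimensional sieve can act.\<close>

definition strip :: "real \<Rightarrow> real \<Rightarrow> real \<Rightarrow> (int \<times> int) set" where
  "strip t h Y = {(a, b). prime (nat (a\<^sup>2 + b\<^sup>2)) \<and> real_of_int (a\<^sup>2 + b\<^sup>2) \<le> Y \<and> \<bar>real_of_int b - t * real_of_int a\<bar> \<le> h}"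

lemma in_stripI:
  assumes "a\<^sup>2 + b\<^sup>2 = int p" "prime p" "real p \<le> Y" "\<bar>real_of_int b - t * real_of_int a\<bar> \<le> h"
  shows "(a, b) \<in> strip t h Y"
  unfolding strip_def using assms(2-4) by (simp add: assms(1) del: of_int_add of_int_power)

lemma gauss_rep_inj:
  assumes "p \<in> sector u \<delta>" "p' \<in> sector u \<delta>" "gauss_rep p = gauss_rep p'"
  shows "p = p'"
proof -
  have "int p = (fst (gauss_rep p))\<^sup>2 + (snd (gauss_rep p))\<^sup>2"
    using gauss_rep[of p] assms(1) by (simp add: sector_def)
  also have "\<dots> = int p'"
    unfolding assms(3) using gauss_rep[of p'] assms(2) by (simp add: sector_def)
  finally have "int p = int p'" .
  then show ?thesis by simp
qed

lemma abs_le_sqrt_of_square_le: "real_of_int (a\<^sup>2 + b\<^sup>2) \<le> Y \<Longrightarrow> \<bar>real_of_int a\<bar> \<le> sqrt Y"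
proof -
  assume "real_of_int (a\<^sup>2 + b\<^sup>2) \<le> Y"
  moreover have "0 \<le> (real_of_int b)\<^sup>2" by simp
  ultimately have "(real_of_int a)\<^sup>2 \<le> Y" unfolding of_int_add of_int_power by linarith
  then show ?thesis using real_le_rsqrt by (metis power2_abs)
qed

lemma int_near_interval:
  assumes "h \<ge> 0"
  obtains s M where "{b::int. \<bar>real_of_int b - x\<bar> \<le> h} = {s..<s + int M}" "real M \<le> 2 * h + 1"
proof
  define s where "s = \<lceil>x - h\<rceil>"
  define M where "M = nat (\<lfloor>x + h\<rfloor> + 1 - s)"
  show "real M \<le> 2 * h + 1" using assms unfolding M_def s_def by linarith
  show "{b::int. \<bar>real_of_int b - x\<bar> \<le> h} = {s..<s + int M}"
  proof (cases "s \<le> \<lfloor>x + h\<rfloor> + 1")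
    case True
    then have "{s..<s + int M} = {s..\<lfloor>x + h\<rfloor>}" by (auto simp: M_def)
    moreover have "\<bar>real_of_int b - x\<bar> \<le> h \<longleftrightarrow> s \<le> b \<and> b \<le> \<lfloor>x + h\<rfloor>" for b
      unfolding s_def ceiling_le_iff le_floor_iff abs_le_iff by linarith
    ultimately show ?thesis by auto
  next
    case False
    then show ?thesis unfolding M_def s_def using assms by linarith
  qed
qed

lemma finite_strip: "finite (strip t h Y)"
proof (rule finite_subset)
  let ?R = "{-\<lfloor>sqrt Y\<rfloor>..\<lfloor>sqrt Y\<rfloor>}"
  show "strip t h Y \<subseteq> ?R \<times> ?R"
  proof (clarsimp simp: strip_def)
    fix a b :: int assume 1: "(real_of_int a)\<^sup>2 + (real_of_int b)\<^sup>2 \<le> Y"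
    have "\<bar>real_of_int a\<bar> \<le> sqrt Y" by (rule abs_le_sqrt_of_square_le[of a b]) (use 1 in simp)
    moreover have "\<bar>real_of_int b\<bar> \<le> sqrt Y" by (rule abs_le_sqrt_of_square_le[of b a]) (use 1 in simp)
    ultimately show "- \<lfloor>sqrt Y\<rfloor> \<le> a \<and> a \<le> \<lfloor>sqrt Y\<rfloor> \<and> - \<lfloor>sqrt Y\<rfloor> \<le> b \<and> b \<le> \<lfloor>sqrt Y\<rfloor>"
      by linarith
  qed
qed simp

text \<open>Any one member p0 of the sector spans the line, and by \<open>sector_det\<close> all
  others lie near it. The distance is measured along the axis belonging to the smaller coordinate of
  \<open>gp p0\<close>, after exchanging coordinates if necessary: the larger coordinate is at least
  sqrt(p0) / 2, and dividing the determinant by it gives the factor 2.\<close>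

lemma card_sector_le_strip:
  assumes "\<delta> \<ge> 0" "Y \<ge> 0"
  shows "\<exists>t. card (sector_upto u \<delta> Y) \<le> card (strip t (2 * \<delta> * sqrt Y) Y)"
proof (cases "(sector_upto u \<delta> Y) = {}")
  case False
  then obtain p0 where p0: "p0 \<in> sector u \<delta>" "real p0 \<le> Y" by auto
  define S where "S = (sector_upto u \<delta> Y)"
  define a0 b0 where "a0 = real_of_int (fst (gauss_rep p0))" and "b0 = real_of_int (snd (gauss_rep p0))"
  have pr0: "prime p0" "p0 mod 4 = 1" using p0 by (auto simp: sector_def)
  have n0: "a0\<^sup>2 + b0\<^sup>2 = real p0"
    using gauss_rep[OF pr0] unfolding a0_def b0_def by (metis of_int_add of_int_of_nat_eq of_int_power)
  have p0pos: "real p0 > 0" using prime_gt_0_nat[OF pr0(1)] by simp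
  have key: "\<bar>y - (c / d) * x\<bar> \<le> 2 * \<delta> * sqrt Y"
    if "\<bar>d * y - c * x\<bar> \<le> \<delta> * sqrt (real p0) * sqrt (real p)" "c\<^sup>2 + d\<^sup>2 = real p0" "\<bar>c\<bar> \<le> \<bar>d\<bar>" "real p \<le> Y" for x y c d p
  proof -
    have "c\<^sup>2 \<le> d\<^sup>2" using that(3) by (simp add: abs_le_square_iff)
    then have "real p0 \<le> 4 * d\<^sup>2" using that(2) zero_le_power2[of d] by linarith
    also have "\<dots> = (2 * \<bar>d\<bar>)\<^sup>2" by (simp add: power_mult_distrib)
    finally have s: "sqrt (real p0) \<le> 2 * \<bar>d\<bar>" by (rule real_le_lsqrt[rotated]) auto
    then have d: "\<bar>d\<bar> > 0" using p0pos real_sqrt_gt_0_iff[of "real p0"] by linarith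
    have "\<bar>d\<bar> * \<bar>y - (c / d) * x\<bar> = \<bar>d * y - c * x\<bar>"
      using d by (simp add: abs_mult[symmetric] right_diff_distrib)
    also have "\<dots> \<le> \<delta> * sqrt (real p0) * sqrt (real p)" by fact
    also have "\<dots> \<le> \<delta> * (2 * \<bar>d\<bar>) * sqrt Y"
      using assms s that(4) by (intro mult_mono mult_left_mono) auto
    also have "\<dots> = \<bar>d\<bar> * (2 * \<delta> * sqrt Y)" by simp
    finally show ?thesis using d by (simp only: mult_le_cancel_left_pos)
  qed
  have det: "\<bar>a0 * real_of_int (snd (gauss_rep p)) - b0 * real_of_int (fst (gauss_rep p))\<bar> \<le> \<delta> * sqrt (real p0) * sqrt (real p)"
    if "p \<in> S" for p
    using sector_det[of p0 u \<delta> p] p0 that unfolding S_def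
    by (simp add: gp_def a0_def b0_def abs_minus_commute mult.commute)
  have norm: "(fst (gauss_rep p))\<^sup>2 + (snd (gauss_rep p))\<^sup>2 = int p" "prime p" "real p \<le> Y" if "p \<in> S" for p
    using that gauss_rep[of p] by (auto simp: S_def sector_def)
  have inj: "inj_on gauss_rep S" using gauss_rep_inj[of _ u \<delta>] by (auto simp: inj_on_def S_def)
  show ?thesis
  proof (cases "\<bar>b0\<bar> \<le> \<bar>a0\<bar>")
    case True
    have "gauss_rep ` S \<subseteq> strip (b0 / a0) (2 * \<delta> * sqrt Y) Y"
    proof (rule image_subsetI)
      fix p assume p: "p \<in> S"
      have "\<bar>real_of_int (snd (gauss_rep p)) - b0 / a0 * real_of_int (fst (gauss_rep p))\<bar> \<le> 2 * \<delta> * sqrt Y"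
        using det[OF p] n0 True norm(3)[OF p] by (intro key[of a0 _ b0 _ p]) (auto simp: add.commute)
      then show "gauss_rep p \<in> strip (b0 / a0) (2 * \<delta> * sqrt Y) Y"
        using norm[OF p] in_stripI[of "fst (gauss_rep p)" "snd (gauss_rep p)" p] by simp
    qed
    then have "card S \<le> card (strip (b0 / a0) (2 * \<delta> * sqrt Y) Y)"
      by (intro card_inj_on_le[OF inj _ finite_strip])
    then show ?thesis unfolding S_def by blast
  next
    case False
    have inj2: "inj_on (prod.swap \<circ> gauss_rep) S" using inj by (intro comp_inj_on) auto
    have "(prod.swap \<circ> gauss_rep) ` S \<subseteq> strip (a0 / b0) (2 * \<delta> * sqrt Y) Y"
    proof (rule image_subsetI)
      fix p assume p: "p \<in> S"
      have "\<bar>real_of_int (fst (gauss_rep p)) - a0 / b0 * real_of_int (snd (gauss_rep p))\<bar> \<le> 2 * \<delta> * sqrt Y"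
        using det[OF p] n0 False norm(3)[OF p] by (intro key[of b0 _ a0 _ p]) (auto simp: abs_minus_commute)
      moreover have "(snd (gauss_rep p))\<^sup>2 + (fst (gauss_rep p))\<^sup>2 = int p" using norm(1)[OF p] by simp
      ultimately show "(prod.swap \<circ> gauss_rep) p \<in> strip (a0 / b0) (2 * \<delta> * sqrt Y) Y"
        using norm[OF p] in_stripI[of "snd (gauss_rep p)" "fst (gauss_rep p)" p] by (simp add: prod.swap_def)
    qed
    then have "card S \<le> card (strip (a0 / b0) (2 * \<delta> * sqrt Y) Y)"
      by (intro card_inj_on_le[OF inj2 _ finite_strip])
    then show ?thesis unfolding S_def by blast
  qed
next
  case True
  then have "card (sector_upto u \<delta> Y) = 0" by (simp only: card.empty)
  then show ?thesis by simp
qed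

lemma card_int_abs_le: "real (card {a::int. \<bar>real_of_int a\<bar> \<le> x}) \<le> 2 * \<bar>x\<bar> + 1"
proof -
  obtain s M where sM: "{b::int. \<bar>real_of_int b - 0\<bar> \<le> \<bar>x\<bar>} = {s..<s + int M}" "real M \<le> 2 * \<bar>x\<bar> + 1"
    by (rule int_near_interval[of "\<bar>x\<bar>" 0]) auto
  have "{a::int. \<bar>real_of_int a\<bar> \<le> x} \<subseteq> {b::int. \<bar>real_of_int b - 0\<bar> \<le> \<bar>x\<bar>}" by auto
  then have "card {a::int. \<bar>real_of_int a\<bar> \<le> x} \<le> card {s..<s + int M}"
    unfolding sM(1) by (rule card_mono[rotated]) simp
  then show ?thesis using sM(2) by simp
qed

text \<open>Counts all lattice points of the strip, row by row. The term with sqrt Y is one point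
  per row and remains however small \<delta> is. For the medium primes even this is enough, because
  few arcs occur there.\<close>

lemma sector_trivial:
  assumes "\<delta> \<ge> 0" "Y \<ge> 1"
  shows "real (card (sector_upto u \<delta> Y)) \<le> 12 * \<delta> * Y + 3 * sqrt Y"
proof -
  define h where "h = 2 * \<delta> * sqrt Y"
  obtain t where t: "card (sector_upto u \<delta> Y) \<le> card (strip t h Y)"
    using card_sector_le_strip[of \<delta> Y u] assms unfolding h_def by auto
  have h0: "h \<ge> 0" using assms by (simp add: h_def)
  let ?A = "{a::int. \<bar>real_of_int a\<bar> \<le> sqrt Y}"
  have row: "finite {b::int. \<bar>real_of_int b - x\<bar> \<le> h} \<and> real (card {b::int. \<bar>real_of_int b - x\<bar> \<le> h}) \<le> 2 * h + 1" for x
    by (rule int_near_interval[OF h0, of x]) simp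
  have fA: "finite ?A"
    by (rule int_near_interval[of "sqrt Y" 0]) (use assms in auto)
  have "card (strip t h Y) \<le> card (SIGMA a:?A. {b::int. \<bar>real_of_int b - t * real_of_int a\<bar> \<le> h})"
    using fA row abs_le_sqrt_of_square_le by (intro card_mono finite_SigmaI) (auto simp: strip_def simp del: of_int_add of_int_power)
  also have "\<dots> = (\<Sum>a\<in>?A. card {b::int. \<bar>real_of_int b - t * real_of_int a\<bar> \<le> h})"
    using fA row by (intro card_SigmaI) auto
  finally have "real (card (strip t h Y)) \<le> (\<Sum>a\<in>?A. real (card {b::int. \<bar>real_of_int b - t * real_of_int a\<bar> \<le> h}))"
    unfolding of_nat_sum[symmetric] of_nat_le_iff .
  also have "\<dots> \<le> (\<Sum>a\<in>?A. 2 * h + 1)" by (intro sum_mono) (use row in auto)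
  also have "\<dots> = real (card ?A) * (2 * h + 1)" by simp
  also have "\<dots> \<le> (2 * sqrt Y + 1) * (2 * h + 1)"
    using card_int_abs_le[of "sqrt Y"] h0 assms by (intro mult_right_mono) auto
  also have "\<dots> \<le> (3 * sqrt Y) * (2 * h + 1)"
    using h0 assms by (intro mult_right_mono) auto
  also have "\<dots> = 12 * \<delta> * Y + 3 * sqrt Y"
    using assms by (simp add: h_def algebra_simps)
  finally show ?thesis using t by linarith
qed

section \<open>The sieve in one row of a strip, and the bound for a sector\<close>

lemma two_power_Om_le: "n > 0 \<Longrightarrow> 2 ^ Om n \<le> n"
proof -
  assume n: "n > 0"
  have "2 ^ size M \<le> prod_mset M" if "\<forall>q\<in>#M. prime q" for M :: "nat multiset"
    using that
  proof (induction M)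
    case (add q M)
    then have "2 * 2 ^ size M \<le> q * prod_mset M" by (intro mult_le_mono) (auto simp: prime_ge_2_nat)
    then show ?case by simp
  qed simp
  from this[of "prime_factorization n"] show ?thesis
    using n by (auto simp: prod_mset_prime_factorization_nat)
qed

lemma card_prime_divisors_le:
  assumes "a \<noteq> (0::int)"
  shows "finite {q. prime q \<and> int q dvd a}" "2 ^ card {q. prime q \<and> int q dvd a} \<le> nat \<bar>a\<bar>"
proof -
  define n where "n = nat \<bar>a\<bar>"
  have n: "n > 0" using assms by (simp add: n_def)
  have "int q dvd a \<longleftrightarrow> q dvd n" for q
    unfolding n_def by (metis abs_ge_zero dvd_abs_iff int_dvd_int_iff nat_0_le)
  then have eq: "{q. prime q \<and> int q dvd a} = prime_factors n"
    using n by (auto simp: in_prime_factors_iff)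
  then show "finite {q. prime q \<and> int q dvd a}" by simp
  have "card (prime_factors n) \<le> Om n"
    by (metis mset_set_set_mset_msubset size_mset_mono size_mset_set)
  then have "(2::nat) ^ card (prime_factors n) \<le> 2 ^ Om n" by (intro power_increasing) auto
  then show "2 ^ card {q. prime q \<and> int q dvd a} \<le> nat \<bar>a\<bar>"
    unfolding eq n_def[symmetric] using two_power_Om_le[OF n] by (rule le_trans)
qed

abbreviation sifted :: "nat \<Rightarrow> nat \<Rightarrow> int \<Rightarrow> int \<Rightarrow> bool" where
  "sifted w z a b \<equiv> \<forall>q. prime q \<longrightarrow> q mod 4 = 1 \<longrightarrow> w < q \<longrightarrow> q \<le> z \<longrightarrow> \<not> int q dvd a \<longrightarrow> \<not> int q dvd a\<^sup>2 + b\<^sup>2"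

text \<open>Primes dividing \<open>a\<close> have one root instead of two and are left out. Sieving only by primes above
  \<open>w\<close>, which is about the logarithm of the range, makes this cost a bounded factor.\<close>

lemma sieve_row:
  "\<exists>C\<ge>1. \<forall>w z (a::int) s N k. 2 \<le> w \<longrightarrow> 3 \<le> z \<longrightarrow> w \<le> z \<longrightarrow> a \<noteq> 0 \<longrightarrow> even k \<longrightarrow> 4 * ln (ln (real z)) \<le> real k + 1 \<longrightarrow>
     card {q. prime q \<and> int q dvd a} \<le> 2 * w \<longrightarrow>
     real (card {b\<in>{s..<s + int N}. sifted w z a b})
       \<le> real N * C * ((ln (real w) + 1) / ln (real z)) + C * (real k + 1) * real z ^ k"
proof -
  obtain D where D: "D \<ge> 0" "\<And>N a. N \<ge> 2 \<Longrightarrow> a \<in> {1,3} \<Longrightarrow>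
     \<bar>(inv_primes a N) - ln (ln (real N)) / 2\<bar> \<le> D"
    using sum_inverse_primes_mod4 by blast
  have "real (card {b\<in>{s..<s + int N}. sifted w z a b})
       \<le> real N * exp (6 * D + 4) * ((ln (real w) + 1) / ln (real z)) + exp (6 * D + 4) * (real k + 1) * real z ^ k"
    if A: "2 \<le> w" "3 \<le> z" "w \<le> z" "a \<noteq> 0" "even k" "4 * ln (ln (real z)) \<le> real k + 1"
     "card {q. prime q \<and> int q dvd a} \<le> 2 * w" for w z s N k and a :: int
  proof -
    define Q where "Q = {q. prime q \<and> q mod 4 = 1 \<and> w < q \<and> q \<le> z \<and> \<not> int q dvd a}"
    define P where "P z = {q \<in> primes_upto z. q mod 4 = 1}" for z
    define B where "B = {q. prime q \<and> int q dvd a \<and> w < q}"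
    have finQ: "finite Q" unfolding Q_def by simp
    have finP: "finite (P z)" for z by (simp add: P_def)
    have "B \<subseteq> {q. prime q \<and> int q dvd a}" by (auto simp: B_def)
    then have finB: "finite B" using card_prime_divisors_le(1)[OF A(4)] by (rule finite_subset)
    have sumP: "(\<Sum>q\<in>P n. 1 / real q) = (inv_primes 1 n)" for n
      unfolding P_def by (rule sum.mono_neutral_cong_left) auto
    have lz1: "ln (real z) \<ge> 1" using A(2) by (rule ln_nat_ge_1)
    have lw: "ln (real w) > 0" using A(1) by simp
    have SP: "\<bar>(\<Sum>q\<in>P z. 1 / real q) - ln (ln (real z)) / 2\<bar> \<le> D" "\<bar>(\<Sum>q\<in>P w. 1 / real q) - ln (ln (real w)) / 2\<bar> \<le> D"
      using D(2)[of z 1] D(2)[of w 1] A unfolding sumP by auto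
    have up: "(\<Sum>q\<in>Q. 2 / real q) \<le> ln (ln (real z)) + 2 * D"
    proof -
      have "(\<Sum>q\<in>Q. 2 / real q) \<le> (\<Sum>q\<in>P z. 2 / real q)"
        by (rule sum_mono2[OF finP]) (auto simp: Q_def P_def primes_upto_def)
      also have "\<dots> = 2 * (\<Sum>q\<in>P z. 1 / real q)" by (simp add: sum_distrib_left)
      finally show ?thesis using SP(1) by linarith
    qed
    \<comment> \<open>A prime of the class up to z that is missing from Q is at most w or divides a.
      Those above w that divide a number at most 2 w and contribute at most 4.\<close>
    have lo: "ln (ln (real z)) - ln (ln (real w)) - (4 * D + 4) \<le> (\<Sum>q\<in>Q. 2 / real q)"
    proof -
      have "(\<Sum>q\<in>P z. 2 / real q) \<le> (\<Sum>q\<in>P w \<union> (Q \<union> B). 2 / real q)"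
      proof (rule sum_mono2)
        show "finite (P w \<union> (Q \<union> B))" using finP finQ finB by simp
        show "P z \<subseteq> P w \<union> (Q \<union> B)" by (auto simp: P_def Q_def B_def primes_upto_def)
      qed simp
      also have "\<dots> \<le> (\<Sum>q\<in>P w. 2 / real q) + ((\<Sum>q\<in>Q. 2 / real q) + (\<Sum>q\<in>B. 2 / real q))"
      proof -
        have U: "(\<Sum>q\<in>X \<union> Y. 2 / real q) \<le> (\<Sum>q\<in>X. 2 / real q) + (\<Sum>q\<in>Y. 2 / real q)" if "finite X" "finite Y" for X Y :: "nat set"
          using sum.union_inter[OF that, of "\<lambda>q. 2 / real q"] sum_nonneg[of "X \<inter> Y" "\<lambda>q. 2 / real q"] by simp
        show ?thesis using U[of "P w" "Q \<union> B"] U[of Q B] finP finQ finB by fastforce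
      qed
      also have "(\<Sum>q\<in>B. 2 / real q) \<le> (\<Sum>q\<in>B. 2 / real w)"
        using A(1) by (intro sum_mono divide_left_mono) (auto simp: B_def)
      also have "\<dots> = real (card B) * (2 / real w)" by simp
      also have "\<dots> \<le> (2 * real w) * (2 / real w)"
      proof (rule mult_right_mono)
        have "card B \<le> card {q. prime q \<and> int q dvd a}"
          unfolding B_def by (rule card_mono[OF card_prime_divisors_le(1)[OF A(4)]]) auto
        then have "card B \<le> 2 * w" using A(7) by linarith
        then show "real (card B) \<le> 2 * real w" by linarith
      qed simp
      also have "\<dots> = 4" using A(1) by simp
      finally have "(\<Sum>q\<in>P z. 2 / real q) \<le> (\<Sum>q\<in>P w. 2 / real q) + ((\<Sum>q\<in>Q. 2 / real q) + 4)" by simp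
      moreover have S2: "(\<Sum>q\<in>P n. 2 / real q) = 2 * (\<Sum>q\<in>P n. 1 / real q)" for n by (simp add: sum_distrib_left)
      ultimately show ?thesis using SP S2[of z] S2[of w] unfolding abs_le_iff by linarith
    qed
    have T1: "(\<Prod>q\<in>Q. 1 - 2 / real q) \<le> exp (4 * D + 4) * (ln (real w) / ln (real z))"
    proof -
      have "(\<Prod>q\<in>Q. 1 - 2 / real q) \<le> (\<Prod>q\<in>Q. exp (- (2 / real q)))"
      proof (rule prod_mono, safe)
        fix q assume "q \<in> Q"
        then have "real q \<ge> 2" using prime_ge_2_nat[of q] by (simp add: Q_def)
        then show "0 \<le> 1 - 2 / real q" by simp
        show "1 - 2 / real q \<le> exp (- (2 / real q))" using exp_ge_add_one_self[of "- (2 / real q)"] by simp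
      qed
      also have "\<dots> = exp (- (\<Sum>q\<in>Q. 2 / real q))" using finQ by (simp add: exp_sum[symmetric] sum_negf)
      also have "\<dots> \<le> exp ((4 * D + 4) + (ln (ln (real w)) - ln (ln (real z))))" using lo by simp
      also have "\<dots> = exp (4 * D + 4) * (ln (real w) / ln (real z))"
        unfolding exp_add[of "4 * D + 4"] exp_diff using lw lz1 by simp
      finally show ?thesis .
    qed
    \<comment> \<open>\<open>esym_le\<close> with c = e: the product is at most a constant times
      exp(3 ln ln z), and e^(k + 1) >= exp(4 ln ln z) leaves a factor 1 / ln z, as good as the main
      term.\<close>
    have T2: "esym (Suc k) (\<lambda>q. 2 / real q) Q \<le> exp (6 * D) / ln (real z)"
    proof -
      have "exp 1 ^ Suc k * esym (Suc k) (\<lambda>q. 2 / real q) Q \<le> (\<Prod>q\<in>Q. 1 + exp 1 * (2 / real q))"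
        by (rule esym_le[OF finQ]) auto
      also have "\<dots> \<le> (\<Prod>q\<in>Q. exp (exp 1 * (2 / real q)))"
        by (rule prod_mono) (auto simp: exp_ge_add_one_self intro!: add_nonneg_nonneg)
      also have "\<dots> = exp (exp 1 * (\<Sum>q\<in>Q. 2 / real q))" using finQ by (simp add: exp_sum[symmetric] sum_distrib_left)
      also have "\<dots> \<le> exp (3 * (ln (ln (real z)) + 2 * D))"
        using up exp_le by (subst exp_le_cancel_iff, intro mult_mono) (auto intro: sum_nonneg)
      finally have "esym (Suc k) (\<lambda>q. 2 / real q) Q \<le> exp (3 * (ln (ln (real z)) + 2 * D)) / exp 1 ^ Suc k"
        by (subst pos_le_divide_eq) (auto simp: mult.commute)
      also have "exp (1::real) ^ Suc k = exp (real k + 1)"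
        using exp_of_nat_mult[of "Suc k" "1::real"] by (simp add: add.commute)
      also have "exp (3 * (ln (ln (real z)) + 2 * D)) / exp (real k + 1) \<le> exp (6 * D - ln (ln (real z)))"
        unfolding exp_diff[symmetric] using A(6) by simp
      also have "\<dots> = exp (6 * D) / ln (real z)" using lz1 by (simp add: exp_diff)
      finally show ?thesis .
    qed
    \<comment> \<open>\<open>esym_le\<close> with c = 1 / z: as Q has at most z elements, the
      product is at most e^2, so degree j contributes at most e^2 z^j.\<close>
    have T3: "(\<Sum>j<Suc k. esym j (\<lambda>_. 2) Q) \<le> (real k + 1) * (exp 2 * real z ^ k)"
    proof -
      have "esym j (\<lambda>_. 2) Q \<le> exp 2 * real z ^ k" if "j < Suc k" for j
      proof -
        have "card Q \<le> card {1..z}" using prime_ge_1_nat by (intro card_mono) (auto simp: Q_def)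
        then have cQ: "real (card Q) \<le> real z" by simp
        have "(1 / real z) ^ j * esym j (\<lambda>_. 2) Q \<le> (\<Prod>q\<in>Q. 1 + 1 / real z * 2)"
          by (rule esym_le[OF finQ]) auto
        also have "\<dots> \<le> (\<Prod>q\<in>Q. exp (2 / real z))"
          by (rule prod_mono) (auto simp: exp_ge_add_one_self)
        also have "\<dots> = exp (real (card Q) * (2 / real z))" by (simp only: prod_constant exp_of_nat_mult)
        also have "\<dots> \<le> exp (real z * (2 / real z))" using cQ by (subst exp_le_cancel_iff, intro mult_right_mono) auto
        also have "\<dots> = exp 2" using A(2) by simp
        finally have "esym j (\<lambda>_. 2) Q \<le> exp 2 * real z ^ j" using A(2) by (simp add: power_divide field_simps)
        also have "\<dots> \<le> exp 2 * real z ^ k" using A(2) that by (intro mult_left_mono power_increasing) auto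
        finally show ?thesis .
      qed
      then have "(\<Sum>j<Suc k. esym j (\<lambda>_. 2) Q) \<le> (\<Sum>j<Suc k. exp 2 * real z ^ k)" by (intro sum_mono) auto
      then show ?thesis by (simp add: algebra_simps)
    qed
    have "{b\<in>{s..<s + int N}. sifted w z a b}
      = {b\<in>{s..<s + int N}. \<forall>q\<in>Q. \<not> int q dvd a\<^sup>2 + b\<^sup>2}" by (auto simp: Q_def)
    then have "real (card {b\<in>{s..<s + int N}. sifted w z a b})
      = real (card {b\<in>{s..<s + int N}. \<forall>q\<in>Q. \<not> int q dvd a\<^sup>2 + b\<^sup>2})" by simp
    also have "\<dots> \<le> real N * (\<Prod>q\<in>Q. 1 - 2 / real q) + real N * esym (Suc k) (\<lambda>q. 2 / real q) Q + (\<Sum>j<Suc k. esym j (\<lambda>_. 2) Q)"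
      by (rule brun_sieve[OF finQ _ _ A(5)]) (auto simp: Q_def two_roots_sum_squares)
    also have "\<dots> \<le> real N * (exp (4 * D + 4) * (ln (real w) / ln (real z))) + real N * (exp (6 * D) / ln (real z)) + (real k + 1) * (exp 2 * real z ^ k)"
      by (intro add_mono mult_left_mono T1 T2 T3) auto
    also have "\<dots> \<le> real N * (exp (6 * D + 4) * (ln (real w) / ln (real z))) + real N * (exp (6 * D + 4) / ln (real z)) + (real k + 1) * (exp (6 * D + 4) * real z ^ k)"
      using D(1) lw lz1 by (intro add_mono mult_left_mono mult_right_mono divide_right_mono) auto
    also have "\<dots> = real N * exp (6 * D + 4) * ((ln (real w) + 1) / ln (real z)) + exp (6 * D + 4) * (real k + 1) * real z ^ k"
      by (simp add: add_divide_distrib distrib_left mult_ac)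
    finally show ?thesis .
  qed
  then show ?thesis using D(1) by (intro exI[of _ "exp (6 * D + 4)"]) auto
qed

text \<open>The sieving limit z is about exp((ln Y)^(1 - eta/2)) and the level k about 4 ln ln Y, so
  that z^k remains below Y^(1/4); ln z falls short of ln Y by a factor (ln Y)^(eta/2) only, and the
  other half of eta absorbs ln w. The hypothesis on \<delta> makes the strip at least Y^(1/4) wide,
  so it dominates the sieve's rounding errors in every row.\<close>

lemma sector_sieve:
  assumes \<eta>: "0 < \<eta>" "\<eta> < 1"
  shows "\<exists>C>0. \<exists>Y0\<ge>2. \<forall>Y\<ge>Y0. \<forall>\<delta>\<ge>Y powr (-(1/4)). \<forall>u.
     real (card (sector_upto u \<delta> Y)) \<le> C * \<delta> * Y * ln Y powr (\<eta> - 1)"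
proof -
  obtain C where C: "C \<ge> 1" "\<And>w z (a::int) s N k. 2 \<le> w \<Longrightarrow> 3 \<le> z \<Longrightarrow> w \<le> z \<Longrightarrow> a \<noteq> 0 \<Longrightarrow> even k \<Longrightarrow> 4 * ln (ln (real z)) \<le> real k + 1 \<Longrightarrow>
     card {q. prime q \<and> int q dvd a} \<le> 2 * w \<Longrightarrow>
     real (card {b\<in>{s..<s + int N}. sifted w z a b})
       \<le> real N * C * ((ln (real w) + 1) / ln (real z)) + C * (real k + 1) * real z ^ k"
    using sieve_row by blast
  define X where "X Y = ln Y powr (1 - \<eta>/2)" for Y :: real
  have "eventually (\<lambda>Y::real. Y \<ge> 16 \<and> ln Y \<ge> 2 \<and> exp (X Y) - 1 \<ge> ln Y + 4 \<and> exp (X Y) - 1 \<ge> exp (X Y / 2) \<and> X Y > 0 \<and> exp (X Y) \<le> Y \<and>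
     9 * exp (X Y) \<le> Y powr (3/4) * ln Y powr (\<eta> - 1) \<and>
     (4 * ln (ln Y) + 3) * exp ((4 * ln (ln Y) + 2) * X Y) \<le> Y powr (1/4) * ln Y powr (\<eta> - 1) \<and>
     (ln (ln Y + 1) + 1) / (X Y / 2) \<le> ln Y powr (\<eta> - 1)) at_top"
    unfolding X_def using \<eta> by (intro eventually_conj; real_asymp)
  then obtain Y0 where Y0: "\<And>Y. Y \<ge> Y0 \<Longrightarrow> Y \<ge> 16 \<and> ln Y \<ge> 2 \<and> exp (X Y) - 1 \<ge> ln Y + 4 \<and> exp (X Y) - 1 \<ge> exp (X Y / 2) \<and> X Y > 0 \<and> exp (X Y) \<le> Y \<and>
     9 * exp (X Y) \<le> Y powr (3/4) * ln Y powr (\<eta> - 1) \<and>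
     (4 * ln (ln Y) + 3) * exp ((4 * ln (ln Y) + 2) * X Y) \<le> Y powr (1/4) * ln Y powr (\<eta> - 1) \<and>
     (ln (ln Y + 1) + 1) / (X Y / 2) \<le> ln Y powr (\<eta> - 1)"
    by (auto simp: eventually_at_top_linorder)
  show ?thesis
  proof (rule exI[of _ "1 + 18 * C"], rule conjI)
    show "0 < 1 + 18 * C" using C(1) by simp
    show "\<exists>Y0\<ge>2. \<forall>Y\<ge>Y0. \<forall>\<delta>\<ge>Y powr (-(1/4)). \<forall>u.
     real (card (sector_upto u \<delta> Y)) \<le> (1 + 18 * C) * \<delta> * Y * ln Y powr (\<eta> - 1)"
    proof (intro exI[of _ "max Y0 2"] conjI allI impI)
    fix Y \<delta> :: real and u assume Y: "max Y0 2 \<le> Y" and \<delta>: "Y powr (-(1/4)) \<le> \<delta>"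
    define x where "x = X Y"
    have E: "Y \<ge> 16" "ln Y \<ge> 2" "exp x - 1 \<ge> ln Y + 4" "exp x - 1 \<ge> exp (x / 2)" "x > 0" "exp x \<le> Y"
      "9 * exp x \<le> Y powr (3/4) * ln Y powr (\<eta> - 1)"
      "(4 * ln (ln Y) + 3) * exp ((4 * ln (ln Y) + 2) * x) \<le> Y powr (1/4) * ln Y powr (\<eta> - 1)"
      "(ln (ln Y + 1) + 1) / (x / 2) \<le> ln Y powr (\<eta> - 1)"
      using Y0[of Y] Y unfolding x_def by auto
    define z where "z = nat \<lfloor>exp x\<rfloor>"
    define w where "w = nat \<lceil>ln Y\<rceil>"
    define k where "k = 2 * nat \<lceil>2 * ln (ln Y)\<rceil>"
    define l where "l = ln Y powr (\<eta> - 1)"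
    have l0: "l \<ge> 0" by (simp add: l_def)
    have "real_of_int \<lfloor>exp x\<rfloor> = real z" unfolding z_def by simp
    then have z: "real z \<le> exp x" "exp x - 1 \<le> real z" by linarith+
    have w: "ln Y \<le> real w" "real w \<le> ln Y + 1" unfolding w_def using E(2) by linarith+
    have llY: "ln (ln Y) \<ge> 0" using E(2) by simp
    have k: "4 * ln (ln Y) \<le> real k" "real k \<le> 4 * ln (ln Y) + 2" "even k" unfolding k_def using llY by (auto, linarith+)
    have w2: "2 \<le> w" and z3: "3 \<le> z" and wz: "w \<le> z" using w z E(2,3) by linarith+
    have lz: "ln (real z) \<ge> x / 2" using z E(4) z3 by (subst ln_ge_iff) auto
    have lzY: "ln (ln (real z)) \<le> ln (ln Y)"
    proof -
      have "real z \<le> Y" using z(1) E(6) by linarith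
      then have "ln (real z) \<le> ln Y" using z3 by simp
      moreover have "ln (real z) > 0" using z3 by simp
      ultimately show ?thesis by simp
    qed
    define h where "h = 2 * \<delta> * sqrt Y"
    have Y1: "Y > 0" "Y \<ge> 1" "sqrt Y \<ge> 1" using E(1) by auto
    have \<delta>0: "\<delta> > 0" using \<delta> Y1 by (smt (verit) powr_gt_zero)
    have h0: "h \<ge> 0" using \<delta>0 Y1 by (simp add: h_def)
    have sq: "sqrt Y = Y powr (1/2)" using Y1 by (simp add: powr_half_sqrt)
    have d1: "Y powr (1/4) \<le> \<delta> * sqrt Y"
    proof -
      have "Y powr (1/4) = Y powr (-(1/4)) * Y powr (1/2)" by (simp add: powr_add[symmetric])
      also have "\<dots> \<le> \<delta> * Y powr (1/2)" using \<delta> by (intro mult_right_mono) auto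
      finally show ?thesis by (simp add: sq)
    qed
    have d2: "Y powr (3/4) \<le> \<delta> * Y"
    proof -
      have "Y powr (3/4) = Y powr (-(1/4)) * Y powr 1" by (simp only: powr_add[symmetric]) simp
      also have "\<dots> \<le> \<delta> * Y powr 1" using \<delta> by (intro mult_right_mono) auto
      finally show ?thesis using Y1 by simp
    qed
    have d3: "1 \<le> \<delta> * sqrt Y"
    proof -
      have "1 \<le> Y powr (1/4)" using Y1 by (intro ge_one_powr_ge_zero) auto
      then show ?thesis using d1 by linarith
    qed
    obtain t where t: "card (sector_upto u \<delta> Y) \<le> card (strip t h Y)"
      using card_sector_le_strip[of \<delta> Y u] \<delta>0 Y1 unfolding h_def by auto
    let ?A = "{a::int. a \<noteq> 0 \<and> \<bar>real_of_int a\<bar> \<le> sqrt Y}"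
    let ?V = "\<lambda>a. {b::int. \<bar>real_of_int b - t * real_of_int a\<bar> \<le> h \<and> sifted w z a b}"
    let ?R = "{a::int. \<bar>real_of_int a\<bar> \<le> sqrt (real z)}"
    have fin: "finite {a::int. \<bar>real_of_int a\<bar> \<le> r}" if "r \<ge> 0" for r
      by (rule int_near_interval[of r 0]) (use that in auto)
    have fA: "finite ?A" by (rule finite_subset[OF _ fin[of "sqrt Y"]]) (use Y1 in auto)
    have fR: "finite ?R" by (rule fin) simp
    have V: "finite (?V a) \<and> real (card (?V a)) \<le> (2 * h + 1) * C * l + C * (Y powr (1/4) * l)" if a: "a \<in> ?A" for a
    proof -
      obtain s M where sM: "{b::int. \<bar>real_of_int b - t * real_of_int a\<bar> \<le> h} = {s..<s + int M}" "real M \<le> 2 * h + 1"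
        using int_near_interval[OF h0] by blast
      have Veq: "?V a = {b\<in>{s..<s + int M}. sifted w z a b}"
        unfolding sM(1)[symmetric] by auto
      have a0: "a \<noteq> 0" using a by simp
      \<comment> \<open>2 to the number of prime divisors is at most |a| <= Y, and ln 2 >= 1/2; w
        was chosen as ln Y rounded up for this purpose.\<close>
      have few: "card {q. prime q \<and> int q dvd a} \<le> 2 * w"
      proof -
        let ?c = "card {q. prime q \<and> int q dvd a}"
        have "real (2 ^ ?c) \<le> real (nat \<bar>a\<bar>)" unfolding of_nat_le_iff by (rule card_prime_divisors_le(2)[OF a0])
        also have "\<dots> = \<bar>real_of_int a\<bar>" by simp
        also have "\<dots> \<le> sqrt Y" using a by simp
        also have "\<dots> \<le> Y" using Y1 real_sqrt_le_mono[of Y "Y * Y"] by (simp add: real_sqrt_mult)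
        finally have "ln (2 ^ ?c) \<le> ln Y" using Y1 by (subst ln_le_cancel_iff) auto
        then have "real ?c * ln 2 \<le> ln Y" by (simp add: ln_realpow)
        moreover have "real ?c * (1/2) \<le> real ?c * ln 2" using ln2_ge_two_thirds by (intro mult_left_mono) auto
        ultimately have "real ?c \<le> 2 * real w" using w by linarith
        then show ?thesis by linarith
      qed
      have "real (card (?V a)) \<le> real M * C * ((ln (real w) + 1) / ln (real z)) + C * (real k + 1) * real z ^ k"
        unfolding Veq by (rule C(2)[OF w2 z3 wz a0 k(3) _ few]) (use k lzY in linarith)
      also have "real M * C * ((ln (real w) + 1) / ln (real z)) \<le> (2 * h + 1) * C * l"
      proof -
        have "(ln (real w) + 1) / ln (real z) \<le> (ln (ln Y + 1) + 1) / (x / 2)"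
          using w w2 lz E(5) by (intro frac_le add_mono) (auto simp: ln_ge_zero)
        then have "(ln (real w) + 1) / ln (real z) \<le> l" using E(9) by (simp add: l_def)
        moreover have "0 \<le> (ln (real w) + 1) / ln (real z)" using w2 z3 by simp
        ultimately show ?thesis using sM(2) C(1) h0 by (intro mult_mono) auto
      qed
      also have "C * (real k + 1) * real z ^ k \<le> C * (Y powr (1/4) * l)"
      proof -
        have "real z ^ k \<le> exp x ^ k" using z(1) by (intro power_mono) auto
        also have "\<dots> = exp (real k * x)" by (simp add: exp_of_nat_mult)
        also have "\<dots> \<le> exp ((4 * ln (ln Y) + 2) * x)" using k(2) E(5) by simp
        finally have "(real k + 1) * real z ^ k \<le> (4 * ln (ln Y) + 3) * exp ((4 * ln (ln Y) + 2) * x)"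
          using k(2) llY by (intro mult_mono) auto
        also have "\<dots> \<le> Y powr (1/4) * l" using E(8) by (simp add: l_def)
        finally have "C * ((real k + 1) * real z ^ k) \<le> C * (Y powr (1/4) * l)" using C(1) by (intro mult_left_mono) auto
        then show ?thesis by (simp only: mult.assoc)
      qed
      finally have "real (card (?V a)) \<le> (2 * h + 1) * C * l + C * (Y powr (1/4) * l)" by simp
      moreover have "finite (?V a)" unfolding Veq by (rule finite_subset[of _ "{s..<s + int M}"]) auto
      ultimately show ?thesis by blast
    qed
    \<comment> \<open>A prime norm p <= z may be one of the sieving primes, so these points are not
      sifted; they lie in a small square and are counted trivially. The row a = 0 holds no point
      because a prime is not a square.\<close>
    have "strip t h Y \<subseteq> ?R \<times> ?R \<union> (SIGMA a:?A. ?V a)"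
    proof (rule subrelI)
      fix a b assume ab: "(a, b) \<in> strip t h Y"
      define p where "p = nat (a\<^sup>2 + b\<^sup>2)"
      have p: "prime p" "int p = a\<^sup>2 + b\<^sup>2" "real p \<le> Y" "\<bar>real_of_int b - t * real_of_int a\<bar> \<le> h"
        using ab by (auto simp: strip_def p_def)
      show "(a, b) \<in> ?R \<times> ?R \<union> (SIGMA a:?A. ?V a)"
      proof (cases "p \<le> z")
        case True
        then have "real_of_int (a\<^sup>2 + b\<^sup>2) \<le> real z" "real_of_int (b\<^sup>2 + a\<^sup>2) \<le> real z"
          using p(2) by linarith+
        from abs_le_sqrt_of_square_le[OF this(1)] abs_le_sqrt_of_square_le[OF this(2)] show ?thesis by simp
      next
        case False
        have "real_of_int (a\<^sup>2 + b\<^sup>2) \<le> Y" using ab by (simp add: strip_def)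
        then have "\<bar>real_of_int a\<bar> \<le> sqrt Y" by (rule abs_le_sqrt_of_square_le)
        moreover have "a \<noteq> 0"
        proof
          assume "a = 0"
          then have "int p = int (nat \<bar>b\<bar> ^ 2)" using p(2) by simp
          then have "p = nat \<bar>b\<bar> ^ 2" by (simp only: of_nat_eq_iff)
          then show False using p(1) by (metis prime_power_iff numeral_eq_one_iff num.distinct(1))
        qed
        moreover have "\<not> int q dvd a\<^sup>2 + b\<^sup>2" if "prime q" "q \<le> z" for q
          using that False p primes_dvd_imp_eq[of q p] unfolding p(2)[symmetric] int_dvd_int_iff by auto
        ultimately show ?thesis using p by auto
      qed
    qed
    then have "card (strip t h Y) \<le> card (?R \<times> ?R \<union> (SIGMA a:?A. ?V a))"
      using fA fR V by (intro card_mono finite_UnI finite_SigmaI finite_cartesian_product) auto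
    also have "\<dots> \<le> card (?R \<times> ?R) + card (SIGMA a:?A. ?V a)" by (rule card_Un_le)
    also have "card (SIGMA a:?A. ?V a) = (\<Sum>a\<in>?A. card (?V a))" using fA V by (intro card_SigmaI) auto
    finally have "real (card (strip t h Y)) \<le> real (card (?R \<times> ?R)) + (\<Sum>a\<in>?A. real (card (?V a)))"
      unfolding of_nat_sum[symmetric] of_nat_add[symmetric] of_nat_le_iff .
    also have "real (card (?R \<times> ?R)) \<le> \<delta> * Y * l"
    proof -
      have s: "sqrt (real z) \<ge> 1" using z3 by simp
      have "real (card ?R) \<le> 3 * sqrt (real z)" using card_int_abs_le[of "sqrt (real z)"] s by linarith
      then have "real (card ?R) * real (card ?R) \<le> (3 * sqrt (real z)) * (3 * sqrt (real z))" by (intro mult_mono) auto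
      also have "\<dots> = 9 * real z" by simp
      also have "\<dots> \<le> 9 * exp x" using z by simp
      also have "\<dots> \<le> Y powr (3/4) * l" using E(7) by (simp add: l_def)
      also have "\<dots> \<le> \<delta> * Y * l" using d2 l0 by (intro mult_right_mono)
      finally show ?thesis by (simp add: card_cartesian_product)
    qed
    also have "(\<Sum>a\<in>?A. real (card (?V a))) \<le> (\<Sum>a\<in>?A. (2 * h + 1) * C * l + C * (Y powr (1/4) * l))"
      by (intro sum_mono) (use V in auto)
    also have "\<dots> = real (card ?A) * ((2 * h + 1) * C * l + C * (Y powr (1/4) * l))" by simp
    also have "\<dots> \<le> (3 * sqrt Y) * ((5 * (\<delta> * sqrt Y)) * C * l + C * ((\<delta> * sqrt Y) * l))"
    proof (rule mult_mono)
      have "card ?A \<le> card {a::int. \<bar>real_of_int a\<bar> \<le> sqrt Y}" using fin[of "sqrt Y"] Y1 by (intro card_mono) auto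
      then show "real (card ?A) \<le> 3 * sqrt Y" using card_int_abs_le[of "sqrt Y"] Y1 by linarith
      have "2 * h + 1 \<le> 5 * (\<delta> * sqrt Y)" using d3 by (simp add: h_def)
      then show "(2 * h + 1) * C * l + C * (Y powr (1/4) * l) \<le> (5 * (\<delta> * sqrt Y)) * C * l + C * ((\<delta> * sqrt Y) * l)"
        using C(1) l0 d1 by (intro add_mono mult_right_mono mult_left_mono) auto
      show "0 \<le> (2 * h + 1) * C * l + C * (Y powr (1/4) * l)" using h0 C(1) l0 by simp
    qed (use Y1 in auto)
    also have "\<dots> = 18 * C * (\<delta> * (sqrt Y * sqrt Y) * l)" by (simp add: algebra_simps)
    also have "sqrt Y * sqrt Y = Y" using Y1 by simp
    finally have "real (card (strip t h Y)) \<le> \<delta> * Y * l + 18 * C * (\<delta> * Y * l)" by simp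
    then show "real (card (sector_upto u \<delta> Y)) \<le> (1 + 18 * C) * \<delta> * Y * ln Y powr (\<eta> - 1)"
      using t unfolding l_def by (simp add: algebra_simps)
    qed simp
  qed
qed

section \<open>Splitting tuples of Gaussian integers\<close>

definition gint :: "complex set" where "gint = {z. Re z \<in> \<int> \<and> Im z \<in> \<int>}"

definition G :: "nat \<Rightarrow> complex set" where "G k = {z \<in> gint. (cmod z)\<^sup>2 = real k}"

lemma gint_mult: "z \<in> gint \<Longrightarrow> w \<in> gint \<Longrightarrow> z * w \<in> gint" by (auto simp: gint_def)

lemma gint_sum: "(\<And>i. i \<in> I \<Longrightarrow> z i \<in> gint) \<Longrightarrow> sum z I \<in> gint"
  by (auto simp: gint_def intro!: Ints_sum)

lemma G_mult: "z \<in> G m \<Longrightarrow> w \<in> G n \<Longrightarrow> z * w \<in> G (m * n)"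
  by (auto simp: G_def gint_mult norm_mult power_mult_distrib)

lemma one_in_G: "1 \<in> G 1" by (auto simp: G_def gint_def)

lemma cmod_G: "z \<in> G k \<Longrightarrow> cmod z = sqrt (real k)"
  using real_sqrt_abs[of "cmod z"] by (auto simp: G_def)

lemma gint_norm_ge_1:
  assumes "z \<in> gint" "z \<noteq> 0"
  shows "cmod z \<ge> 1"
proof -
  obtain x y where xy: "Re z = of_int x" "Im z = of_int y" using assms(1) by (auto simp: gint_def elim!: Ints_cases)
  have "x \<noteq> 0 \<or> y \<noteq> 0" using assms(2) xy by (auto simp: complex_eq_iff)
  then have "x\<^sup>2 + y\<^sup>2 > 0" by (simp add: sum_power2_gt_zero_iff)
  then have "x\<^sup>2 + y\<^sup>2 \<ge> 1" by linarith
  then have "real_of_int (x\<^sup>2 + y\<^sup>2) \<ge> 1" by linarith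
  then show ?thesis unfolding cmod_def xy by simp
qed

lemma gp_in_G:
  assumes "prime p" "p mod 4 = 1"
  shows "gp p \<in> G p" "cnj (gp p) \<in> G p"
  using cmod_gp[OF assms] by (auto simp: G_def gint_def gp_def)

text \<open>The hypothesis d says that p divides the real part of z times the conjugate of a + b i.
  The two-squares identity then makes p^2 divide the square sum of both parts, so p divides the
  imaginary part as well, and the quotient s + t i is the cofactor.\<close>

lemma gauss_divide:
  fixes a b :: int
  assumes p: "prime p" and ab: "a\<^sup>2 + b\<^sup>2 = int p" and x: "x\<^sup>2 + y\<^sup>2 = int (p * k)" and d: "int p dvd a * x + b * y"
  shows "\<exists>w\<in>G k. Complex (of_int x) (of_int y) = Complex (of_int a) (of_int b) * w"
proof -
  have pp: "prime (int p)" using p by simp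
  have p0: "p > 0" using p by (rule prime_gt_0_nat)
  have "(a * x + b * y)\<^sup>2 + (a * y - b * x)\<^sup>2 = (a\<^sup>2 + b\<^sup>2) * (x\<^sup>2 + y\<^sup>2)"
    by (simp add: power2_eq_square algebra_simps)
  also have "\<dots> = int p * int (p * k)" unfolding ab x ..
  finally have e: "(a * x + b * y)\<^sup>2 + (a * y - b * x)\<^sup>2 = int p * int (p * k)" .
  have "int p dvd (a * x + b * y)\<^sup>2" using d by (simp add: power2_eq_square)
  then have "int p dvd (a * y - b * x)\<^sup>2" using e by (metis dvd_add_right_iff dvd_triv_left)
  then have d2: "int p dvd a * y - b * x" using pp prime_dvd_power by blast
  obtain s t where s: "a * x + b * y = int p * s" and t: "a * y - b * x = int p * t"
    using d d2 by (auto elim!: dvdE)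
  define w where "w = Complex (of_int s) (of_int t)"
  have "int p * (int p * (s\<^sup>2 + t\<^sup>2)) = int p * (int p * int k)"
    using e unfolding s t by (simp add: power2_eq_square algebra_simps)
  then have st: "s\<^sup>2 + t\<^sup>2 = int k" using p0 by simp
  have "int p * (a * s - b * t) = a * (int p * s) - b * (int p * t)" by (simp add: algebra_simps)
  also have "\<dots> = (a\<^sup>2 + b\<^sup>2) * x" unfolding s[symmetric] t[symmetric] by (simp add: power2_eq_square algebra_simps)
  also have "\<dots> = int p * x" unfolding ab ..
  finally have 1: "a * s - b * t = x" using p0 by simp
  have "int p * (a * t + b * s) = a * (int p * t) + b * (int p * s)" by (simp add: algebra_simps)
  also have "\<dots> = (a\<^sup>2 + b\<^sup>2) * y" unfolding s[symmetric] t[symmetric] by (simp add: power2_eq_square algebra_simps)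
  also have "\<dots> = int p * y" unfolding ab ..
  finally have 2: "a * t + b * s = y" using p0 by simp
  have "(cmod w)\<^sup>2 = real_of_int (s\<^sup>2 + t\<^sup>2)" by (simp add: w_def cmod_power2)
  then have "w \<in> G k" unfolding st by (simp add: G_def gint_def w_def)
  moreover have "Complex (of_int x) (of_int y) = Complex (of_int a) (of_int b) * w"
    unfolding w_def 1[symmetric] 2[symmetric] by (simp add: complex_eq_iff)
  ultimately show ?thesis by blast
qed

text \<open>Primality of the Gaussian factors read off in the integers: (a x + b y)(a x - b y) = a^2
  (x^2 + y^2) - y^2 (a^2 + b^2) is divisible by p, so one of the factors is. Unique factorization of
  Gaussian integers is thereby avoided.\<close>

lemma gauss_split:
  assumes p: "prime p" "p mod 4 = 1" and z: "z \<in> G (p * k)"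
  shows "\<exists>w\<in>G k. z = gp p * w \<or> z = cnj (gp p) * w"
proof -
  obtain x y where xy: "Re z = of_int x" "Im z = of_int y" using z by (auto simp: G_def gint_def elim!: Ints_cases)
  then have zxy: "z = Complex (of_int x) (of_int y)" by (simp add: complex_eq_iff)
  have "real_of_int (x\<^sup>2 + y\<^sup>2) = real_of_int (int (p * k))"
    using z unfolding G_def zxy by (simp add: cmod_power2)
  then have n: "x\<^sup>2 + y\<^sup>2 = int (p * k)" by (simp only: of_int_eq_iff)
  define a b where "a = fst (gauss_rep p)" and "b = snd (gauss_rep p)"
  have ab: "a\<^sup>2 + b\<^sup>2 = int p" "a\<^sup>2 + (-b)\<^sup>2 = int p" using gauss_rep[OF p] by (auto simp: a_def b_def)
  have gpc: "gp p = Complex (of_int a) (of_int b)" "cnj (gp p) = Complex (of_int a) (of_int (-b))"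
    by (auto simp: gp_def a_def b_def complex_eq_iff)
  have "(a * x + b * y) * (a * x + (-b) * y) = a\<^sup>2 * (x\<^sup>2 + y\<^sup>2) - y\<^sup>2 * (a\<^sup>2 + b\<^sup>2)"
    by (simp add: power2_eq_square algebra_simps)
  then have "int p dvd (a * x + b * y) * (a * x + (-b) * y)" unfolding n ab by simp
  then have "int p dvd a * x + b * y \<or> int p dvd a * x + (-b) * y" using p(1) prime_dvd_mult_iff[of "int p"] by simp
  then show ?thesis
  proof
    assume "int p dvd a * x + b * y"
    from gauss_divide[OF p(1) ab(1) n this] show ?thesis unfolding gpc zxy by blast
  next
    assume "int p dvd a * x + (-b) * y"
    from gauss_divide[OF p(1) ab(2) n this] show ?thesis unfolding gpc(2) zxy by blast
  qed
qed

lemma Om_prime_mult: "prime p \<Longrightarrow> k > 0 \<Longrightarrow> Om (p * k) = Suc (Om k)"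
  by (simp add: prime_factorization_mult prime_factorization_prime prime_gt_0_nat)

text \<open>Each prime factor leaves at most two choices by \<open>gauss_split\<close>, and at norm
  1 there are the four units.\<close>

lemma card_G: "k \<in> S1 \<Longrightarrow> finite (G k) \<and> card (G k) \<le> 4 * 2 ^ Om k"
proof (induction k rule: less_induct)
  case (less k)
  show ?case
  proof (cases "k = 1")
    case True
    have "G 1 \<subseteq> {1, -1, \<i>, -\<i>}"
    proof
      fix z assume z: "z \<in> G 1"
      then obtain x y where xy: "Re z = of_int x" "Im z = of_int y" by (auto simp: G_def gint_def elim!: Ints_cases)
      have "real_of_int (x\<^sup>2 + y\<^sup>2) = 1" using z xy by (simp add: G_def cmod_power2)
      then have e: "x\<^sup>2 + y\<^sup>2 = 1" by linarith
      have "x\<^sup>2 \<le> 1\<^sup>2" "y\<^sup>2 \<le> 1\<^sup>2" using e zero_le_power2[of x] zero_le_power2[of y] unfolding power_one by linarith+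
      then have "\<bar>x\<bar> \<le> 1" "\<bar>y\<bar> \<le> 1" by (simp_all only: abs_le_square_iff[symmetric] abs_1)
      then have "x \<in> {-1,0,1}" "y \<in> {-1,0,1}" by auto
      then show "z \<in> {1, -1, \<i>, -\<i>}" using e xy by (auto simp: complex_eq_iff)
    qed
    moreover have "card {1, -1, \<i>, -\<i>} \<le> 4" by (simp add: card_insert_if)
    ultimately show ?thesis using True card_mono[of "{1, -1, \<i>, -\<i>}" "G 1"] finite_subset by auto
  next
    case False
    then obtain p where p: "prime p" "p dvd k" using prime_factor_nat by blast
    then have p4: "p mod 4 = 1" using less.prems by (auto simp: S1_def)
    obtain m where m: "k = p * m" using p by (auto elim: dvdE)
    have mS: "m \<in> S1" using less.prems unfolding m S1_mult_iff by simp
    have m0: "m > 0" using mS by (rule S1_pos)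
    have "m < k" unfolding m using m0 prime_gt_1_nat[OF p(1)] by simp
    then have IH: "finite (G m)" "card (G m) \<le> 4 * 2 ^ Om m" using less.IH mS by auto
    have sub: "G k \<subseteq> (\<lambda>w. gp p * w) ` G m \<union> (\<lambda>w. cnj (gp p) * w) ` G m"
      using gauss_split[OF p(1) p4, of _ m] unfolding m by auto
    have fin: "finite ((\<lambda>w. gp p * w) ` G m \<union> (\<lambda>w. cnj (gp p) * w) ` G m)" using IH by simp
    have "card (G k) \<le> card ((\<lambda>w. gp p * w) ` G m \<union> (\<lambda>w. cnj (gp p) * w) ` G m)" by (rule card_mono[OF fin sub])
    also have "\<dots> \<le> card ((\<lambda>w. gp p * w) ` G m) + card ((\<lambda>w. cnj (gp p) * w) ` G m)" by (rule card_Un_le)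
    also have "\<dots> \<le> card (G m) + card (G m)" by (intro add_mono card_image_le IH)
    also have "\<dots> \<le> 4 * 2 ^ Om k" unfolding m Om_prime_mult[OF p(1) m0] using IH(2) by simp
    finally show ?thesis using finite_subset[OF sub fin] by simp
  qed
qed

text \<open>The nontrivial splits: both \<open>gp p\<close> and its conjugate are taken out of at
  least one entry. An entry divisible by both may be put on either side, whence the existential
  quantifier over I.\<close>

definition psplit :: "nat \<Rightarrow> (nat \<Rightarrow> complex) \<Rightarrow> nat \<Rightarrow> nat \<Rightarrow> bool" where
  "psplit l z n p \<longleftrightarrow> (\<exists>I w. I \<subseteq> {..<l} \<and> I \<noteq> {} \<and> I \<noteq> {..<l} \<and> (\<forall>i<l. w i \<in> G (n div p)) \<and>
     (\<forall>i<l. z i = (if i \<in> I then gp p else cnj (gp p)) * w i))"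

text \<open>Primes are taken out of Q one at a time. If all entries yield the same factor, it joins
  the common factor and the induction continues with the quotients, which is why z is generalized; a
  split found for the quotients is carried back by multiplying with that factor. Otherwise the set
  of entries yielding \<open>gp p\<close> is nonempty and proper.\<close>

lemma split_or_common_factor:
  assumes "Q > 0" "\<And>p. prime p \<Longrightarrow> p dvd Q \<Longrightarrow> p mod 4 = 1" "\<And>i. i < l \<Longrightarrow> z i \<in> G (Q * k)"
  shows "(\<exists>p. prime p \<and> p dvd Q \<and> psplit l z (Q * k) p) \<or> (\<exists>g\<in>G Q. \<exists>w. \<forall>i<l. w i \<in> G k \<and> z i = g * w i)"
  using assms
proof (induction Q arbitrary: z rule: less_induct)
  case (less Q)
  show ?case
  proof (cases "Q = 1")
    case True
    then have "1 \<in> G Q \<and> (\<forall>i<l. z i \<in> G k \<and> z i = 1 * z i)" using less.prems(3) one_in_G by simp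
    then show ?thesis by blast
  next
    case False
    then obtain p where p: "prime p" "p dvd Q" using prime_factor_nat by blast
    then have p4: "p mod 4 = 1" using less.prems by blast
    obtain m where m: "Q = p * m" using p by (auto elim: dvdE)
    have m0: "m > 0" using less.prems(1) m by (auto intro: Nat.gr0I)
    have mQ: "m < Q" unfolding m using m0 prime_gt_1_nat[OF p(1)] by simp
    have "\<forall>i<l. \<exists>w\<in>G (m * k). z i = gp p * w \<or> z i = cnj (gp p) * w"
      using gauss_split[OF p(1) p4, of _ "m * k"] less.prems(3) unfolding m by (auto simp: mult.assoc)
    then obtain w where w: "\<And>i. i < l \<Longrightarrow> w i \<in> G (m * k)" "\<And>i. i < l \<Longrightarrow> z i = gp p * w i \<or> z i = cnj (gp p) * w i"
      by metis
    define I where "I = {i. i < l \<and> z i = gp p * w i}"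
    have zI: "z i = (if i \<in> I then gp p else cnj (gp p)) * w i" if "i < l" for i
      using w(2)[OF that] that by (auto simp: I_def)
    have Ip: "I \<subseteq> {..<l}" by (auto simp: I_def)
    have trivial: ?thesis if sg: "\<sigma> \<in> G p" "\<And>i. i < l \<Longrightarrow> z i = \<sigma> * w i" for \<sigma>
    proof -
      have "(\<exists>p. prime p \<and> p dvd m \<and> psplit l w (m * k) p) \<or> (\<exists>g\<in>G m. \<exists>w'. \<forall>i<l. w' i \<in> G k \<and> w i = g * w' i)"
        using less.prems(2) m w(1) by (intro less.IH mQ m0) auto
      then show ?thesis
      proof
        assume "\<exists>p. prime p \<and> p dvd m \<and> psplit l w (m * k) p"
        then obtain p' J v where v: "prime p'" "p' dvd m" "J \<subseteq> {..<l}" "J \<noteq> {}" "J \<noteq> {..<l}"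
          "\<And>i. i < l \<Longrightarrow> v i \<in> G (m * k div p')" "\<And>i. i < l \<Longrightarrow> w i = (if i \<in> J then gp p' else cnj (gp p')) * v i"
          unfolding psplit_def by blast
        have "p * (m * k div p') = Q * k div p'"
          unfolding m using v(2) by (metis div_mult_swap dvd_mult2 mult.assoc)
        then have "\<sigma> * v i \<in> G (Q * k div p')" if "i < l" for i
          using G_mult[OF sg(1) v(6)[OF that]] by simp
        moreover have "z i = (if i \<in> J then gp p' else cnj (gp p')) * (\<sigma> * v i)" if "i < l" for i
          using sg(2)[OF that] v(7)[OF that] by simp
        ultimately have "psplit l z (Q * k) p'"
          unfolding psplit_def using v(3-5) by (intro exI[of _ J] exI[of _ "\<lambda>i. \<sigma> * v i"]) auto
        then show ?thesis using v(1,2) m by auto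
      next
        assume "\<exists>g\<in>G m. \<exists>w'. \<forall>i<l. w' i \<in> G k \<and> w i = g * w' i"
        then obtain g w' where g: "g \<in> G m" "\<And>i. i < l \<Longrightarrow> w' i \<in> G k \<and> w i = g * w' i" by blast
        have "\<sigma> * g \<in> G Q" unfolding m using sg(1) g(1) by (rule G_mult)
        moreover have "\<forall>i<l. w' i \<in> G k \<and> z i = (\<sigma> * g) * w' i" using g(2) sg(2) by simp
        ultimately show ?thesis by blast
      qed
    qed
    show ?thesis
    proof (cases "I = {} \<or> I = {..<l}")
      case True
      then show ?thesis
      proof
        assume "I = {}"
        then show ?thesis using zI by (intro trivial[OF gp_in_G(2)[OF p(1) p4]]) auto
      next
        assume "I = {..<l}"
        then show ?thesis using zI by (intro trivial[OF gp_in_G(1)[OF p(1) p4]]) auto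
      qed
    next
      case False
      have "Q * k div p = m * k" unfolding m using prime_gt_0_nat[OF p(1)] by (simp add: mult.assoc)
      then have "psplit l z (Q * k) p"
        unfolding psplit_def using False Ip w(1) zI by (intro exI[of _ I] exI[of _ w]) auto
      then show ?thesis using p by blast
    qed
  qed
qed

text \<open>If pi A + conj(pi) B is small and A is not, then pi / conj(pi) is close to -B / A. These
  centres depend on the cofactors and on I but not on p, so for given k there are few of them. A
  vanishing denominator merely adds the centre 0.\<close>

definition arcs :: "nat \<Rightarrow> nat \<Rightarrow> complex set" where
  "arcs l k = (\<lambda>(w, I, c). let A = \<Sum>i\<in>I. w i; B = \<Sum>i\<in>{..<l} - I. w i in if c then - B / A else cnj (- A / B)) `
     (PiE {..<l} (\<lambda>_. G k) \<times> Pow {..<l} \<times> (UNIV :: bool set))"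

lemma card_arcs:
  assumes "k \<in> S1"
  shows "finite (arcs l k)" "card (arcs l k) \<le> 2 * 2 ^ l * (4 * 2 ^ Om k) ^ l"
proof -
  let ?D = "PiE {..<l} (\<lambda>_. G k) \<times> Pow {..<l} \<times> (UNIV :: bool set)"
  have fin: "finite ?D" using card_G[OF assms] by (intro finite_cartesian_product finite_PiE) auto
  then show "finite (arcs l k)" unfolding arcs_def by (rule finite_imageI)
  have "card (arcs l k) \<le> card ?D" unfolding arcs_def by (rule card_image_le[OF fin])
  also have "\<dots> = card (G k) ^ l * (2 ^ l * 2)" by (simp add: card_cartesian_product card_PiE card_Pow)
  also have "\<dots> \<le> (4 * 2 ^ Om k) ^ l * (2 ^ l * 2)" using card_G[OF assms] by (intro mult_right_mono power_mono) auto
  finally show "card (arcs l k) \<le> 2 * 2 ^ l * (4 * 2 ^ Om k) ^ l" by (simp add: mult_ac)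
qed

text \<open>The case where the sum over the complement of \<open>I\<close> is the large one is reduced to the other one by
  conjugation; this is the purpose of the second kind of element in \<open>arcs\<close>.\<close>

lemma split_sector:
  assumes p: "prime p" "p mod 4 = 1" and n: "n = p * k" "k > 0" and sp: "psplit l z n p"
    and small: "cmod (\<Sum>i<l. z i) \<le> sqrt (real n) * d0" and d1: "d1 > 0"
    and big: "\<And>I. I \<subseteq> {..<l} \<Longrightarrow> I \<noteq> {} \<Longrightarrow> I \<noteq> {..<l} \<Longrightarrow>
       sqrt (real n) * d1 \<le> cmod (\<Sum>i\<in>I. z i) \<or> sqrt (real n) * d1 \<le> cmod (\<Sum>i\<in>{..<l} - I. z i)"
  shows "\<exists>u\<in>arcs l k. p \<in> sector u (d0 / d1)"
proof -
  have p0: "p > 0" using prime_gt_0_nat[OF p(1)] .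
  obtain I w where I: "I \<subseteq> {..<l}" "I \<noteq> {}" "I \<noteq> {..<l}" "\<And>i. i < l \<Longrightarrow> w i \<in> G k"
    "\<And>i. i < l \<Longrightarrow> z i = (if i \<in> I then gp p else cnj (gp p)) * w i"
    using sp unfolding psplit_def n using p0 by auto
  define A B where "A = (\<Sum>i\<in>I. w i)" and "B = (\<Sum>i\<in>{..<l} - I. w i)"
  have zA: "(\<Sum>i\<in>I. z i) = gp p * A"
    unfolding A_def sum_distrib_left using I by (intro sum.cong) auto
  have zB: "(\<Sum>i\<in>{..<l} - I. z i) = cnj (gp p) * B"
    unfolding B_def sum_distrib_left using I by (intro sum.cong) auto
  have zAB: "(\<Sum>i<l. z i) = gp p * A + cnj (gp p) * B"
    unfolding zA[symmetric] zB[symmetric] using I(1) sum.subset_diff[of I "{..<l}" z] by (simp add: add.commute)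
  have m: "cmod (gp p) = sqrt (real p)" using p by (rule cmod_gp)
  have sn: "sqrt (real n) = sqrt (real p) * sqrt (real k)" unfolding n by (simp add: real_sqrt_mult)
  have sp0: "sqrt (real p) > 0" "sqrt (real k) > 0" using p0 n(2) by auto
  have d0: "0 \<le> d0"
  proof -
    have "0 \<le> sqrt (real n) * d0" using small norm_ge_zero order_trans by blast
    moreover have "sqrt (real n) > 0" using sp0 sn by simp
    ultimately show ?thesis by (simp add: zero_le_mult_iff)
  qed
  have restr: "(\<Sum>i\<in>J. restrict w {..<l} i) = (\<Sum>i\<in>J. w i)" if "J \<subseteq> {..<l}" for J
    using that by (intro sum.cong) auto
  have mem: "(if c then - B / A else cnj (- A / B)) \<in> arcs l k" for c
    unfolding arcs_def
  proof (rule image_eqI[of _ _ "(restrict w {..<l}, I, c)"])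
    show "(if c then - B / A else cnj (- A / B)) = (\<lambda>(w, I, c). let A = \<Sum>i\<in>I. w i; B = \<Sum>i\<in>{..<l} - I. w i in if c then - B / A else cnj (- A / B)) (restrict w {..<l}, I, c)"
      using restr[OF I(1)] restr[of "{..<l} - I"] by (simp add: A_def B_def)
    show "(restrict w {..<l}, I, c) \<in> PiE {..<l} (\<lambda>_. G k) \<times> Pow {..<l} \<times> UNIV"
      using I by auto
  qed
  have S: "cmod (gp p * A + cnj (gp p) * B) \<le> sqrt (real p) * sqrt (real k) * d0"
    using small unfolding zAB sn .
  from big[OF I(1-3)] show ?thesis
  proof
    assume "sqrt (real n) * d1 \<le> cmod (\<Sum>i\<in>I. z i)"
    then have "sqrt (real p) * (sqrt (real k) * d1) \<le> sqrt (real p) * cmod A" unfolding zA norm_mult m sn by (simp only: mult.assoc)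
    then have A: "sqrt (real k) * d1 \<le> cmod A" using sp0 by simp
    have kd: "sqrt (real k) * d1 > 0" using sp0 d1 by simp
    then have A0: "A \<noteq> 0" using A by auto
    have "gp p - (- B / A) * cnj (gp p) = (gp p * A + cnj (gp p) * B) / A" using A0 by (simp add: field_simps)
    then have "cmod (gp p - (- B / A) * cnj (gp p)) = cmod (gp p * A + cnj (gp p) * B) / cmod A" by (simp add: norm_divide)
    also have "\<dots> \<le> (sqrt (real p) * sqrt (real k) * d0) / (sqrt (real k) * d1)"
      using S A kd d0 by (intro frac_le) auto
    also have "\<dots> = d0 / d1 * sqrt (real p)" using sp0 by simp
    finally have "p \<in> sector (- B / A) (d0 / d1)" using p by (simp add: sector_def)
    then show ?thesis using mem[of True] by auto
  next
    assume "sqrt (real n) * d1 \<le> cmod (\<Sum>i\<in>{..<l} - I. z i)"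
    then have "sqrt (real p) * (sqrt (real k) * d1) \<le> sqrt (real p) * cmod B" unfolding zB norm_mult complex_mod_cnj m sn by (simp only: mult.assoc)
    then have B: "sqrt (real k) * d1 \<le> cmod B" using sp0 by simp
    have kd: "sqrt (real k) * d1 > 0" using sp0 d1 by simp
    then have B0: "B \<noteq> 0" using B by auto
    have "gp p - cnj (- A / B) * cnj (gp p) = cnj ((gp p * A + cnj (gp p) * B) / B)" using B0 by (simp add: field_simps)
    then have "cmod (gp p - cnj (- A / B) * cnj (gp p)) = cmod (gp p * A + cnj (gp p) * B) / cmod B"
      by (simp only: complex_mod_cnj norm_divide)
    also have "\<dots> \<le> (sqrt (real p) * sqrt (real k) * d0) / (sqrt (real k) * d1)"
      using S B kd d0 by (intro frac_le) auto
    also have "\<dots> = d0 / d1 * sqrt (real p)" using sp0 by simp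
    finally have "p \<in> sector (cnj (- A / B)) (d0 / d1)" using p by (simp add: sector_def)
    then show ?thesis using mem[of False] by auto
  qed
qed

section \<open>Counting the integers with an exceptional split\<close>

lemma finite_sector_upto: "finite (sector_upto u \<delta> Y)"
  by (rule finite_subset[of _ "{..nat \<lfloor>Y\<rfloor>}"]) (auto simp: le_nat_iff le_floor_iff)

abbreviation sector_products :: "nat set \<Rightarrow> (nat \<Rightarrow> complex set) \<Rightarrow> real \<Rightarrow> (nat \<Rightarrow> real) \<Rightarrow> nat set" where
  "sector_products K U \<delta> Y \<equiv> {p * k | p k. k \<in> K \<and> (\<exists>u\<in>U k. p \<in> sector u \<delta> \<and> real p \<le> Y k)}"

lemma card_sector_products:
  assumes K: "finite K" and U: "\<And>k. k \<in> K \<Longrightarrow> finite (U k) \<and> real (card (U k)) \<le> B"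
    and P: "\<And>k u. k \<in> K \<Longrightarrow> real (card (sector_upto u \<delta> (Y k))) \<le> P k"
  shows "finite (sector_products K U \<delta> Y)"
    "real (card (sector_products K U \<delta> Y)) \<le> (\<Sum>k\<in>K. B * P k)"
proof -
  let ?E = "(sector_products K U \<delta> Y)"
  let ?S = "SIGMA k:K. SIGMA u:U k. (sector_upto u \<delta> (Y k))"
  have fin: "finite ?S" using K U by (intro finite_SigmaI finite_sector_upto) auto
  have sub: "?E \<subseteq> (\<lambda>(k, u, p). p * k) ` ?S"
  proof
    fix n assume "n \<in> ?E"
    then obtain p k u where "n = p * k" "k \<in> K" "u \<in> U k" "p \<in> sector u \<delta>" "real p \<le> Y k" by auto
    then show "n \<in> (\<lambda>(k, u, p). p * k) ` ?S" by (intro image_eqI[of _ _ "(k, u, p)"]) auto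
  qed
  show "finite ?E" using fin by (intro finite_subset[OF sub]) auto
  have "card ?E \<le> card ((\<lambda>(k, u, p). p * k) ` ?S)" using fin by (intro card_mono sub) auto
  also have "\<dots> \<le> card ?S" by (rule card_image_le[OF fin])
  also have "card ?S = (\<Sum>k\<in>K. card (SIGMA u:U k. (sector_upto u \<delta> (Y k))))"
    using K U by (intro card_SigmaI ballI finite_SigmaI finite_sector_upto) auto
  also have "\<dots> = (\<Sum>k\<in>K. \<Sum>u\<in>U k. card (sector_upto u \<delta> (Y k)))"
    using U by (intro sum.cong refl card_SigmaI ballI finite_sector_upto) auto
  finally have "real (card ?E) \<le> (\<Sum>k\<in>K. \<Sum>u\<in>U k. real (card (sector_upto u \<delta> (Y k))))"
    unfolding of_nat_sum[symmetric] of_nat_le_iff .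
  also have "\<dots> \<le> (\<Sum>k\<in>K. B * P k)"
  proof (rule sum_mono)
    fix k assume k: "k \<in> K"
    have P0: "0 \<le> P k" using P[OF k, of 0] by (rule order_trans[rotated]) simp
    have "(\<Sum>u\<in>U k. real (card (sector_upto u \<delta> (Y k)))) \<le> (\<Sum>u\<in>U k. P k)"
      by (intro sum_mono P k)
    also have "\<dots> = real (card (U k)) * P k" by simp
    also have "\<dots> \<le> B * P k" using U[OF k] P0 by (intro mult_right_mono) auto
    finally show "(\<Sum>u\<in>U k. real (card (sector_upto u \<delta> (Y k)))) \<le> B * P k" .
  qed
  finally show "real (card ?E) \<le> (\<Sum>k\<in>K. B * P k)" .
qed

section \<open>Dyadic decomposition according to the size of p\<close>

definition dyadic :: "real \<Rightarrow> real \<Rightarrow> nat set" where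
  "dyadic y y' = {j. y < 2 ^ (j + 1) \<and> 2 ^ j \<le> y'}"

lemma dyadic_bound:
  assumes "j \<in> dyadic y y'"
  shows "real j \<le> 2 * ln y'"
proof -
  have j: "2 ^ j \<le> y'" using assms by (simp add: dyadic_def)
  moreover have "(0::real) < 2 ^ j" by simp
  ultimately have "y' > 0" by linarith
  with j have "ln (2 ^ j) \<le> ln y'" by (subst ln_le_cancel_iff) simp_all
  then have "real j * ln 2 \<le> ln y'" by (simp add: ln_realpow)
  moreover have "real j * (1/2) \<le> real j * ln 2" using ln2_ge_two_thirds by (intro mult_left_mono) auto
  ultimately show ?thesis by linarith
qed

lemma finite_dyadic: "finite (dyadic y y')"
  by (rule finite_subset[of _ "{..nat \<lfloor>2 * ln y'\<rfloor>}"]) (use dyadic_bound in \<open>force simp: le_nat_iff le_floor_iff\<close>)+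

lemma card_dyadic:
  assumes "y' \<ge> 1"
  shows "real (card (dyadic y y')) \<le> 2 * ln y' + 1"
proof -
  have "dyadic y y' \<subseteq> {..nat \<lfloor>2 * ln y'\<rfloor>}"
  proof
    fix j assume "j \<in> dyadic y y'"
    then have "real j \<le> 2 * ln y'" by (rule dyadic_bound)
    then show "j \<in> {..nat \<lfloor>2 * ln y'\<rfloor>}" by (auto simp: le_nat_iff le_floor_iff)
  qed
  then have "card (dyadic y y') \<le> card {..nat \<lfloor>2 * ln y'\<rfloor>}" by (intro card_mono) auto
  moreover have "real (nat \<lfloor>2 * ln y'\<rfloor>) \<le> 2 * ln y'" using assms by (simp add: ln_ge_zero)
  ultimately show ?thesis by simp
qed

abbreviation range_products :: "real \<Rightarrow> real \<Rightarrow> nat \<Rightarrow> (nat \<Rightarrow> complex set) \<Rightarrow> real \<Rightarrow> nat set" where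
  "range_products y y' N U \<delta> \<equiv>
     {p * k | p k. k \<in> S1 \<and> y < real p \<and> real p \<le> y' \<and> p * k \<le> N \<and> (\<exists>u\<in>U k. p \<in> sector u \<delta>)}"

text \<open>For p in [2^j, 2^(j + 1)) the cofactor is at most N div 2^j; it is chosen first, then
  one of its at most B centres, then p in the sector.\<close>

lemma card_dyadic_products:
  assumes U: "\<And>k. k \<in> S1 \<Longrightarrow> finite (U k) \<and> real (card (U k)) \<le> B"
    and P: "\<And>j u. j \<in> dyadic y y' \<Longrightarrow> real (card (sector_upto u \<delta> (2 ^ (j + 1)))) \<le> P j"
  shows "real (card (range_products y y' N U \<delta>))
    \<le> (\<Sum>j\<in>dyadic y y'. real (card (S1 \<inter> {1..N div 2 ^ j})) * (B * P j))"
proof -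
  let ?F = "\<lambda>j. sector_products (S1 \<inter> {1..N div 2 ^ j}) U \<delta> (\<lambda>_. 2 ^ (j + 1))"
  have F: "finite (?F j)" "real (card (?F j)) \<le> real (card (S1 \<inter> {1..N div 2 ^ j})) * (B * P j)" if j: "j \<in> dyadic y y'" for j
    using card_sector_products[of "S1 \<inter> {1..N div 2 ^ j}" U B \<delta> "\<lambda>_. 2 ^ (j + 1)" "\<lambda>_. P j"] U P[OF j] by auto
  have sub: "(range_products y y' N U \<delta>) \<subseteq> (\<Union>j\<in>dyadic y y'. ?F j)"
  proof
    fix n assume "n \<in> (range_products y y' N U \<delta>)"
    then obtain p k u where n: "n = p * k" "k \<in> S1" "y < real p" "real p \<le> y'" "p * k \<le> N" "u \<in> U k" "p \<in> sector u \<delta>" by auto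
    have "p \<ge> 1" using n(7) prime_ge_1_nat by (auto simp: sector_def)
    then obtain j where j: "2 ^ j \<le> p" "p < 2 ^ (j + 1)" using ex_power_ivl1[of 2 p] by auto
    have rj: "(2::real) ^ j \<le> real p" "real p < 2 ^ (j + 1)" using j by (metis of_nat_le_iff of_nat_less_iff of_nat_power of_nat_numeral)+
    have "y < 2 ^ (j + 1)" "2 ^ j \<le> y'" using rj n(3,4) by linarith+
    then have jd: "j \<in> dyadic y y'" by (simp add: dyadic_def)
    have "2 ^ j * k \<le> N" using j(1) n(5) mult_le_mono1[of "2 ^ j" p k] by linarith
    then have "k \<le> N div 2 ^ j" by (simp add: less_eq_div_iff_mult_less_eq mult.commute)
    then have "n \<in> ?F j" using n rj S1_pos[OF n(2)] by fastforce
    then show "n \<in> (\<Union>j\<in>dyadic y y'. ?F j)" using jd by blast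
  qed
  have "card (range_products y y' N U \<delta>) \<le> card (\<Union>j\<in>dyadic y y'. ?F j)"
    using sub F(1) finite_dyadic by (intro card_mono finite_UN_I) auto
  also have "\<dots> \<le> (\<Sum>j\<in>dyadic y y'. card (?F j))" using finite_dyadic by (rule card_UN_le)
  finally have "real (card (range_products y y' N U \<delta>)) \<le> (\<Sum>j\<in>dyadic y y'. real (card (?F j)))"
    unfolding of_nat_sum[symmetric] of_nat_le_iff .
  also have "\<dots> \<le> (\<Sum>j\<in>dyadic y y'. real (card (S1 \<inter> {1..N div 2 ^ j})) * (B * P j))"
    by (intro sum_mono F(2))
  finally show ?thesis .
qed

text \<open>For d <= sqrt N the quotient N div d is at least N^(1/4), so replacing its logarithm by
  ln N under the square root costs a factor 2.\<close>

lemma S1_count_div: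
  "\<exists>C>0. \<exists>N0\<ge>3. \<forall>N\<ge>N0. \<forall>d\<ge>1. (real d)\<^sup>2 \<le> real N \<longrightarrow>
     real (card (S1 \<inter> {1..N div d})) \<le> C * (real N / sqrt (ln (real N))) / real d"
proof -
  obtain C where C: "C > 0" "\<And>N. N \<ge> 2 \<Longrightarrow> real (card (S1 \<inter> {1..N})) \<le> C * real N / sqrt (ln (real N))"
    using S1_count_upper by blast
  have "eventually (\<lambda>N::nat. sqrt (real N) - 1 \<ge> real N powr (1/4) \<and> sqrt (real N) - 1 \<ge> 2) sequentially"
    by (intro eventually_conj; real_asymp)
  then obtain N0 where N0: "\<And>N. N \<ge> N0 \<Longrightarrow> sqrt (real N) - 1 \<ge> real N powr (1/4) \<and> sqrt (real N) - 1 \<ge> 2"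
    by (auto simp: eventually_sequentially)
  have "real (card (S1 \<inter> {1..N div d})) \<le> 2 * C * (real N / sqrt (ln (real N))) / real d"
    if N: "N \<ge> max N0 3" and d: "d \<ge> 1" "(real d)\<^sup>2 \<le> real N" for N d
  proof -
    define M where "M = N div d"
    have "real d \<le> sqrt (real N)" using d by (simp add: real_le_rsqrt)
    then have "sqrt (real N) * real d \<le> sqrt (real N) * sqrt (real N)" by (intro mult_left_mono) auto
    then have "sqrt (real N) \<le> real N / real d" using d by (simp add: field_simps)
    then have M: "real M \<ge> sqrt (real N) - 1" using real_div_le_Suc[of N d] unfolding M_def by linarith
    then have M2: "M \<ge> 2" "real M \<ge> real N powr (1/4)" using N0[of N] N by linarith+
    have lN: "ln (real N) > 0" using N by simp
    have "ln (real N powr (1/4)) \<le> ln (real M)" using M2 N by (subst ln_le_cancel_iff) auto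
    then have "ln (real N) / 4 \<le> ln (real M)" using N by (simp add: ln_powr)
    then have "sqrt (ln (real N) / 4) \<le> sqrt (ln (real M))" by simp
    then have sq: "sqrt (ln (real N)) / 2 \<le> sqrt (ln (real M))" by (simp add: real_sqrt_divide)
    have "real (card (S1 \<inter> {1..M})) \<le> C * real M / sqrt (ln (real M))" using C(2) M2(1) by blast
    also have "\<dots> \<le> C * (real N / real d) / (sqrt (ln (real N)) / 2)"
      using C(1) sq lN by (intro frac_le mult_left_mono) (auto simp: M_def of_nat_div_le_of_nat)
    also have "\<dots> = 2 * C * (real N / sqrt (ln (real N))) / real d" by (simp add: mult_ac)
    finally show ?thesis by (simp add: M_def)
  qed
  then show ?thesis using C(1) by (intro exI[of _ "2 * C"] conjI exI[of _ "max N0 3"]) auto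
qed

lemma arcs_card_le_powr:
  assumes "k \<in> S1" "real (Om k) \<le> T"
  shows "finite (arcs l k) \<and> real (card (arcs l k)) \<le> 2 * 8 ^ l * exp (real l * ln 2 * T)"
proof
  show "finite (arcs l k)" by (rule card_arcs(1)[OF assms(1)])
  have "real (card (arcs l k)) \<le> real (2 * 2 ^ l * (4 * 2 ^ Om k) ^ l)"
    unfolding of_nat_le_iff by (rule card_arcs(2)[OF assms(1)])
  also have "\<dots> = 2 * 8 ^ l * (2 ^ Om k) ^ l"
  proof -
    have "(2::real) ^ l * 4 ^ l = 8 ^ l" by (simp add: power_mult_distrib[symmetric])
    then show ?thesis by (simp add: power_mult_distrib mult.assoc[symmetric])
  qed
  also have "((2::real) ^ Om k) ^ l = exp (real l * ln 2 * real (Om k))"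
  proof -
    have "((2::real) ^ Om k) ^ l = 2 ^ (Om k * l)" by (rule power_mult[symmetric])
    also have "\<dots> = exp (real (Om k * l) * ln 2)" unfolding exp_of_nat_mult by simp
    also have "real (Om k * l) * ln 2 = real l * ln 2 * real (Om k)" by simp
    finally show ?thesis .
  qed
  also have "2 * 8 ^ l * exp (real l * ln 2 * real (Om k)) \<le> 2 * 8 ^ l * exp (real l * ln 2 * T)"
    using assms(2) by (simp add: mult_left_mono)
  finally show "real (card (arcs l k)) \<le> 2 * 8 ^ l * exp (real l * ln 2 * T)" .
qed

abbreviation smooth_part :: "real \<Rightarrow> nat \<Rightarrow> nat" where
  "smooth_part y \<equiv> part (\<lambda>q. real q \<le> y)"

lemma part_in_S1: "k \<in> S1 \<Longrightarrow> part P k \<in> S1"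
  using part_mult_compl[of k P] S1_mult_iff[of "part P k" "part (\<lambda>q. \<not> P q) k"] S1_pos[of k] by simp

text \<open>The centres come from the smooth part of k only, since the larger primes have been
  removed from the tuple as a common factor. The conditional discards atypical k, so that the number
  of centres is bounded uniformly; such k are accounted for by
  \<open>many_small_primes\<close>.\<close>

abbreviation medium_splits :: "nat \<Rightarrow> real \<Rightarrow> real \<Rightarrow> real \<Rightarrow> nat \<Rightarrow> nat set" where
  "medium_splits l A s D N \<equiv> {p * k | p k. k \<in> S1 \<and> exp (sqrt (ln (ln (real N)))) < real p \<and> real p \<le> ln (real N) powr A \<and> p * k \<le> N \<and>
    (\<exists>u\<in>(if real (Om (smooth_part (ln (real N) powr A) k)) \<le> ln (ln (real N)) powr (1/4) then arcs l (smooth_part (ln (real N) powr A) k) else {}).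
       p \<in> sector u (D * ln (real N) powr (-s)))}"

text \<open>There are O(ln ln N) dyadic ranges and exp(O((ln ln N)^(1/4))) centres. Relative to 2^j,
  the trivial bound contributes O(\<delta>) and the reciprocal square root of the lower end of the
  range, that is exp(-sqrt(ln ln N) / 2); both beat the two losses.\<close>

lemma small_medium_split:
  assumes l: "l \<ge> 2" and "A > 0" "s > 0" "D > 0"
  shows "small (\<lambda>N. real (card (medium_splits l A s D N)))" (is "small (\<lambda>N. real (card (?E N)))")
proof -
  obtain C N0 where C: "C > 0" "N0 \<ge> 3" "\<And>N d. N \<ge> N0 \<Longrightarrow> d \<ge> 1 \<Longrightarrow> (real d)\<^sup>2 \<le> real N \<Longrightarrow>
     real (card (S1 \<inter> {1..N div d})) \<le> C * (real N / sqrt (ln (real N))) / real d"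
    using S1_count_div by blast
  define a where "a = real l * ln 2"
  have a: "a > 0" using l by (simp add: a_def)
  let ?h = "\<lambda>N. (2 * A * ln (ln (real N)) + 1) * exp (a * ln (ln (real N)) powr (1/4)) * (24 * (D * ln (real N) powr (-s)) + 6 * exp (- (sqrt (ln (ln (real N))) / 2)))"
  show ?thesis
  proof (rule smallI[where h = ?h and C = "C * (2 * 8 ^ l)"])
    show "?h \<longlonglongrightarrow> 0" using a assms(2-4) by real_asymp
    have "eventually (\<lambda>N::nat. (ln (real N) powr A)\<^sup>2 \<le> real N) sequentially" using assms by real_asymp
    then show "eventually (\<lambda>N. 0 \<le> real (card (?E N)) \<and> real (card (?E N)) \<le> C * (2 * 8 ^ l) * (real N / sqrt (ln (real N))) * ?h N) sequentially"
      using eventually_ge_at_top[of N0]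
    proof (eventually_elim, intro conjI)
      case (elim N)
      define L where "L = ln (real N)"
      have N3: "N \<ge> 3" using elim C(2) by simp
      have L: "L \<ge> 1" unfolding L_def by (rule ln_nat_ge_1[OF N3])
      define T where "T = ln L powr (1/4)"
      define y where "y = exp (sqrt (ln L))"
      define \<delta> where "\<delta> = D * L powr (-s)"
      define B where "B = 2 * 8 ^ l * exp (a * T)"
      define U where "U k = (if real (Om (smooth_part (L powr A) k)) \<le> T then arcs l (smooth_part (L powr A) k) else {})" for k
      define Pj where "Pj j = 12 * \<delta> * 2 ^ (j + 1) + 3 * sqrt (2 ^ (j + 1))" for j :: nat
      define NL where "NL = real N / sqrt L"
      have \<delta>0: "\<delta> \<ge> 0" using assms by (simp add: \<delta>_def)
      have B0: "B \<ge> 0" by (simp add: B_def)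
      have NL0: "NL \<ge> 0" using L by (simp add: NL_def)
      have y'1: "L powr A \<ge> 1" using L assms by (intro ge_one_powr_ge_zero) auto
      have E: "?E N = {p * k | p k. k \<in> S1 \<and> y < real p \<and> real p \<le> L powr A \<and> p * k \<le> N \<and> (\<exists>u\<in>U k. p \<in> sector u \<delta>)}"
        unfolding y_def \<delta>_def U_def T_def L_def ..
      have "real (card (?E N)) \<le> (\<Sum>j\<in>dyadic y (L powr A). real (card (S1 \<inter> {1..N div 2 ^ j})) * (B * Pj j))"
        unfolding E
      proof (rule card_dyadic_products)
        fix k assume k: "k \<in> S1"
        show "finite (U k) \<and> real (card (U k)) \<le> B"
          using arcs_card_le_powr[OF part_in_S1[OF k], of "\<lambda>q. real q \<le> L powr A" T l] B0
          by (auto simp: U_def B_def a_def)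
      next
        fix j :: nat and u
        show "real (card (sector_upto u \<delta> (2 ^ (j + 1)))) \<le> Pj j"
          unfolding Pj_def by (rule sector_trivial[OF \<delta>0]) (rule one_le_power, simp)
      qed
      also have "\<dots> \<le> (\<Sum>j\<in>dyadic y (L powr A). C * NL * B * (24 * \<delta> + 6 * exp (- (sqrt (ln L) / 2))))"
      proof (rule sum_mono)
        fix j assume j: "j \<in> dyadic y (L powr A)"
        have j1: "y < 2 ^ (j + 1)" "2 ^ j \<le> L powr A" using j by (auto simp: dyadic_def)
        have "(2 ^ j)\<^sup>2 \<le> (L powr A)\<^sup>2" using j1(2) by (intro power_mono) auto
        also have "\<dots> \<le> real N" using elim by (simp add: L_def)
        finally have K: "real (card (S1 \<inter> {1..N div 2 ^ j})) \<le> C * NL / 2 ^ j"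
          using C(3)[of N "2 ^ j"] elim by (simp add: L_def NL_def)
        have "3 * sqrt (2 ^ (j + 1)) / 2 ^ j \<le> 6 * exp (- (sqrt (ln L) / 2))"
        proof -
          have r: "sqrt (2 ^ (j + 1)) * sqrt (2 ^ (j + 1)) = 2 * 2 ^ j" by simp
          have "exp (sqrt (ln L) / 2) = sqrt y"
            unfolding y_def by (rule real_sqrt_unique[symmetric]) (simp_all add: exp_double[symmetric])
          also have "\<dots> \<le> sqrt (2 ^ (j + 1))" using j1(1) by simp
          finally have e: "exp (sqrt (ln L) / 2) \<le> sqrt (2 ^ (j + 1))" .
          have "3 * x / 2 ^ j = 6 * (1 / x)" if "x * x = 2 * 2 ^ j" "x > 0" for x :: real
            using that by (simp add: field_simps)
          from this[OF r] have "3 * sqrt (2 ^ (j + 1)) / 2 ^ j = 6 * (1 / sqrt (2 ^ (j + 1)))" by simp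
          also have "\<dots> \<le> 6 * (1 / exp (sqrt (ln L) / 2))" using e by (intro mult_left_mono frac_le) auto
          finally show ?thesis by (simp add: exp_minus inverse_eq_divide)
        qed
        moreover have "Pj j / 2 ^ j = 24 * \<delta> + 3 * sqrt (2 ^ (j + 1)) / 2 ^ j"
          unfolding Pj_def by (simp add: add_divide_distrib)
        ultimately have Pb: "Pj j / 2 ^ j \<le> 24 * \<delta> + 6 * exp (- (sqrt (ln L) / 2))" by linarith
        have Pj0: "Pj j \<ge> 0" using \<delta>0 by (simp add: Pj_def)
        have "real (card (S1 \<inter> {1..N div 2 ^ j})) * (B * Pj j) \<le> C * NL / 2 ^ j * (B * Pj j)"
          using K B0 Pj0 by (intro mult_right_mono) auto
        also have "\<dots> = C * NL * B * (Pj j / 2 ^ j)" by simp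
        also have "\<dots> \<le> C * NL * B * (24 * \<delta> + 6 * exp (- (sqrt (ln L) / 2)))"
          using Pb C(1) NL0 B0 by (intro mult_left_mono) auto
        finally show "real (card (S1 \<inter> {1..N div 2 ^ j})) * (B * Pj j) \<le> C * NL * B * (24 * \<delta> + 6 * exp (- (sqrt (ln L) / 2)))" .
      qed
      also have "\<dots> = real (card (dyadic y (L powr A))) * (C * NL * B * (24 * \<delta> + 6 * exp (- (sqrt (ln L) / 2))))" by simp
      also have "\<dots> \<le> (2 * A * ln L + 1) * (C * NL * B * (24 * \<delta> + 6 * exp (- (sqrt (ln L) / 2))))"
        using card_dyadic[OF y'1, of y] C(1) NL0 B0 \<delta>0 L by (intro mult_right_mono) (auto simp: ln_powr)
      also have "\<dots> = C * (2 * 8 ^ l) * NL * ((2 * A * ln L + 1) * exp (a * T) * (24 * \<delta> + 6 * exp (- (sqrt (ln L) / 2))))"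
        by (simp add: B_def mult_ac)
      finally show "real (card (?E N)) \<le> C * (2 * 8 ^ l) * (real N / sqrt (ln (real N))) * ?h N"
        unfolding NL_def \<delta>_def T_def L_def .
    qed simp
  qed
qed

lemma sum_inverse_le: "n \<ge> 1 \<Longrightarrow> (\<Sum>i=1..n. 1 / real i) \<le> 1 + ln (real n)"
proof (induction n rule: dec_induct)
  case (step n)
  have n: "real n > 0" using step by simp
  have "ln (real n / real (Suc n)) \<le> real n / real (Suc n) - 1" using n by (intro ln_le_minus_one) auto
  also have "\<dots> = - (1 / real (Suc n))" by (simp add: field_simps)
  finally have "ln (real n) - ln (real (Suc n)) \<le> - (1 / real (Suc n))" using n by (simp add: ln_div)
  then show ?case using step by simp
qed simp

lemma small_add: "small f \<Longrightarrow> small g \<Longrightarrow> small (\<lambda>N. f N + g N)"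
  unfolding small_def by (drule (1) tendsto_add) (simp add: add_divide_distrib distrib_right)

lemma small_mono:
  assumes "small g" "eventually (\<lambda>N. 0 \<le> f N \<and> f N \<le> g N) sequentially"
  shows "small f"
  unfolding small_def
proof (rule tendsto_sandwich[OF _ _ tendsto_const])
  show "(\<lambda>N. g N * sqrt (ln (real N)) / real N) \<longlonglongrightarrow> 0" using assms(1) by (simp add: small_def)
  show "eventually (\<lambda>N. 0 \<le> f N * sqrt (ln (real N)) / real N) sequentially"
    using assms(2) eventually_gt_at_top[of 1] by eventually_elim simp
  show "eventually (\<lambda>N. f N * sqrt (ln (real N)) / real N \<le> g N * sqrt (ln (real N)) / real N) sequentially"
    using assms(2) eventually_gt_at_top[of 1] by eventually_elim (auto intro!: divide_right_mono mult_right_mono)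
qed

abbreviation large_splits :: "nat \<Rightarrow> real \<Rightarrow> real \<Rightarrow> real \<Rightarrow> nat \<Rightarrow> nat set" where
  "large_splits l \<eta> s D N \<equiv> {p * k | p k. k \<in> S1 \<and> ln (real N) powr (4 * s) < real p \<and> real p \<le> sqrt (real N) \<and> p * k \<le> N \<and>
    (\<exists>u\<in>(if real (Om k) \<le> (1/2 + \<eta>) * ln (ln (real N)) then arcs l k else {}).
       p \<in> sector u (D * ln (real N) powr (-s)))}"

text \<open>With L = ln N, a dyadic range contributes N / (2^j sqrt L) cofactors, L^a centres and
  L^(-s) 2^j j^(eta - 1) primes, up to constants. Summing over j costs L^eta and a logarithm, so the
  hypothesis \<open>ex\<close> is what makes the total exponent negative. The lower end L^(4 s) is
  where L^(-s) equals Y^(-1/4), the shortest arc that the sieve admits.\<close>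

lemma large_split_below_sqrt:
  assumes l: "l \<ge> 2" and \<eta>: "0 < \<eta>" "\<eta> < 1" and s: "s > 0" and D: "D \<ge> 1"
    and ex: "real l * ln 2 * (1/2 + \<eta>) + \<eta> < s"
  shows "small (\<lambda>N. real (card (large_splits l \<eta> s D N)))" (is "small (\<lambda>N. real (card (?E N)))")
proof -
  obtain C N0 where C: "C > 0" "N0 \<ge> 3" "\<And>N d. N \<ge> N0 \<Longrightarrow> d \<ge> 1 \<Longrightarrow> (real d)\<^sup>2 \<le> real N \<Longrightarrow>
     real (card (S1 \<inter> {1..N div d})) \<le> C * (real N / sqrt (ln (real N))) / real d"
    using S1_count_div by blast
  obtain C' Y0 where C': "C' > 0" "\<And>Y \<delta> u. Y \<ge> Y0 \<Longrightarrow> \<delta> \<ge> Y powr (-(1/4)) \<Longrightarrow>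
     real (card (sector_upto u \<delta> Y)) \<le> C' * \<delta> * Y * ln Y powr (\<eta> - 1)"
    using sector_sieve[OF \<eta>] by blast
  define a where "a = real l * ln 2 * (1/2 + \<eta>)"
  have aneg: "a - s + \<eta> < 0" using ex by (simp add: a_def)
  let ?h = "\<lambda>N. ln (real N) powr (a - s + \<eta>) * (1 + ln (ln (real N) + 1))"
  show ?thesis
  proof (rule smallI[where h = ?h and C = "C * (2 * 8 ^ l) * C' * D * 8"])
    show "?h \<longlonglongrightarrow> 0" using aneg by real_asymp
    have "eventually (\<lambda>N::nat. ln (real N) powr (4 * s) \<ge> Y0) sequentially" using s by real_asymp
    then show "eventually (\<lambda>N. 0 \<le> real (card (?E N)) \<and> real (card (?E N)) \<le> C * (2 * 8 ^ l) * C' * D * 8 * (real N / sqrt (ln (real N))) * ?h N) sequentially"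
      using eventually_ge_at_top[of N0]
    proof (eventually_elim, intro conjI)
      case (elim N)
      define L where "L = ln (real N)"
      have N3: "N \<ge> 3" using elim C(2) by simp
      have L: "L \<ge> 1" unfolding L_def by (rule ln_nat_ge_1[OF N3])
      define W where "W = (1/2 + \<eta>) * ln L"
      define \<delta> where "\<delta> = D * L powr (-s)"
      define B where "B = 2 * 8 ^ l * L powr a"
      define U where "U k = (if real (Om k) \<le> W then arcs l k else {})" for k
      define Pj where "Pj j = C' * \<delta> * 2 ^ (j + 1) * ln (2 ^ (j + 1)) powr (\<eta> - 1)" for j :: nat
      define NL where "NL = real N / sqrt L"
      let ?J = "dyadic (L powr (4 * s)) (sqrt (real N))"
      have \<delta>0: "\<delta> \<ge> 0" using D by (simp add: \<delta>_def)
      have B0: "B \<ge> 0" by (simp add: B_def)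
      have NL0: "NL \<ge> 0" using L by (simp add: NL_def)
      have expW: "exp (real l * ln 2 * W) = L powr a" using L by (simp add: powr_def W_def a_def)
      have E: "?E N = {p * k | p k. k \<in> S1 \<and> L powr (4 * s) < real p \<and> real p \<le> sqrt (real N) \<and> p * k \<le> N \<and> (\<exists>u\<in>U k. p \<in> sector u \<delta>)}"
        unfolding \<delta>_def U_def W_def L_def ..
      have "real (card (?E N)) \<le> (\<Sum>j\<in>?J. real (card (S1 \<inter> {1..N div 2 ^ j})) * (B * Pj j))"
        unfolding E
      proof (rule card_dyadic_products)
        fix k assume k: "k \<in> S1"
        show "finite (U k) \<and> real (card (U k)) \<le> B"
          using arcs_card_le_powr[OF k, of W l] B0 unfolding expW by (auto simp: U_def B_def)
      next
        fix j :: nat and u assume "j \<in> ?J"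
        then have j: "L powr (4 * s) < 2 ^ (j + 1)" by (simp add: dyadic_def)
        show "real (card (sector_upto u \<delta> (2 ^ (j + 1)))) \<le> Pj j"
          unfolding Pj_def
        proof (rule C'(2))
          show "Y0 \<le> 2 ^ (j + 1)" using j elim by (simp add: L_def)
          have "(2 ^ (j + 1)) powr (-(1/4)) \<le> (L powr (4 * s)) powr (-(1/4))"
            using j L by (intro powr_mono2') auto
          also have "\<dots> = 1 * L powr (-s)" by (simp add: powr_powr)
          also have "\<dots> \<le> \<delta>" unfolding \<delta>_def using D by (intro mult_right_mono) auto
          finally show "(2 ^ (j + 1)) powr (-(1/4)) \<le> \<delta>" .
        qed
      qed
      also have "\<dots> \<le> (\<Sum>j\<in>?J. C * NL * B * C' * \<delta> * 8 * L powr \<eta> * (1 / real (j + 1)))"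
      proof (rule sum_mono)
        fix j assume j: "j \<in> ?J"
        have j1: "2 ^ j \<le> sqrt (real N)" using j by (auto simp: dyadic_def)
        have "(2 ^ j)\<^sup>2 \<le> (sqrt (real N))\<^sup>2" using j1 by (intro power_mono) auto
        then have K: "real (card (S1 \<inter> {1..N div 2 ^ j})) \<le> C * NL / 2 ^ j"
          using C(3)[of N "2 ^ j"] elim by (simp add: L_def NL_def)
        have jL: "real j \<le> L" using dyadic_bound[OF j] N3 by (simp add: ln_sqrt L_def)
        \<comment> \<open>Trades the power eta of j + 1 for L^eta, using j <= L, so that a harmonic
          sum over j remains.\<close>
        have "ln (2 ^ (j + 1)) powr (\<eta> - 1) \<le> (real (j + 1) * (1/2)) powr (\<eta> - 1)"
        proof (rule powr_mono2')
          show "real (j + 1) * (1/2) \<le> ln (2 ^ (j + 1))"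
            unfolding ln_realpow using ln2_ge_two_thirds by (intro mult_left_mono) auto
        qed (use \<eta> in auto)
        also have "\<dots> = real (j + 1) powr (\<eta> - 1) * (1/2) powr (\<eta> - 1)" by (rule powr_mult)
        also have "\<dots> \<le> (2 * L powr \<eta> * (1 / real (j + 1))) * 2"
        proof (rule mult_mono)
          have "real (j + 1) powr (\<eta> - 1) = real (j + 1) powr \<eta> * (1 / real (j + 1))" by (simp add: powr_diff)
          also have "real (j + 1) powr \<eta> \<le> (2 * L) powr \<eta>" using jL L \<eta> by (intro powr_mono2) auto
          also have "\<dots> = 2 powr \<eta> * L powr \<eta>" using L by (simp add: powr_mult)
          also have "2 powr \<eta> \<le> (2::real) powr 1" using \<eta> by (intro powr_mono) auto
          finally show "real (j + 1) powr (\<eta> - 1) \<le> 2 * L powr \<eta> * (1 / real (j + 1))"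
            by (simp add: mult_right_mono divide_right_mono)
          have "(1/2::real) powr (\<eta> - 1) = 2 powr (1 - \<eta>)"
            by (simp add: powr_divide powr_minus_divide[symmetric])
          also have "\<dots> \<le> (2::real) powr 1" using \<eta> by (intro powr_mono) auto
          finally show "(1/2::real) powr (\<eta> - 1) \<le> 2" by simp
        qed auto
        finally have lnb: "ln (2 ^ (j + 1)) powr (\<eta> - 1) \<le> 4 * L powr \<eta> * (1 / real (j + 1))" by simp
        have Pj0: "Pj j \<ge> 0" using \<delta>0 C'(1) by (simp add: Pj_def)
        have "real (card (S1 \<inter> {1..N div 2 ^ j})) * (B * Pj j) \<le> C * NL / 2 ^ j * (B * Pj j)"
          using K B0 Pj0 by (intro mult_right_mono) auto
        also have "\<dots> = C * NL * B * C' * \<delta> * 2 * ln (2 ^ (j + 1)) powr (\<eta> - 1)" by (simp add: Pj_def)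
        also have "\<dots> \<le> C * NL * B * C' * \<delta> * 2 * (4 * L powr \<eta> * (1 / real (j + 1)))"
          using lnb C(1) C'(1) NL0 B0 \<delta>0 by (intro mult_left_mono) auto
        finally show "real (card (S1 \<inter> {1..N div 2 ^ j})) * (B * Pj j) \<le> C * NL * B * C' * \<delta> * 8 * L powr \<eta> * (1 / real (j + 1))"
          by (simp add: mult_ac)
      qed
      also have "\<dots> = C * NL * B * C' * \<delta> * 8 * L powr \<eta> * (\<Sum>j\<in>?J. 1 / real (j + 1))"
        by (simp add: sum_distrib_left)
      also have "\<dots> \<le> C * NL * B * C' * \<delta> * 8 * L powr \<eta> * (1 + ln (L + 1))"
      proof (rule mult_left_mono)
        define M where "M = nat \<lfloor>L\<rfloor> + 1"
        have M: "real M \<le> L + 1" "M \<ge> 1" using L by (auto simp: M_def)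
        have "(\<Sum>j\<in>?J. 1 / real (j + 1)) = (\<Sum>i\<in>Suc ` ?J. 1 / real i)"
          by (subst sum.reindex) auto
        also have "\<dots> \<le> (\<Sum>i=1..M. 1 / real i)"
        proof (rule sum_mono2)
          show "Suc ` ?J \<subseteq> {1..M}"
          proof
            fix i assume "i \<in> Suc ` ?J"
            then obtain j where j: "i = Suc j" "j \<in> ?J" by auto
            have "real j \<le> L" using dyadic_bound[OF j(2)] N3 by (simp add: ln_sqrt L_def)
            then show "i \<in> {1..M}" using j(1) by (auto simp: M_def le_nat_iff le_floor_iff)
          qed
        qed auto
        also have "\<dots> \<le> 1 + ln (real M)" by (rule sum_inverse_le[OF M(2)])
        also have "\<dots> \<le> 1 + ln (L + 1)" using M by simp
        finally show "(\<Sum>j\<in>?J. 1 / real (j + 1)) \<le> 1 + ln (L + 1)" .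
      qed (use C(1) C'(1) NL0 B0 \<delta>0 in auto)
      also have "\<dots> = C * (2 * 8 ^ l) * C' * D * 8 * NL * ((L powr a * L powr (-s) * L powr \<eta>) * (1 + ln (L + 1)))"
        by (simp add: B_def \<delta>_def mult_ac)
      also have "L powr a * L powr (-s) * L powr \<eta> = L powr (a - s + \<eta>)" by (simp add: powr_add[symmetric])
      finally show "real (card (?E N)) \<le> C * (2 * 8 ^ l) * C' * D * 8 * (real N / sqrt (ln (real N))) * ?h N"
        unfolding NL_def L_def .
    qed simp
  qed
qed

abbreviation huge_splits :: "nat \<Rightarrow> real \<Rightarrow> real \<Rightarrow> real \<Rightarrow> nat \<Rightarrow> nat set" where
  "huge_splits l \<eta> s D N \<equiv> {p * k | p k. k \<in> S1 \<and> sqrt (real N) < real p \<and> p * k \<le> N \<and>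
    (\<exists>u\<in>(if real (Om k) \<le> (1/2 + \<eta>) * ln (ln (real N)) then arcs l k else {}).
       p \<in> sector u (D * ln (real N) powr (-s)))}"

text \<open>For p > sqrt N the cofactor is below sqrt N, and \<open>S1_count_div\<close> is out of
  reach, so the order is reversed: k is fixed and p is sieved up to N / k >= sqrt N, where the sieve
  gains a full L^(eta - 1), L = ln N. The sum of 1 / k over \<open>S1\<close> gives sqrt L, and
  together they yield the required N / sqrt L.\<close>

lemma large_split_above_sqrt:
  assumes l: "l \<ge> 2" and \<eta>: "0 < \<eta>" "\<eta> < 1" and s: "s > 0" and D: "D \<ge> 1"
    and ex: "real l * ln 2 * (1/2 + \<eta>) + \<eta> < s"
  shows "small (\<lambda>N. real (card (huge_splits l \<eta> s D N)))" (is "small (\<lambda>N. real (card (?E N)))")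
proof -
  obtain C where C: "C > 0" "\<And>N. N \<ge> 2 \<Longrightarrow> (\<Sum>n\<in>S1 \<inter> {1..N}. 1 / real n) \<le> C * sqrt (ln (real N))"
    using S1_harmonic_upper by blast
  obtain C' Y0 where C': "C' > 0" "\<And>Y \<delta> u. Y \<ge> Y0 \<Longrightarrow> \<delta> \<ge> Y powr (-(1/4)) \<Longrightarrow>
     real (card (sector_upto u \<delta> Y)) \<le> C' * \<delta> * Y * ln Y powr (\<eta> - 1)"
    using sector_sieve[OF \<eta>] by blast
  define a where "a = real l * ln 2 * (1/2 + \<eta>)"
  have aneg: "a - s + \<eta> < 0" using ex by (simp add: a_def)
  let ?h = "\<lambda>N. ln (real N) powr (a - s + \<eta>)"
  show ?thesis
  proof (rule smallI[where h = ?h and C = "C * (2 * 8 ^ l) * C' * D * 2"])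
    show "?h \<longlonglongrightarrow> 0" using aneg by real_asymp
    have "eventually (\<lambda>N::nat. sqrt (real N) \<ge> Y0 \<and> sqrt (real N) powr (-(1/4)) \<le> ln (real N) powr (-s)) sequentially"
      using s by (intro eventually_conj; real_asymp)
    then show "eventually (\<lambda>N. 0 \<le> real (card (?E N)) \<and> real (card (?E N)) \<le> C * (2 * 8 ^ l) * C' * D * 2 * (real N / sqrt (ln (real N))) * ?h N) sequentially"
      using eventually_ge_at_top[of 3]
    proof (eventually_elim, intro conjI)
      case (elim N)
      define L where "L = ln (real N)"
      have N3: "N \<ge> 3" using elim by simp
      have L: "L \<ge> 1" unfolding L_def by (rule ln_nat_ge_1[OF N3])
      define W where "W = (1/2 + \<eta>) * ln L"
      define \<delta> where "\<delta> = D * L powr (-s)"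
      define B where "B = 2 * 8 ^ l * L powr a"
      define U where "U k = (if real (Om k) \<le> W then arcs l k else {})" for k
      define K where "K = {k\<in>S1 \<inter> {1..N}. real k \<le> sqrt (real N)}"
      define P where "P k = C' * \<delta> * (real N / real k) * (L / 2) powr (\<eta> - 1)" for k :: nat
      have \<delta>0: "\<delta> \<ge> 0" using D by (simp add: \<delta>_def)
      have B0: "B \<ge> 0" by (simp add: B_def)
      have expW: "exp (real l * ln 2 * W) = L powr a" using L by (simp add: powr_def W_def a_def)
      have sN: "sqrt (real N) > 0" "sqrt (real N) * sqrt (real N) = real N" using N3 by auto
      have "?E N \<subseteq> (sector_products K U \<delta> (\<lambda>k. real N / real k))"
      proof
        fix n assume "n \<in> ?E N"
        then obtain p k u where n: "n = p * k" "k \<in> S1" "sqrt (real N) < real p" "p * k \<le> N" "u \<in> U k" "p \<in> sector u \<delta>"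
          unfolding \<delta>_def U_def W_def L_def by blast
        have k0: "k \<ge> 1" using S1_pos[OF n(2)] by simp
        have pk: "real p * real k \<le> real N" using n(4) by (metis of_nat_le_iff of_nat_mult)
        have "sqrt (real N) * real k \<le> sqrt (real N) * sqrt (real N)"
          unfolding sN(2) using n(3) pk mult_right_mono[of "sqrt (real N)" "real p" "real k"] by simp
        then have "real k \<le> sqrt (real N)" using sN(1) by (rule mult_left_le_imp_le)
        moreover have "p \<ge> 1" using n(6) prime_ge_1_nat by (auto simp: sector_def)
        then have "k \<le> N" using n(4) mult_le_mono1[of 1 p k] by linarith
        ultimately have "k \<in> K" using k0 n(2) by (simp add: K_def)
        moreover have "real p \<le> real N / real k" using pk k0 by (simp add: field_simps)
        ultimately show "n \<in> (sector_products K U \<delta> (\<lambda>k. real N / real k))"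
          using n by blast
      qed
      moreover have prods: "finite (sector_products K U \<delta> (\<lambda>k. real N / real k))"
        "real (card (sector_products K U \<delta> (\<lambda>k. real N / real k))) \<le> (\<Sum>k\<in>K. B * P k)"
      proof -
        have 1: "finite K" by (simp add: K_def)
        have 2: "finite (U k) \<and> real (card (U k)) \<le> B" if "k \<in> K" for k
          using arcs_card_le_powr[of k W l] that B0 unfolding expW by (auto simp: U_def B_def K_def)
        have 3: "real (card (sector_upto u \<delta> (real N / real k))) \<le> P k" if k: "k \<in> K" for k u
        proof -
          have k1: "real k \<ge> 1" "real k \<le> sqrt (real N)" using k by (auto simp: K_def)
          have "sqrt (real N) * real k \<le> real N" using k1 sN mult_left_mono[OF k1(2), of "sqrt (real N)"] by simp
          then have Y: "sqrt (real N) \<le> real N / real k" using k1 by (simp add: field_simps)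
          have "real (card (sector_upto u \<delta> (real N / real k))) \<le> C' * \<delta> * (real N / real k) * ln (real N / real k) powr (\<eta> - 1)"
          proof (rule C'(2))
            show "Y0 \<le> real N / real k" using Y elim by simp
            have "(real N / real k) powr (-(1/4)) \<le> sqrt (real N) powr (-(1/4))"
              using Y sN by (intro powr_mono2') auto
            also have "\<dots> \<le> 1 * L powr (-s)" using elim by (simp add: L_def)
            also have "\<dots> \<le> \<delta>" unfolding \<delta>_def using D by (intro mult_right_mono) auto
            finally show "(real N / real k) powr (-(1/4)) \<le> \<delta>" .
          qed
          also have "\<dots> \<le> P k" unfolding P_def
          proof (intro mult_left_mono powr_mono2')
            have "ln (sqrt (real N)) \<le> ln (real N / real k)" using Y sN(1) by (subst ln_le_cancel_iff) linarith+
            then show "L / 2 \<le> ln (real N / real k)" using N3 by (simp add: ln_sqrt L_def)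
          qed (use \<eta> L C'(1) \<delta>0 in auto)
          finally show ?thesis .
        qed
        show "finite (sector_products K U \<delta> (\<lambda>k. real N / real k))"
          using card_sector_products(1)[OF 1 2 3] .
        show "real (card (sector_products K U \<delta> (\<lambda>k. real N / real k))) \<le> (\<Sum>k\<in>K. B * P k)"
          using card_sector_products(2)[OF 1 2 3] .
      qed
      ultimately have "real (card (?E N)) \<le> (\<Sum>k\<in>K. B * P k)"
        using card_mono[OF prods(1)] prods(2) by (meson of_nat_mono order_trans)
      also have "\<dots> = B * C' * \<delta> * real N * (L / 2) powr (\<eta> - 1) * (\<Sum>k\<in>K. 1 / real k)"
        unfolding P_def sum_distrib_left by (intro sum.cong) (auto simp: mult_ac)
      also have "\<dots> \<le> B * C' * \<delta> * real N * (2 * L powr (\<eta> - 1)) * (C * sqrt L)"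
      proof (intro mult_mono mult_left_mono)
        have "(L / 2) powr (\<eta> - 1) = L powr (\<eta> - 1) * 2 powr (1 - \<eta>)"
          using L by (simp add: powr_divide powr_diff)
        also have "\<dots> \<le> L powr (\<eta> - 1) * 2"
        proof (rule mult_left_mono)
          have "2 powr (1 - \<eta>) \<le> (2::real) powr 1" using \<eta> by (intro powr_mono) auto
          then show "2 powr (1 - \<eta>) \<le> (2::real)" by simp
        qed simp
        finally show "(L / 2) powr (\<eta> - 1) \<le> 2 * L powr (\<eta> - 1)" by simp
        have "(\<Sum>k\<in>K. 1 / real k) \<le> (\<Sum>n\<in>S1 \<inter> {1..N}. 1 / real n)" by (rule sum_mono2) (auto simp: K_def)
        also have "\<dots> \<le> C * sqrt L" using C(2)[of N] N3 by (simp add: L_def)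
        finally show "(\<Sum>k\<in>K. 1 / real k) \<le> C * sqrt L" .
      qed (use B0 C'(1) \<delta>0 in \<open>auto intro!: sum_nonneg\<close>)
      also have "\<dots> = C * (2 * 8 ^ l) * C' * D * 2 * (real N / sqrt L) * (L powr a * L powr (-s) * L powr \<eta>)"
      proof -
        have h: "L powr (\<eta> - 1) = L powr \<eta> / (sqrt L * sqrt L)" using L by (simp add: powr_diff)
        have "x / (r * r) * r = x * (1 / r)" if "r > 0" for r x :: real using that by (simp add: field_simps)
        then have e: "L powr (\<eta> - 1) * sqrt L = L powr \<eta> * (1 / sqrt L)" unfolding h using L by (meson less_le_trans real_sqrt_gt_zero zero_less_one)
        have "B * C' * \<delta> * real N * (2 * L powr (\<eta> - 1)) * (C * sqrt L) = B * C' * \<delta> * real N * 2 * C * (L powr (\<eta> - 1) * sqrt L)"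
          by (simp only: mult_ac)
        then show ?thesis unfolding e B_def \<delta>_def by (simp add: mult_ac)
      qed
      also have "L powr a * L powr (-s) * L powr \<eta> = L powr (a - s + \<eta>)" by (simp add: powr_add[symmetric])
      finally show "real (card (?E N)) \<le> C * (2 * 8 ^ l) * C' * D * 2 * (real N / sqrt (ln (real N))) * ?h N"
        unfolding L_def .
    qed simp
  qed
qed

section \<open>Density of the bad integers\<close>

lemma part_prime_mult:
  assumes "prime p" "P p" "k > 0"
  shows "part P (p * k) = p * part P k"
  using assms by (simp add: part_def prime_factorization_mult prime_factorization_prime prime_gt_0_nat)

text \<open>The hypotheses on the tuple are homogeneous: removing a common Gaussian factor of norm Q
  divides all subsums and the bounds by sqrt Q. So \<open>split_or_common_factor\<close> applies
  first to the primes above y2, then to the quotient tuple and the primes in (y1, y2], with the same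
  d0 and d1. In the second case the cofactor is the smooth part of k because the quotient tuple has
  norm \<open>smooth_part y2 n\<close>.\<close>

lemma split_dichotomy:
  assumes n: "n \<in> S1" and z: "\<And>i. i < l \<Longrightarrow> z i \<in> G n" and y: "y1 \<le> y2"
    and nz: "(\<Sum>i<l. z i) \<noteq> 0" and small: "cmod (\<Sum>i<l. z i) \<le> sqrt (real n) * d0" and d1: "d1 > 0"
    and big: "\<And>I. I \<subseteq> {..<l} \<Longrightarrow> I \<noteq> {} \<Longrightarrow> I \<noteq> {..<l} \<Longrightarrow>
       sqrt (real n) * d1 \<le> cmod (\<Sum>i\<in>I. z i) \<or> sqrt (real n) * d1 \<le> cmod (\<Sum>i\<in>{..<l} - I. z i)"
  shows "(\<exists>p k. n = p * k \<and> k \<in> S1 \<and> y2 < real p \<and> (\<exists>u\<in>arcs l k. p \<in> sector u (d0 / d1))) \<or>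
    (\<exists>p k. n = p * k \<and> k \<in> S1 \<and> y1 < real p \<and> real p \<le> y2 \<and> (\<exists>u\<in>arcs l (smooth_part y2 k). p \<in> sector u (d0 / d1))) \<or>
    1 \<le> sqrt (real (smooth_part y1 (smooth_part y2 n))) * d0"
proof -
  have n0: "n > 0" using n by (rule S1_pos)
  have S1p: "p mod 4 = 1" if "prime p" "p dvd n" for p using n that by (simp add: S1_def)
  define Q k0 where "Q = part (\<lambda>q. \<not> real q \<le> y2) n" and "k0 = smooth_part y2 n"
  have nQ: "n = Q * k0" using part_mult_compl[OF n0, of "\<lambda>q. real q \<le> y2"] by (simp add: Q_def k0_def mult.commute)
  have Q0: "Q > 0" "k0 > 0" by (simp_all add: Q_def k0_def part_pos)
  have Qp: "y2 < real p" "p dvd n" if "prime p" "p dvd Q" for p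
    using prime_dvd_part[OF that(1), of "\<lambda>q. \<not> real q \<le> y2" n] that(2) by (auto simp: Q_def)
  from split_or_common_factor[of Q l z k0]
  have "(\<exists>p. prime p \<and> p dvd Q \<and> psplit l z n p) \<or> (\<exists>g\<in>G Q. \<exists>w. \<forall>i<l. w i \<in> G k0 \<and> z i = g * w i)"
    unfolding nQ[symmetric] using Q0 Qp S1p z by blast
  then show ?thesis
  proof
    assume "\<exists>p. prime p \<and> p dvd Q \<and> psplit l z n p"
    then obtain p where p: "prime p" "p dvd Q" "psplit l z n p" by blast
    obtain k where k: "n = p * k" using Qp(2)[OF p(1,2)] by (auto elim: dvdE)
    have kS: "k \<in> S1" using n unfolding k S1_mult_iff by simp
    have "\<exists>u\<in>arcs l k. p \<in> sector u (d0 / d1)"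
      by (rule split_sector[OF p(1) S1p[OF p(1) Qp(2)[OF p(1,2)]] k S1_pos[OF kS] p(3) small d1 big])
    then show ?thesis using k kS Qp(1)[OF p(1,2)] by blast
  next
    assume "\<exists>g\<in>G Q. \<exists>w. \<forall>i<l. w i \<in> G k0 \<and> z i = g * w i"
    then obtain g w where g: "g \<in> G Q" and w: "\<And>i. i < l \<Longrightarrow> w i \<in> G k0" "\<And>i. i < l \<Longrightarrow> z i = g * w i" by blast
    have gm: "cmod g = sqrt (real Q)" using g by (rule cmod_G)
    have sQ: "sqrt (real Q) > 0" using Q0 by simp
    have sn: "sqrt (real n) = sqrt (real Q) * sqrt (real k0)" unfolding nQ by (simp add: real_sqrt_mult)
    have zw: "(\<Sum>i\<in>I. z i) = g * (\<Sum>i\<in>I. w i)" if "I \<subseteq> {..<l}" for I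
      unfolding sum_distrib_left using that w(2) by (intro sum.cong) auto
    have cz: "cmod (\<Sum>i\<in>I. z i) = sqrt (real Q) * cmod (\<Sum>i\<in>I. w i)" if "I \<subseteq> {..<l}" for I
      unfolding zw[OF that] norm_mult gm ..
    have small': "cmod (\<Sum>i<l. w i) \<le> sqrt (real k0) * d0"
      using small sQ unfolding cz[OF order_refl] sn mult.assoc by simp
    have big': "sqrt (real k0) * d1 \<le> cmod (\<Sum>i\<in>I. w i) \<or> sqrt (real k0) * d1 \<le> cmod (\<Sum>i\<in>{..<l} - I. w i)"
      if I: "I \<subseteq> {..<l}" "I \<noteq> {}" "I \<noteq> {..<l}" for I
      using big[OF I] sQ unfolding cz[OF I(1)] cz[OF Diff_subset] sn mult.assoc by simp
    define Q' k1 where "Q' = part (\<lambda>q. \<not> real q \<le> y1) k0" and "k1 = smooth_part y1 k0"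
    have kQ: "k0 = Q' * k1" using part_mult_compl[OF Q0(2), of "\<lambda>q. real q \<le> y1"] by (simp add: Q'_def k1_def mult.commute)
    have Q'0: "Q' > 0" "k1 > 0" by (simp_all add: Q'_def k1_def part_pos)
    have Q'p: "y1 < real p" "p dvd k0" "real p \<le> y2" "p dvd n" if "prime p" "p dvd Q'" for p
    proof -
      show 1: "y1 < real p" "p dvd k0"
        using prime_dvd_part[OF that(1), of "\<lambda>q. \<not> real q \<le> y1" k0] that(2) by (auto simp: Q'_def)
      show "real p \<le> y2" "p dvd n"
        using prime_dvd_part[OF that(1), of "\<lambda>q. real q \<le> y2" n] 1(2) by (auto simp: k0_def)
    qed
    from split_or_common_factor[of Q' l w k1]
    have "(\<exists>p. prime p \<and> p dvd Q' \<and> psplit l w k0 p) \<or> (\<exists>g\<in>G Q'. \<exists>v. \<forall>i<l. v i \<in> G k1 \<and> w i = g * v i)"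
      unfolding kQ[symmetric] using Q'0 Q'p(4) S1p w(1) by blast
    then show ?thesis
    proof
      assume "\<exists>p. prime p \<and> p dvd Q' \<and> psplit l w k0 p"
      then obtain p where p: "prime p" "p dvd Q'" "psplit l w k0 p" by blast
      obtain k where k: "n = p * k" using Q'p(4)[OF p(1,2)] by (auto elim: dvdE)
      have kS: "k \<in> S1" using n unfolding k S1_mult_iff by simp
      have k0k: "k0 = p * smooth_part y2 k"
        unfolding k0_def k by (rule part_prime_mult[of p "\<lambda>q. real q \<le> y2" k, OF p(1) Q'p(3)[OF p(1,2)] S1_pos[OF kS]])
      have "\<exists>u\<in>arcs l (smooth_part y2 k). p \<in> sector u (d0 / d1)"
        by (rule split_sector[OF p(1) S1p[OF p(1) Q'p(4)[OF p(1,2)]] k0k part_pos p(3) small' d1 big'])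
      then show ?thesis using k kS Q'p(1,3)[OF p(1,2)] by blast
    next
      assume "\<exists>g\<in>G Q'. \<exists>v. \<forall>i<l. v i \<in> G k1 \<and> w i = g * v i"
      then obtain h v where h: "h \<in> G Q'" and v: "\<And>i. i < l \<Longrightarrow> v i \<in> G k1" "\<And>i. i < l \<Longrightarrow> w i = h * v i" by blast
      have sQ': "sqrt (real Q') > 0" using Q'0 by simp
      have wv: "(\<Sum>i<l. w i) = h * (\<Sum>i<l. v i)" unfolding sum_distrib_left using v(2) by (intro sum.cong) auto
      have "(\<Sum>i<l. v i) \<noteq> 0" using nz unfolding zw[OF order_refl] wv by auto
      moreover have "(\<Sum>i<l. v i) \<in> gint" using v(1) by (intro gint_sum) (auto simp: G_def)
      ultimately have "1 \<le> cmod (\<Sum>i<l. v i)" by (intro gint_norm_ge_1)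
      also have "cmod (\<Sum>i<l. v i) \<le> sqrt (real k1) * d0"
        using small' sQ' unfolding wv norm_mult cmod_G[OF h] kQ of_nat_mult real_sqrt_mult mult.assoc by simp
      finally show ?thesis by (simp add: k1_def k0_def)
    qed
  qed
qed

lemma smooth_part_le_power:
  assumes "y \<ge> 1"
  shows "real (smooth_part y n) \<le> y ^ Om n"
proof -
  have "real (prod_mset (filter_mset (\<lambda>q. real q \<le> y) M)) \<le> y ^ size M" for M
  proof (induction M)
    case (add q M)
    show ?case
    proof (cases "real q \<le> y")
      case True
      then show ?thesis using add assms by (simp add: mult_mono)
    next
      case False
      have "y ^ size M \<le> y * y ^ size M" using assms by (simp add: mult_le_cancel_right1)
      then show ?thesis using add False by simp
    qed
  qed simp
  then show ?thesis by (simp add: part_def)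
qed

text \<open>The dummy value 0 at l = 1 makes the recursion valid at 2 and 3 too. It is also the
  right value there: a single entry has modulus exactly sqrt n, without logarithmic loss.\<close>

lemma c_exp_step:
  assumes "l \<ge> 2"
  shows "c_exp \<epsilon> l = real l * ln 2 * (1/2) + \<epsilon> + c_exp \<epsilon> (l div 2)"
proof -
  consider "l = 2" | "l = 3" | "l \<ge> 4" using assms by linarith
  then show ?thesis
  proof cases
    case 1
    then show ?thesis by (simp add: c_exp.simps[of _ 2] c_exp.simps[of _ "Suc 0"])
  next
    case 2
    then show ?thesis by (simp add: c_exp.simps[of _ 3] c_exp.simps[of _ "Suc 0"])
  next
    case 3
    then show ?thesis by (subst c_exp.simps) simp
  qed
qed

lemma c_exp_nonneg: "\<epsilon> > 0 \<Longrightarrow> c_exp \<epsilon> l \<ge> 0"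
proof (induction l rule: less_induct)
  case (less l)
  show ?case
  proof (cases "l < 2")
    case False
    then have "c_exp \<epsilon> (l div 2) \<ge> 0" using less by simp
    then show ?thesis using False less.prems by (simp add: c_exp_step)
  qed (simp add: c_exp.simps)
qed

lemma c_exp_mono: "\<epsilon> > 0 \<Longrightarrow> j \<le> l \<Longrightarrow> c_exp \<epsilon> j \<le> c_exp \<epsilon> l"
proof (induction l arbitrary: j rule: less_induct)
  case (less l)
  show ?case
  proof (cases "j < 2")
    case True
    then show ?thesis using c_exp_nonneg[OF less.prems(1), of l] by (simp add: c_exp.simps[of _ j])
  next
    case False
    then have l: "l \<ge> 2" using less.prems by simp
    have "c_exp \<epsilon> (j div 2) \<le> c_exp \<epsilon> (l div 2)"
      using l less.prems by (intro less.IH) (auto simp: div_le_mono)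
    moreover have "real j * ln 2 * (1/2) \<le> real l * ln 2 * (1/2)"
      using less.prems by (intro mult_right_mono) auto
    moreover have "j \<ge> 2" using False by simp
    ultimately show ?thesis unfolding c_exp_step[OF l] c_exp_step[OF \<open>j \<ge> 2\<close>] by linarith
  qed
qed

definition bad :: "real \<Rightarrow> nat \<Rightarrow> nat set" where
  "bad \<epsilon> l = {n\<in>S1. \<exists>z. (\<forall>i<l. z i \<in> G n) \<and> 0 < cmod (\<Sum>i<l. z i) \<and>
     cmod (\<Sum>i<l. z i) \<le> sqrt (real n) / ln (real n) powr c_exp \<epsilon> l}"

lemma subsum_bad:
  fixes l :: nat
  assumes "n \<in> S1" "\<And>i. i < l \<Longrightarrow> z i \<in> G n" "I \<subseteq> {..<l}" "n \<notin> bad \<epsilon> (card I)" "(\<Sum>i\<in>I. z i) \<noteq> 0"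
  shows "sqrt (real n) / ln (real n) powr c_exp \<epsilon> (card I) < cmod (\<Sum>i\<in>I. z i)"
proof (rule ccontr)
  assume "\<not> ?thesis"
  then have le: "cmod (\<Sum>i\<in>I. z i) \<le> sqrt (real n) / ln (real n) powr c_exp \<epsilon> (card I)" by (simp only: not_less)
  have "finite I" using assms(3) by (rule finite_subset) simp
  then obtain h where h: "bij_betw h {..<card I} I"
    using ex_bij_betw_nat_finite[of I] by (auto simp: atLeast0LessThan)
  have s: "(\<Sum>i<card I. z (h i)) = (\<Sum>i\<in>I. z i)" using h by (rule sum.reindex_bij_betw)
  have "\<forall>i<card I. z (h i) \<in> G n" using h assms(2,3) by (auto simp: bij_betw_def)
  then have "n \<in> bad \<epsilon> (card I)"
    unfolding bad_def using le assms(1,5) s by (intro CollectI conjI exI[of _ "\<lambda>i. z (h i)"]) auto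
  then show False using assms(4) by simp
qed

text \<open>One of I and its complement has at most l div 2 elements, and its sum is large because n
  is not bad for that number of terms, or because it is a single entry of modulus sqrt n. It remains
  to exclude that a proper subsum vanishes: the complementary subsum would then equal the total, a
  nonzero short sum of fewer than l terms, which is impossible because \<open>c_exp\<close>
  increases with l.\<close>

lemma proper_subsums_large:
  assumes \<epsilon>: "\<epsilon> > 0" and l: "l \<ge> 2" and n: "n \<in> S1" "ln (real n) > 1" and z: "\<And>i. i < l \<Longrightarrow> z i \<in> G n"
    and good: "\<And>j. 2 \<le> j \<Longrightarrow> j < l \<Longrightarrow> n \<notin> bad \<epsilon> j"
    and tot: "0 < cmod (\<Sum>i<l. z i)" "cmod (\<Sum>i<l. z i) \<le> sqrt (real n) / ln (real n) powr c_exp \<epsilon> l"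
    and I: "I \<subseteq> {..<l}" "I \<noteq> {}" "I \<noteq> {..<l}"
  shows "sqrt (real n) / ln (real n) powr c_exp \<epsilon> (l div 2) \<le> cmod (\<Sum>i\<in>I. z i) \<or>
    sqrt (real n) / ln (real n) powr c_exp \<epsilon> (l div 2) \<le> cmod (\<Sum>i\<in>{..<l} - I. z i)"
proof -
  let ?K = "\<lambda>j. sqrt (real n) / ln (real n) powr c_exp \<epsilon> j"
  have n0: "sqrt (real n) > 0" using S1_pos[OF n(1)] by simp
  have Kmono: "?K l' \<le> ?K j" if "j \<le> l'" for j l'
    using n(2) n0 c_exp_mono[OF \<epsilon> that] by (intro frac_le powr_mono) auto
  have Kl: "?K l < sqrt (real n)"
  proof -
    have "c_exp \<epsilon> l > 0" using c_exp_step[OF l, of \<epsilon>] c_exp_nonneg[OF \<epsilon>, of "l div 2"] \<epsilon> by (simp add: add_nonneg_pos add_pos_nonneg)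
    then have "1 < ln (real n) powr c_exp \<epsilon> l" using n(2) by (simp add: gr_one_powr)
    then show ?thesis using n0 by (simp add: divide_less_eq)
  qed
  have one: "cmod (\<Sum>i\<in>J. z i) = sqrt (real n)" if J: "card J = 1" "J \<subseteq> {..<l}" for J
  proof -
    obtain a where "J = {a}" using J(1) by (rule card_1_singletonE)
    then show ?thesis using cmod_G[OF z[of a]] J(2) by auto
  qed
  have fin: "finite J" if "J \<subseteq> {..<l}" for J using that by (rule finite_subset) simp
  have split: "(\<Sum>i<l. z i) = (\<Sum>i\<in>J. z i) + (\<Sum>i\<in>{..<l} - J. z i)" if "J \<subseteq> {..<l}" for J
    using sum.subset_diff[OF that, of z] by (simp add: add.commute)
  have cardlt: "card J < l" if "J \<subseteq> {..<l}" "J \<noteq> {..<l}" for J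
    using psubset_card_mono[of "{..<l}" J] that by (simp add: psubset_eq)
  have nonzero: "(\<Sum>i\<in>J. z i) \<noteq> 0" if J: "J \<subseteq> {..<l}" "J \<noteq> {}" "J \<noteq> {..<l}" for J
  proof
    assume 0: "(\<Sum>i\<in>J. z i) = 0"
    define J' where "J' = {..<l} - J"
    have J': "J' \<subseteq> {..<l}" "J' \<noteq> {}" "J' \<noteq> {..<l}" using J by (auto simp: J'_def)
    have eq: "(\<Sum>i<l. z i) = (\<Sum>i\<in>J'. z i)" using split[OF J(1)] 0 by (simp add: J'_def)
    have cl: "card J' < l" using J'(1,3) by (rule cardlt)
    have c0: "card J' > 0" using J' fin[OF J'(1)] by (simp add: card_gt_0_iff)
    show False
    proof (cases "card J' = 1")
      case True
      then show False using one[OF True J'(1)] tot(2) Kl eq by simp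
    next
      case False
      have "n \<notin> bad \<epsilon> (card J')" using False c0 cl by (intro good) auto
      moreover have "(\<Sum>i\<in>J'. z i) \<noteq> 0" using tot(1) eq by auto
      ultimately have "?K (card J') < cmod (\<Sum>i\<in>J'. z i)" using z by (intro subsum_bad[OF n(1) _ J'(1)]) auto
      also have "\<dots> \<le> ?K l" using tot(2) eq by simp
      also have "\<dots> \<le> ?K (card J')" using cl by (intro Kmono) simp
      finally show False by simp
    qed
  qed
  have half: "?K (l div 2) \<le> cmod (\<Sum>i\<in>J. z i)" if J: "J \<subseteq> {..<l}" "J \<noteq> {}" "J \<noteq> {..<l}" "card J \<le> l div 2" for J
  proof -
    have c0: "card J > 0" using J fin[OF J(1)] by (simp add: card_gt_0_iff)
    have cl: "card J < l" using J(1,3) by (rule cardlt)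
    show ?thesis
    proof (cases "card J = 1")
      case True
      have "1 \<le> ln (real n) powr c_exp \<epsilon> (l div 2)" using n(2) c_exp_nonneg[OF \<epsilon>] by (intro ge_one_powr_ge_zero) auto
      then have "?K (l div 2) \<le> sqrt (real n)" using n0 by (simp add: divide_le_eq)
      then show ?thesis using one[OF True J(1)] by simp
    next
      case False
      have "n \<notin> bad \<epsilon> (card J)" using False c0 cl by (intro good) auto
      then have "?K (card J) < cmod (\<Sum>i\<in>J. z i)" using z nonzero[OF J(1-3)] by (intro subsum_bad[OF n(1) _ J(1)]) auto
      moreover have "?K (l div 2) \<le> ?K (card J)" using J(4) by (rule Kmono)
      ultimately show ?thesis by linarith
    qed
  qed
  show ?thesis
  proof (cases "card I \<le> l div 2")
    case True
    then show ?thesis using half[OF I] by blast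
  next
    case False
    have "card ({..<l} - I) = l - card I" using I(1) fin[OF I(1)] by (simp add: card_Diff_subset)
    then have "card ({..<l} - I) \<le> l div 2" using False by linarith
    then show ?thesis using half[of "{..<l} - I"] I by auto
  qed
qed

lemma small_sum: "finite J \<Longrightarrow> (\<And>j. j \<in> J \<Longrightarrow> small (f j)) \<Longrightarrow> small (\<lambda>N. \<Sum>j\<in>J. f j N)"
proof (induction J rule: finite_induct)
  case empty
  then show ?case by (simp add: small_def)
next
  case (insert j J)
  then show ?case using small_add[of "f j" "\<lambda>N. \<Sum>j\<in>J. f j N"] by simp
qed

text \<open>Strong induction on l. Integers that are bad for some smaller j, that are at most sqrt
  N, or that have too many prime factors are discarded; for the others
  \<open>split_dichotomy\<close> leads to one of three small sets of splits or to a
  contradiction.\<close>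

lemma bad_small:
  assumes \<epsilon>: "\<epsilon> > 0"
  shows "l \<ge> 2 \<Longrightarrow> small (\<lambda>N. real (card (bad \<epsilon> l \<inter> {1..N})))"
proof (induction l rule: less_induct)
  case (less l)
  note l = less.prems
  define c c' where "c = c_exp \<epsilon> l" and "c' = c_exp \<epsilon> (l div 2)"
  define s where "s = c - c'"
  have s: "s = real l * ln 2 * (1/2) + \<epsilon>" using c_exp_step[OF l, of \<epsilon>] by (simp add: s_def c_def c'_def)
  have s0: "s > 0" using \<epsilon> unfolding s by (simp add: add_nonneg_pos)
  have c'0: "c' \<ge> 0" using \<epsilon> by (simp add: c'_def c_exp_nonneg)
  have c0: "c > 0" using s0 c'0 by (simp add: s_def)
  \<comment> \<open>For n > sqrt N we have ln n >= ln N / 2, so replacing ln n by ln N in the bound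
    for the total costs the factor 2^c.\<close>
  define D :: real where "D = 2 powr c"
  have D1: "D \<ge> 1" using c0 by (simp add: D_def ge_one_powr_ge_zero)
  \<comment> \<open>Then (ln N)^(-s) is the power -1/4 of (ln N)^A, the limit of what
    \<open>sector_sieve\<close> allows.\<close>
  define A where "A = 4 * s"
  have A0: "A > 0" using s0 by (simp add: A_def)
  \<comment> \<open>Chosen so that (l ln 2 + 1) eta <= eps / 2, which leaves the exponent in
    \<open>ex\<close> strictly below s; \<open>typical_Omega\<close> requires eta <= 1/2.\<close>
  define \<eta> where "\<eta> = min (1/2) (\<epsilon> / (2 * (real l + 1)))"
  have "0 < \<epsilon> / (2 * (real l + 1))" using \<epsilon> by simp
  then have \<eta>: "0 < \<eta>" "\<eta> \<le> 1/2" unfolding \<eta>_def by linarith+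
  have ex: "real l * ln 2 * (1/2 + \<eta>) + \<eta> < s"
  proof -
    have "real l * ln 2 * \<eta> \<le> real l * 1 * \<eta>" using \<eta> ln2_le_25_over_36 by (intro mult_right_mono mult_left_mono) auto
    moreover have "real l * 1 * \<eta> + \<eta> \<le> \<epsilon> / 2"
    proof -
      have t: "t * (\<epsilon> / (2 * t)) = \<epsilon> / 2" if "t > 0" for t using that by simp
      have "real l * 1 * \<eta> + \<eta> = (real l + 1) * \<eta>" by (simp add: distrib_right)
      also have "\<dots> \<le> (real l + 1) * (\<epsilon> / (2 * (real l + 1)))" by (intro mult_left_mono) (auto simp: \<eta>_def)
      also have "\<dots> = \<epsilon> / 2" by (rule t) simp
      finally show ?thesis .
    qed
    ultimately have "real l * ln 2 * \<eta> + \<eta> \<le> \<epsilon> / 2" by linarith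
    then show ?thesis unfolding s using \<epsilon> by (simp add: distrib_left)
  qed
  define T1 where "T1 N = (many_primes \<eta> N)" for N
  define T2 where "T2 N = (many_small_primes A N)" for N
  define R2 where "R2 N = medium_splits l A s D N" for N
  define R3 where "R3 N = large_splits l \<eta> s D N" for N
  define R4 where "R4 N = huge_splits l \<eta> s D N" for N
  \<comment> \<open>The summand sqrt N accounts for the n <= sqrt N, where ln n is not comparable
    with ln N.\<close>
  define F where "F N = sqrt (real N) + (\<Sum>j\<in>{2..<l}. real (card (bad \<epsilon> j \<inter> {1..N}))) + real (card (T1 N)) + real (card (T2 N)) +
     real (card (R2 N)) + real (card (R3 N)) + real (card (R4 N))" for N
  have "small F"
    unfolding F_def
  proof (intro small_add small_sum)
    show "small (\<lambda>N. sqrt (real N))" unfolding small_def by real_asymp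
    show "small (\<lambda>N. real (card (bad \<epsilon> j \<inter> {1..N})))" if "j \<in> {2..<l}" for j
      using that by (intro less.IH) auto
    show "small (\<lambda>N. real (card (T1 N)))" unfolding T1_def by (rule typical_Omega[OF \<eta>])
    show "small (\<lambda>N. real (card (T2 N)))" unfolding T2_def by (rule typical_smooth_Omega[OF A0])
    show "small (\<lambda>N. real (card (R2 N)))" unfolding R2_def using l A0 s0 D1 by (intro small_medium_split) auto
    show "small (\<lambda>N. real (card (R3 N)))" unfolding R3_def using l \<eta> s0 D1 ex by (intro large_split_below_sqrt) auto
    show "small (\<lambda>N. real (card (R4 N)))" unfolding R4_def using l \<eta> s0 D1 ex by (intro large_split_above_sqrt) auto
  qed simp
  then show ?case
  proof (rule small_mono)
    have "eventually (\<lambda>N::nat. exp (sqrt (ln (ln (real N)))) \<le> ln (real N) powr A \<and> ln (real N) > 2 \<and>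
       exp (ln (ln (real N)) powr (3/4) / 2) * (D * ln (real N) powr (-c)) < 1) sequentially"
      using A0 c0 D1 by (intro eventually_conj; real_asymp)
    then show "eventually (\<lambda>N. 0 \<le> real (card (bad \<epsilon> l \<inter> {1..N})) \<and> real (card (bad \<epsilon> l \<inter> {1..N})) \<le> F N) sequentially"
    proof (eventually_elim, intro conjI)
      case (elim N)
      define L where "L = ln (real N)"
      define y1 y2 T where "y1 = exp (sqrt (ln L))" and "y2 = L powr A" and "T = ln L powr (1/4)"
      have L2: "L > 2" and y12: "y1 \<le> y2" and e3: "exp (ln L powr (3/4) / 2) * (D * L powr (-c)) < 1"
        using elim by (auto simp: L_def y1_def y2_def)
      define W where "W = {n \<in> {1..N}. real n \<le> sqrt (real N)}"
      have sub: "bad \<epsilon> l \<inter> {1..N} \<subseteq> W \<union> (\<Union>j\<in>{2..<l}. bad \<epsilon> j \<inter> {1..N}) \<union> T1 N \<union> T2 N \<union> R2 N \<union> R3 N \<union> R4 N"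
      proof
        fix n assume nb: "n \<in> bad \<epsilon> l \<inter> {1..N}"
        show "n \<in> W \<union> (\<Union>j\<in>{2..<l}. bad \<epsilon> j \<inter> {1..N}) \<union> T1 N \<union> T2 N \<union> R2 N \<union> R3 N \<union> R4 N"
        proof (rule ccontr)
          assume not: "n \<notin> W \<union> (\<Union>j\<in>{2..<l}. bad \<epsilon> j \<inter> {1..N}) \<union> T1 N \<union> T2 N \<union> R2 N \<union> R3 N \<union> R4 N"
          have nS: "n \<in> S1" and nN: "n \<in> {1..N}" using nb by (auto simp: bad_def)
          obtain z where z: "\<And>i. i < l \<Longrightarrow> z i \<in> G n" "0 < cmod (\<Sum>i<l. z i)"
            "cmod (\<Sum>i<l. z i) \<le> sqrt (real n) / ln (real n) powr c_exp \<epsilon> l"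
            using nb unfolding bad_def by blast
          have big_n: "sqrt (real N) < real n" using not nN by (auto simp: W_def)
          have N0: "real N > 0" using nN by simp
          have lnn: "L / 2 \<le> ln (real n)"
          proof -
            have "ln (sqrt (real N)) \<le> ln (real n)" using big_n N0 nN by (subst ln_le_cancel_iff) auto
            then show ?thesis using N0 by (simp add: ln_sqrt L_def)
          qed
          have lnn': "ln (real n) \<le> L" using nN by (simp add: L_def)
          have lnn1: "ln (real n) > 1" using lnn L2 by linarith
          \<comment> \<open>Bounds uniform in n: the sets of splits refer to N only. In the upper
            bound for the total ln n is replaced by ln N / 2, in the lower bound for the subsums by
            ln N; the ratio is the width of the sectors.\<close>
          define d0 d1 where "d0 = D * L powr (-c)" and "d1 = L powr (-c')"
          have d1: "d1 > 0" using L2 by (simp add: d1_def)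
          have dd: "d0 / d1 = D * L powr (-s)" using L2 by (simp add: d0_def d1_def s_def powr_diff[symmetric] flip: times_divide_eq_right)
          have sn: "sqrt (real n) \<ge> 0" by simp
          have tot: "cmod (\<Sum>i<l. z i) \<le> sqrt (real n) * d0"
          proof -
            have "ln (real n) powr (-c) \<le> (L / 2) powr (-c)" using lnn L2 c0 by (intro powr_mono2') auto
            also have "\<dots> = d0" using L2 by (simp add: d0_def D_def powr_divide powr_minus_divide field_simps)
            finally have "sqrt (real n) * ln (real n) powr (-c) \<le> sqrt (real n) * d0" using sn by (rule mult_left_mono)
            then show ?thesis using z(3) lnn1 unfolding c_def[symmetric] powr_minus_divide by simp
          qed
          have bigI: "sqrt (real n) * d1 \<le> cmod (\<Sum>i\<in>I. z i) \<or> sqrt (real n) * d1 \<le> cmod (\<Sum>i\<in>{..<l} - I. z i)"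
            if I: "I \<subseteq> {..<l}" "I \<noteq> {}" "I \<noteq> {..<l}" for I
          proof -
            have "L powr (-c') \<le> ln (real n) powr (-c')" using lnn' lnn1 c'0 by (intro powr_mono2') auto
            then have "sqrt (real n) * d1 \<le> sqrt (real n) * ln (real n) powr (-c')" unfolding d1_def using sn by (rule mult_left_mono)
            also have "\<dots> = sqrt (real n) / ln (real n) powr c_exp \<epsilon> (l div 2)"
              unfolding c'_def[symmetric] powr_minus_divide by simp
            finally have *: "sqrt (real n) * d1 \<le> sqrt (real n) / ln (real n) powr c_exp \<epsilon> (l div 2)" .
            have "n \<notin> bad \<epsilon> j" if "2 \<le> j" "j < l" for j using not nN that by auto
            from proper_subsums_large[OF \<epsilon> l nS lnn1 z(1) this z(2,3) I] show ?thesis using * by linarith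
          qed
          have OmW: "real (Om n) \<le> (1/2 + \<eta>) * ln L" using not nS nN by (auto simp: T1_def L_def)
          have OmT: "real (Om (smooth_part y2 n)) \<le> T"
            using not nS nN unfolding prime_factorization_part by (auto simp: T2_def L_def y2_def T_def)
          have nz: "(\<Sum>i<l. z i) \<noteq> 0" using z(2) by auto
          from split_dichotomy[OF nS z(1) y12 nz tot d1 bigI]
          consider (large) p k where "n = p * k" "k \<in> S1" "y2 < real p" "\<exists>u\<in>arcs l k. p \<in> sector u (d0 / d1)"
            | (medium) p k where "n = p * k" "k \<in> S1" "y1 < real p" "real p \<le> y2" "\<exists>u\<in>arcs l (smooth_part y2 k). p \<in> sector u (d0 / d1)"
            | (none) "1 \<le> sqrt (real (smooth_part y1 (smooth_part y2 n))) * d0" by blast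
          then show False
          proof cases
            case large
            then obtain u where u: "u \<in> arcs l k" "p \<in> sector u (D * L powr (-s))" unfolding dd by blast
            have pr: "prime p" using u(2) by (simp add: sector_def)
            have "Om k \<le> Om n" unfolding large(1) Om_prime_mult[OF pr S1_pos[OF large(2)]] by simp
            then have "real (Om k) \<le> (1/2 + \<eta>) * ln L" using OmW by linarith
            then have u': "u \<in> (if real (Om k) \<le> (1/2 + \<eta>) * ln (ln (real N)) then arcs l k else {})" using u(1) by (simp add: L_def)
            have pN: "p * k \<le> N" using nN large(1) by simp
            have "n \<in> R3 N \<or> n \<in> R4 N"
            proof (cases "real p \<le> sqrt (real N)")
              case True
              then have "n \<in> R3 N" unfolding R3_def using large(1-3) u(2) u' pN
                unfolding y2_def A_def L_def by blast
              then show ?thesis ..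
            next
              case False
              then have "n \<in> R4 N" unfolding R4_def using large(1-3) u(2) u' pN
                unfolding L_def not_le by blast
              then show ?thesis ..
            qed
            then show False using not by blast
          next
            case medium
            then obtain u where u: "u \<in> arcs l (smooth_part y2 k)" "p \<in> sector u (D * L powr (-s))" unfolding dd by blast
            have pr: "prime p" using u(2) by (simp add: sector_def)
            have "smooth_part y2 n = p * smooth_part y2 k"
              unfolding medium(1) by (rule part_prime_mult[of p "\<lambda>q. real q \<le> y2" k, OF pr medium(4) S1_pos[OF medium(2)]])
            then have "Om (smooth_part y2 k) \<le> Om (smooth_part y2 n)" using Om_prime_mult[OF pr part_pos] by simp
            then have "real (Om (smooth_part y2 k)) \<le> T" using OmT by linarith
            then have u': "u \<in> (if real (Om (smooth_part (ln (real N) powr A) k)) \<le> ln (ln (real N)) powr (1/4) then arcs l (smooth_part (ln (real N) powr A) k) else {})"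
              using u(1) by (simp add: L_def y2_def T_def)
            have pN: "p * k \<le> N" using nN medium(1) by simp
            have "n \<in> R2 N" unfolding R2_def
            proof (rule CollectI, rule exI[of _ p], rule exI[of _ k], intro conjI)
              show "exp (sqrt (ln (ln (real N)))) < real p" "real p \<le> ln (real N) powr A"
                using medium(3,4) by (auto simp: y1_def y2_def L_def)
              show "\<exists>u\<in>(if real (Om (smooth_part (ln (real N) powr A) k)) \<le> ln (ln (real N)) powr (1/4) then arcs l (smooth_part (ln (real N) powr A) k) else {}).
                p \<in> sector u (D * ln (real N) powr (-s))" using u' u(2) unfolding L_def by (rule bexI[rotated])
            qed (use medium(1,2) pN in auto)
            then show False using not by blast
          next
            case none
            define m where "m = smooth_part y2 n"
            have y1: "y1 \<ge> 1" using L2 by (simp add: y1_def)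
            \<comment> \<open>At most (ln ln N)^(1/4) primes, each at most exp((ln ln N)^(1/2)), so
              their product is at most exp((ln ln N)^(3/4)). This is a power of ln N with exponent
              tending to 0 and loses against (ln N)^(-c).\<close>
            have "real (smooth_part y1 m) \<le> y1 ^ Om m" by (rule smooth_part_le_power[OF y1])
            also have "\<dots> = exp (real (Om m) * sqrt (ln L))" by (simp add: y1_def exp_of_nat_mult)
            also have "\<dots> \<le> exp (T * sqrt (ln L))" using OmT L2 by (simp add: m_def mult_right_mono)
            also have "T * sqrt (ln L) = ln L powr (3/4)"
              using L2 by (simp add: T_def powr_half_sqrt[symmetric] powr_add[symmetric])
            finally have "sqrt (real (smooth_part y1 m)) \<le> sqrt (exp (ln L powr (3/4)))" by (rule real_sqrt_le_mono)
            also have "\<dots> = exp (ln L powr (3/4) / 2)"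
              by (rule real_sqrt_unique) (simp_all add: exp_double[symmetric])
            finally have "sqrt (real (smooth_part y1 m)) * d0 \<le> exp (ln L powr (3/4) / 2) * d0"
              using D1 by (intro mult_right_mono) (auto simp: d0_def)
            then show False using none e3 unfolding m_def d0_def by linarith
          qed
        qed
      qed
      have fW: "finite W" by (simp add: W_def)
      have fin: "finite (W \<union> (\<Union>j\<in>{2..<l}. bad \<epsilon> j \<inter> {1..N}) \<union> T1 N \<union> T2 N \<union> R2 N \<union> R3 N \<union> R4 N)"
      proof -
        have "R2 N \<subseteq> {..N}" "R3 N \<subseteq> {..N}" "R4 N \<subseteq> {..N}" unfolding R2_def R3_def R4_def by auto
        then have "finite (R2 N)" "finite (R3 N)" "finite (R4 N)" by (auto intro: finite_subset[OF _ finite_atMost])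
        then show ?thesis using fW by (auto simp: T1_def T2_def)
      qed
      have "card (bad \<epsilon> l \<inter> {1..N}) \<le> card (W \<union> (\<Union>j\<in>{2..<l}. bad \<epsilon> j \<inter> {1..N}) \<union> T1 N \<union> T2 N \<union> R2 N \<union> R3 N \<union> R4 N)"
        using fin sub by (rule card_mono)
      also have "\<dots> \<le> card W + (\<Sum>j\<in>{2..<l}. card (bad \<epsilon> j \<inter> {1..N})) + card (T1 N) + card (T2 N) + card (R2 N) + card (R3 N) + card (R4 N)"
        by (intro order_trans[OF card_Un_le] add_mono order_refl card_UN_le) auto
      finally have "real (card (bad \<epsilon> l \<inter> {1..N})) \<le> real (card W) + (\<Sum>j\<in>{2..<l}. real (card (bad \<epsilon> j \<inter> {1..N}))) + real (card (T1 N)) + real (card (T2 N)) +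
         real (card (R2 N)) + real (card (R3 N)) + real (card (R4 N))"
        unfolding of_nat_sum[symmetric] of_nat_add[symmetric] of_nat_le_iff .
      moreover have "real (card W) \<le> sqrt (real N)"
      proof -
        have "W \<subseteq> {1..nat \<lfloor>sqrt (real N)\<rfloor>}" by (auto simp: W_def le_nat_iff le_floor_iff)
        then have "card W \<le> card {1..nat \<lfloor>sqrt (real N)\<rfloor>}" by (intro card_mono) auto
        then have "card W \<le> nat \<lfloor>sqrt (real N)\<rfloor>" by simp
        moreover have "real (nat \<lfloor>sqrt (real N)\<rfloor>) \<le> sqrt (real N)" by simp
        ultimately show ?thesis by linarith
      qed
      ultimately show "real (card (bad \<epsilon> l \<inter> {1..N})) \<le> F N" by (simp add: F_def)
    qed simp
  qed
qed

section \<open>Translation back to lattice points and relative density\<close>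

lemma G_nonempty: "n \<in> S1 \<Longrightarrow> G n \<noteq> {}"
proof (induction n rule: less_induct)
  case (less n)
  show ?case
  proof (cases "n = 1")
    case False
    then obtain p where p: "prime p" "p dvd n" using prime_factor_nat by blast
    then have p4: "p mod 4 = 1" using less.prems by (auto simp: S1_def)
    obtain m where m: "n = p * m" using p by (auto elim: dvdE)
    have mS: "m \<in> S1" using less.prems unfolding m S1_mult_iff by simp
    have "m < n" unfolding m using S1_pos[OF mS] prime_gt_1_nat[OF p(1)] by simp
    then obtain w where "w \<in> G m" using less.IH mS by blast
    then have "gp p * w \<in> G n" unfolding m using gp_in_G(1)[OF p(1) p4] by (rule G_mult[rotated])
    then show ?thesis by blast
  qed (use one_in_G in auto)
qed

lemma sums_two_squares'_eq_S1: "sums_two_squares' = S1"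
proof (intro equalityI subsetI)
  fix n assume n: "n \<in> sums_two_squares'"
  have pm: "p mod 4 = 1" if "prime p" "p dvd n" for p
    using n that by (auto simp: sums_two_squares'_def cong_def)
  moreover have "n > 0"
  proof (rule Nat.gr0I)
    assume "n = 0"
    then have "2 mod 4 = (1 :: nat)" using pm[of 2] by simp
    then show False by simp
  qed
  ultimately show "n \<in> S1" by (simp add: S1_def)
next
  fix n assume n: "n \<in> S1"
  then obtain z where z: "z \<in> G n" using G_nonempty by blast
  then obtain x y where xy: "Re z = of_int x" "Im z = of_int y" by (auto simp: G_def gint_def elim!: Ints_cases)
  have "real_of_int (x\<^sup>2 + y\<^sup>2) = real_of_int (int n)" using z xy by (simp add: G_def cmod_power2)
  then have "x\<^sup>2 + y\<^sup>2 = int n" by (simp only: of_int_eq_iff)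
  then have "n \<in> sums_two_squares" unfolding sums_two_squares_def by (intro CollectI exI[of _ x] exI[of _ y]) simp
  then show "n \<in> sums_two_squares'" using n by (auto simp: sums_two_squares'_def S1_def cong_def)
qed

definition to_complex :: "int \<times> int \<Rightarrow> complex" where
  "to_complex v = Complex (of_int (fst v)) (of_int (snd v))"

lemma cmod_to_complex: "cmod (to_complex v) = lattice_norm v"
  by (simp add: to_complex_def lattice_norm_def norm_Pair cmod_def)

lemma to_complex_sum: "to_complex (\<Sum>i\<in>I. f i) = (\<Sum>i\<in>I. to_complex (f i))"
  by (simp add: to_complex_def complex_eq_iff fst_sum snd_sum)

lemma quasi_corr_bad:
  assumes "n \<in> S1" "quasi_corr l n (sqrt (real n) / ln (real n) powr c_exp \<epsilon> l) \<noteq> {}"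
  shows "n \<in> bad \<epsilon> l"
proof -
  obtain \<xi> where \<xi>: "\<forall>i<l. (lattice_norm (\<xi> ! i))\<^sup>2 = real n"
    "0 < lattice_norm (\<Sum>i<l. \<xi> ! i)" "lattice_norm (\<Sum>i<l. \<xi> ! i) \<le> sqrt (real n) / ln (real n) powr c_exp \<epsilon> l"
    using assms(2) by (auto simp: quasi_corr_def)
  define z where "z i = to_complex (\<xi> ! i)" for i
  have "z i \<in> G n" if "i < l" for i
    using \<xi>(1) that unfolding z_def G_def by (simp add: cmod_to_complex) (simp add: gint_def to_complex_def)
  moreover have "cmod (\<Sum>i<l. z i) = lattice_norm (\<Sum>i<l. \<xi> ! i)"
    unfolding z_def to_complex_sum[symmetric] by (rule cmod_to_complex)
  ultimately show ?thesis unfolding bad_def using assms(1) \<xi>(2,3) by (intro CollectI conjI exI[of _ z]) auto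
qed

theorem theorem2p1:
  fixes l :: nat and \<epsilon> :: real
  assumes "l \<ge> 2" and "\<epsilon> > 0"
  shows "\<exists>A. relative_density_one A sums_two_squares' \<and>
           (\<forall>n\<in>A. quasi_corr l n (sqrt (real n) / ln (real n) powr c_exp \<epsilon> l) = {})"
proof -
  define A where "A = {n \<in> S1. quasi_corr l n (sqrt (real n) / ln (real n) powr c_exp \<epsilon> l) = {}}"
  obtain c N0 where c: "c > 0" "\<And>N. N \<ge> N0 \<Longrightarrow> c * real N / sqrt (ln (real N)) \<le> real (card (S1 \<inter> {1..N}))"
    using S1_count_lower by blast
  have b: "small (\<lambda>N. real (card (bad \<epsilon> l \<inter> {1..N})))" using bad_small[OF assms(2,1)] .
  let ?r = "\<lambda>N. real (card (A \<inter> {1..N})) / real (card (S1 \<inter> {1..N}))"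
  have "?r \<longlonglongrightarrow> 1"
  proof (rule tendsto_sandwich[OF _ _ _ tendsto_const])
    show "(\<lambda>N. 1 - (1 / c) * (real (card (bad \<epsilon> l \<inter> {1..N})) * sqrt (ln (real N)) / real N)) \<longlonglongrightarrow> 1"
      using tendsto_diff[OF tendsto_const tendsto_mult_right_zero[OF b[unfolded small_def], of "1 / c"], of 1] by simp
    show "eventually (\<lambda>N. ?r N \<le> 1) sequentially"
    proof (rule always_eventually, rule allI)
      fix N
      have "card (A \<inter> {1..N}) \<le> card (S1 \<inter> {1..N})" by (intro card_mono) (auto simp: A_def)
      moreover have "real a / real b \<le> 1" if "a \<le> b" for a b :: nat
        using that by (cases "b = 0") auto
      ultimately show "?r N \<le> 1" by blast
    qed
    \<comment> \<open>The lower bound for the counting function of \<open>S1\<close> enters here: it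
      converts smallness relative to N / sqrt(ln N) into smallness relative to
      \<open>S1\<close>.\<close>
    show "eventually (\<lambda>N. 1 - (1 / c) * (real (card (bad \<epsilon> l \<inter> {1..N})) * sqrt (ln (real N)) / real N) \<le> ?r N) sequentially"
      using eventually_ge_at_top[of "max N0 2"]
    proof eventually_elim
      case (elim N)
      define S B where "S = real (card (S1 \<inter> {1..N}))" and "B = real (card (bad \<epsilon> l \<inter> {1..N}))"
      have l0: "sqrt (ln (real N)) > 0" using elim by simp
      have cs: "c * real N / sqrt (ln (real N)) \<le> S" using c(2)[of N] elim by (simp add: S_def)
      have pos: "c * real N / sqrt (ln (real N)) > 0" using c(1) l0 elim by simp
      \<comment> \<open>By \<open>quasi_corr_bad\<close> a member of \<open>S1\<close> outside A is
        bad.\<close>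
      have "card (S1 \<inter> {1..N}) \<le> card ((A \<inter> {1..N}) \<union> (bad \<epsilon> l \<inter> {1..N}))"
        using quasi_corr_bad[of _ l \<epsilon>] by (intro card_mono) (auto simp: A_def)
      also have "\<dots> \<le> card (A \<inter> {1..N}) + card (bad \<epsilon> l \<inter> {1..N})" by (rule card_Un_le)
      finally have "S \<le> real (card (A \<inter> {1..N})) + B" by (simp add: S_def B_def)
      then have "(S - B) / S \<le> real (card (A \<inter> {1..N})) / S" using pos cs by (intro divide_right_mono) auto
      then have "1 - B / S \<le> real (card (A \<inter> {1..N})) / S" using pos cs by (simp add: diff_divide_distrib)
      moreover have "B / S \<le> B / (c * real N / sqrt (ln (real N)))"
        using cs pos by (intro frac_le) (auto simp: B_def)
      moreover have "B / (c * real N / sqrt (ln (real N))) = (1 / c) * (B * sqrt (ln (real N)) / real N)" by simp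
      ultimately show ?case unfolding S_def B_def by linarith
    qed
  qed
  \<comment> \<open>Both counting functions are constant between consecutive integers, so the limit
    along integers gives the limit along real X through the floor.\<close>
  then have "((\<lambda>X :: real. ?r (nat \<lfloor>X\<rfloor>)) \<longlongrightarrow> 1) at_top"
    by (rule filterlim_compose) (intro filterlim_compose[OF filterlim_nat_sequentially] filterlim_floor_sequentially)
  moreover have "{n \<in> B. real n \<le> X} = B \<inter> {1..nat \<lfloor>X\<rfloor>}" if "B \<subseteq> S1" for B X
  proof -
    have "real n \<le> X \<longleftrightarrow> n \<in> {1..nat \<lfloor>X\<rfloor>}" if "n > 0" for n
    proof
      assume "n \<in> {1..nat \<lfloor>X\<rfloor>}"
      then have "1 \<le> nat \<lfloor>X\<rfloor>" "real n \<le> real (nat \<lfloor>X\<rfloor>)" by auto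
      then show "real n \<le> X" by linarith
    qed (use that le_nat_floor in auto)
    then show ?thesis using that S1_pos by blast
  qed
  moreover have "A \<subseteq> S1" by (auto simp: A_def)
  ultimately have "relative_density_one A sums_two_squares'"
    unfolding relative_density_one_def sums_two_squares'_eq_S1 by simp
  then show ?thesis by (intro exI[of _ A]) (auto simp: A_def)
qed

end
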